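(* Let $\theta\ge1$, let $A$ be a $\theta$-SDD matrix of size $n$, and let $0<\varepsilon<1/2$. There is an algorithm that, given $A$ and $\varepsilon$, outputs a matrix $\widetilde A\in\mathbb{R}^{n\times n}$ with at most $\mathcal{O}(n\theta/\varepsilon^2)$ non-zero entries such that $\|A-\widetilde A\|\le\varepsilon\|A\|$. Moreover, the algorithm computes $\widetilde A$ in deterministic $\widetilde{\mathcal{O}}(\mathrm{nnz}(A)\,n^2\theta\log^3n/\varepsilon^2+n^4\theta^2\log n/\varepsilon^4)$ time.
   Context: $\|\cdot\|$ is the operator norm, $\|A\|_\infty=\max_i\sum_j|A_{ij}|$, and $\mathrm{nnz}(A)$ is the number of non-zero entries of $A$. A real matrix $A$ is $\theta$-SDD if $A$ is symmetric and $\|A\|_\infty\le\sqrt\theta\,\|A\|$. The $\widetilde{\mathcal{O}}(\cdot)$ notation hides $\log\log n$ and $\log\log(1/\varepsilon)$ factors. *)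

theory Defs
  imports Complex_Main "Jordan_Normal_Form.Matrix"
begin

section \<open>Matrix notions\<close>

definition vec_norm2 :: "real vec \<Rightarrow> real" where
  "vec_norm2 v = sqrt (v \<bullet> v)"

text \<open>The unit ball (rather than the unit sphere) is used so that the supremum is
  over a nonempty set also in dimension 0.\<close>

definition op_norm :: "real mat \<Rightarrow> real" where
  "op_norm A = (SUP v \<in> {v \<in> carrier_vec (dim_col A). vec_norm2 v \<le> 1}. vec_norm2 (A *\<^sub>v v))"

text \<open>Only meaningful for matrices with at least one row.\<close>

definition inf_norm :: "real mat \<Rightarrow> real" where
  "inf_norm A = Max ((\<lambda>i. \<Sum>j<dim_col A. \<bar>A $$ (i, j)\<bar>) ` {..<dim_row A})"

definition nnz :: "real mat \<Rightarrow> nat" where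
  "nnz A = card {(i, j). i < dim_row A \<and> j < dim_col A \<and> A $$ (i, j) \<noteq> 0}"

definition sdd :: "real \<Rightarrow> real mat \<Rightarrow> bool" where
  "sdd \<theta> A \<longleftrightarrow> transpose_mat A = A \<and> inf_norm A \<le> sqrt \<theta> * op_norm A"


section \<open>Real-RAM programs\<close>

text \<open>
  Algorithms are programs of a deterministic real RAM: the memory consists of natural-number
  (index) and real variables, and of unbounded arrays of both kinds with two indices.
  Unit-cost operations are exact field operations and comparisons on reals, and addition,
  truncated subtraction and comparison on indices. There is neither a
  floor function from reals to indices nor a root, exponential or logarithm, and program
  constants are rational, so that no information can be hidden in real constants.
  The four memory components have separate name spaces; a program mentions only finitely many names.
\<close>

type_synonym name = string

datatype iexp =
    IConst nat
  | IVar name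
  | IEntry name iexp iexp
  | IAdd iexp iexp
  | ISub iexp iexp

datatype rexp =
    RConst rat
  | RVar name
  | REntry name iexp iexp
  | ROfIndex iexp
  | RAdd rexp rexp
  | RSub rexp rexp
  | RMul rexp rexp
  | RDiv rexp rexp

datatype test =
    ILess iexp iexp
  | RLess rexp rexp
  | Neg test
  | Conj test test

datatype com =
    Skip
  | IAssign name iexp
  | IStore name iexp iexp iexp
  | RAssign name rexp
  | RStore name iexp iexp rexp
  | Seq com com
  | Cond test com com
  | While test com

record state =
  ivar :: "name \<Rightarrow> nat"
  iarr :: "name \<Rightarrow> nat \<Rightarrow> nat \<Rightarrow> nat"
  rvar :: "name \<Rightarrow> real"
  rarr :: "name \<Rightarrow> nat \<Rightarrow> nat \<Rightarrow> real"

primrec ival :: "iexp \<Rightarrow> state \<Rightarrow> nat" where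
  "ival (IConst c) s = c"
| "ival (IVar x) s = ivar s x"
| "ival (IEntry x a b) s = iarr s x (ival a s) (ival b s)"
| "ival (IAdd a b) s = ival a s + ival b s"
| "ival (ISub a b) s = ival a s - ival b s"

text \<open>Division by zero yields 0; a program can test for a zero divisor beforehand.\<close>

primrec rval :: "rexp \<Rightarrow> state \<Rightarrow> real" where
  "rval (RConst c) s = of_rat c"
| "rval (RVar x) s = rvar s x"
| "rval (REntry x a b) s = rarr s x (ival a s) (ival b s)"
| "rval (ROfIndex a) s = real (ival a s)"
| "rval (RAdd a b) s = rval a s + rval b s"
| "rval (RSub a b) s = rval a s - rval b s"
| "rval (RMul a b) s = rval a s * rval b s"
| "rval (RDiv a b) s = rval a s / rval b s"

primrec tval :: "test \<Rightarrow> state \<Rightarrow> bool" where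
  "tval (ILess a b) s \<longleftrightarrow> ival a s < ival b s"
| "tval (RLess a b) s \<longleftrightarrow> rval a s < rval b s"
| "tval (Neg b) s \<longleftrightarrow> \<not> tval b s"
| "tval (Conj b c) s \<longleftrightarrow> tval b s \<and> tval c s"

text \<open>The cost of an expression is the number of its operations, memory reads and constants.\<close>

primrec icost :: "iexp \<Rightarrow> nat" where
  "icost (IConst c) = 1"
| "icost (IVar x) = 1"
| "icost (IEntry x a b) = icost a + icost b + 1"
| "icost (IAdd a b) = icost a + icost b + 1"
| "icost (ISub a b) = icost a + icost b + 1"

primrec rcost :: "rexp \<Rightarrow> nat" where
  "rcost (RConst c) = 1"
| "rcost (RVar x) = 1"
| "rcost (REntry x a b) = icost a + icost b + 1"
| "rcost (ROfIndex a) = icost a + 1"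
| "rcost (RAdd a b) = rcost a + rcost b + 1"
| "rcost (RSub a b) = rcost a + rcost b + 1"
| "rcost (RMul a b) = rcost a + rcost b + 1"
| "rcost (RDiv a b) = rcost a + rcost b + 1"

primrec tcost :: "test \<Rightarrow> nat" where
  "tcost (ILess a b) = icost a + icost b + 1"
| "tcost (RLess a b) = rcost a + rcost b + 1"
| "tcost (Neg b) = tcost b + 1"
| "tcost (Conj b c) = tcost b + tcost c + 1"

definition iupd :: "name \<Rightarrow> nat \<Rightarrow> state \<Rightarrow> state" where
  "iupd x v s = s\<lparr>ivar := (ivar s)(x := v)\<rparr>"

definition rupd :: "name \<Rightarrow> real \<Rightarrow> state \<Rightarrow> state" where
  "rupd x v s = s\<lparr>rvar := (rvar s)(x := v)\<rparr>"

definition istore :: "name \<Rightarrow> nat \<Rightarrow> nat \<Rightarrow> nat \<Rightarrow> state \<Rightarrow> state" where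
  "istore x i j v s = s\<lparr>iarr := (iarr s)(x := (iarr s x)(i := (iarr s x i)(j := v)))\<rparr>"

definition rstore :: "name \<Rightarrow> nat \<Rightarrow> nat \<Rightarrow> real \<Rightarrow> state \<Rightarrow> state" where
  "rstore x i j v s = s\<lparr>rarr := (rarr s)(x := (rarr s x)(i := (rarr s x i)(j := v)))\<rparr>"

text \<open>\<open>exec c s t s'\<close>: started in \<open>s\<close>, program \<open>c\<close> halts in \<open>s'\<close> after \<open>t\<close> time units.\<close>

inductive exec :: "com \<Rightarrow> state \<Rightarrow> nat \<Rightarrow> state \<Rightarrow> bool" where
  Skip: "exec Skip s 1 s"
| IAssign: "exec (IAssign x a) s (icost a + 1) (iupd x (ival a s) s)"
| IStore: "exec (IStore x a b e) s (icost a + icost b + icost e + 1)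
    (istore x (ival a s) (ival b s) (ival e s) s)"
| RAssign: "exec (RAssign x e) s (rcost e + 1) (rupd x (rval e s) s)"
| RStore: "exec (RStore x a b e) s (icost a + icost b + rcost e + 1)
    (rstore x (ival a s) (ival b s) (rval e s) s)"
| Seq: "exec c s t s' \<Longrightarrow> exec d s' u s'' \<Longrightarrow> exec (Seq c d) s (t + u) s''"
| CondTrue: "tval b s \<Longrightarrow> exec c s t s' \<Longrightarrow> exec (Cond b c d) s (tcost b + t) s'"
| CondFalse: "\<not> tval b s \<Longrightarrow> exec d s t s' \<Longrightarrow> exec (Cond b c d) s (tcost b + t) s'"
| WhileFalse: "\<not> tval b s \<Longrightarrow> exec (While b c) s (tcost b) s"
| WhileTrue: "tval b s \<Longrightarrow> exec c s t s' \<Longrightarrow> exec (While b c) s' u s'' \<Longrightarrow>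
    exec (While b c) s (tcost b + t + u) s''"

inductive_cases SkipE: "exec Skip s t s'"
inductive_cases IAssignE: "exec (IAssign x a) s t s'"
inductive_cases IStoreE: "exec (IStore x a b e) s t s'"
inductive_cases RAssignE: "exec (RAssign x e) s t s'"
inductive_cases RStoreE: "exec (RStore x a b e) s t s'"
inductive_cases SeqE: "exec (Seq c d) s t s'"
inductive_cases CondE: "exec (Cond b c d) s t s'"
inductive_cases WhileE: "exec (While b c) s t s'"

lemma exec_deterministic:
  assumes "exec c s t s'" and "exec c s u r"
  shows "u = t \<and> r = s'"
  using assms
proof (induction arbitrary: u r rule: exec.induct)
  case (WhileTrue b s c t s' u' s'')
  from WhileTrue.prems WhileTrue.hyps(1) obtain t1 r1 u1 where
    "exec c s t1 r1" "exec (While b c) r1 u1 r" "u = tcost b + t1 + u1"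
    by (blast elim: WhileE)
  with WhileTrue.IH show ?case by blast
next
  case (WhileFalse b s c)
  then show ?case by (blast elim: WhileE)
next
  case (Seq c s t s' d u' s'')
  from Seq.prems obtain t1 r1 u1 where
    "exec c s t1 r1" "exec d r1 u1 r" "u = t1 + u1"
    by (blast elim: SeqE)
  with Seq.IH show ?case by blast
next
  case (CondTrue b s c t s' d)
  from CondTrue.prems CondTrue.hyps(1) obtain t1 where "exec c s t1 r" "u = tcost b + t1"
    by (blast elim: CondE)
  with CondTrue.IH show ?case by blast
next
  case (CondFalse b s d t s' c)
  from CondFalse.prems CondFalse.hyps(1) obtain t1 where "exec d s t1 r" "u = tcost b + t1"
    by (blast elim: CondE)
  with CondFalse.IH show ?case by blast
qed (auto elim: SkipE IAssignE IStoreE RAssignE RStoreE)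

definition input_state :: "nat \<Rightarrow> real mat \<Rightarrow> real \<Rightarrow> state" where
  "input_state n A \<epsilon> = \<lparr>
     ivar = (\<lambda>x. if x = ''n'' then n else 0),
     iarr = (\<lambda>x i j. 0),
     rvar = (\<lambda>x. if x = ''eps'' then \<epsilon> else 0),
     rarr = (\<lambda>x i j. if x = ''A'' \<and> i < n \<and> j < n then A $$ (i, j) else 0)\<rparr>"

definition output_mat :: "nat \<Rightarrow> state \<Rightarrow> real mat" where
  "output_mat n s = mat n n (\<lambda>(i, j). rarr s ''B'' i j)"

text \<open>On input \<open>A\<close> (of size \<open>n\<close>) and \<open>\<epsilon>\<close>, program \<open>P\<close> halts after \<open>t\<close> time units with output \<open>B\<close>.\<close>

definition computes :: "com \<Rightarrow> nat \<Rightarrow> real mat \<Rightarrow> real \<Rightarrow> nat \<Rightarrow> real mat \<Rightarrow> bool" where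
  "computes P n A \<epsilon> t B \<longleftrightarrow> (\<exists>s. exec P (input_state n A \<epsilon>) t s \<and> B = output_mat n s)"


section \<open>Running time\<close>

text \<open>
  \<open>log 2 (n + 1)\<close> stands for \<open>log n\<close>: both agree up to constant factors for \<open>n \<ge> 2\<close>,
  but the former is positive also for \<open>n = 1\<close>.
  The factors hidden in the soft-O are bounded by a power of \<open>hidden_factor\<close>, which is at
  least 1 for \<open>n \<ge> 1\<close> and \<open>0 < \<epsilon> < 1/2\<close>.
\<close>

definition lg :: "nat \<Rightarrow> real" where
  "lg n = log 2 (real n + 1)"

definition hidden_factor :: "nat \<Rightarrow> real \<Rightarrow> real" where
  "hidden_factor n \<epsilon> = 1 + log 2 (lg n) + log 2 (log 2 (1 / \<epsilon>))"

end

theory Submission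
  imports Defs
begin

text \<open>
  The algorithm is a two-sided barrier argument in the style of Batson, Spielman and Srivastava.
  Let \<open>R = \<parallel>A\<parallel>\<^sub>\<infinity>\<close>, let \<open>D\<close> be the diagonal matrix of the absolute row sums of \<open>A\<close>, and put
  \<open>M = A + D\<close>. With \<open>v\<^sub>i\<^sub>j = e\<^sub>i + sgn(A\<^sub>i\<^sub>j) e\<^sub>j\<close> one has \<open>M = \<Sum>\<^sub>i\<^sub>j \<bar>A\<^sub>i\<^sub>j\<bar>/2 v\<^sub>i\<^sub>j v\<^sub>i\<^sub>j\<^sup>T\<close>, hence \<open>0 \<le> M \<le> 2R\<close>.
  In \<open>T\<close> steps a sum \<open>G\<close> of \<open>T\<close> terms \<open>s v\<^sub>i\<^sub>j v\<^sub>i\<^sub>j\<^sup>T\<close> is built such that \<open>X = G - (k/T) M\<close> stays strictly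
  between the barriers \<open>-u\<^sub>k\<close> and \<open>u\<^sub>k\<close> after \<open>k\<close> steps, where \<open>u\<^sub>k = u + k \<eta>\<close>, while
  \<open>tr (u\<^sub>k - X)\<^sup>-\<^sup>1\<close> and \<open>tr (u\<^sub>k + X)\<^sup>-\<^sup>1\<close> never exceed \<open>n/u\<close>.
  Averaging over the pairs with weights \<open>\<bar>A\<^sub>i\<^sub>j\<bar>/2\<close> shows that an admissible pair exists
  as soon as \<open>\<eta> = 6 R\<^sup>2 n / (u T\<^sup>2)\<close>. With \<open>T\<close> about \<open>6 R\<^sup>2 n / u\<^sup>2 = O(n \<theta> / \<epsilon>\<^sup>2)\<close> the barrier at most doubles,
  so the output \<open>B = G - D\<close> satisfies \<open>\<parallel>A - B\<parallel> = \<parallel>G - M\<parallel> \<le> 2u\<close>, and \<open>B\<close> has at most \<open>4T + n\<close> non-zero entries.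
  A step costs \<open>O(n\<^sup>3)\<close>: two inversions by Gauss--Jordan elimination and the evaluation of all pairs.
  The parameter \<open>u\<close> needs \<open>\<parallel>A\<parallel>\<close> up to a constant factor, which is read off from
  \<open>\<parallel>A\<parallel>\<^sup>2\<^sup>n \<le> \<parallel>A\<^sup>n\<parallel>\<^sub>F\<^sup>2 \<le> n \<parallel>A\<parallel>\<^sup>2\<^sup>n\<close> by repeatedly halving \<open>R\<close>.
\<close>

section \<open>Quadratic forms and inverses\<close>

text \<open>Why \<open>A\<close> is not treated directly: the barrier method adds positive rank-one
  terms, and \<open>A\<close> is indefinite. Adding D makes the target a positive combination of the
  v v^T; being diagonal, D costs only n entries when it is taken off again.

  Where \<eta> comes from: let H, K be the inverses at the two barriers after M/T has been
  subtracted and the barriers widened. The upper trace then has some slack \<open>al\<close>, the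
  lower one some slack \<open>al'\<close>, possibly negative. A term s v v^T with 1/s = |H v|^2/al +
  v^T H v spends exactly \<open>al\<close>; the pair is admissible if the same term makes up the
  lower deficit. If every pair failed, averaging together with tr(M H) \<le> 2 R \<Phi> and tr(M K)
  \<le> 4 R \<Phi>, \<Phi> = n/u, would force \<eta>/R < 6 R \<Phi>/T^2; the chosen \<eta> is the
  case of equality. The 6 is 2 + 4, the 4 arising because the subtraction of M/T may double the
  lower trace.

  The machine has no roots and no rounding, so T is found by counting and the norm by comparing
  powers. A factor 4 of uncertainty in the norm is harmless, since u enters the bounds only up to a
  constant.\<close>

definition bf :: "nat \<Rightarrow> (nat \<Rightarrow> nat \<Rightarrow> real) \<Rightarrow> (nat \<Rightarrow> real) \<Rightarrow> (nat \<Rightarrow> real) \<Rightarrow> real" where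
  "bf n P x y = (\<Sum>i<n. \<Sum>j<n. x i * P i j * y j)"

definition ip :: "nat \<Rightarrow> (nat \<Rightarrow> real) \<Rightarrow> (nat \<Rightarrow> real) \<Rightarrow> real" where
  "ip n x y = (\<Sum>i<n. x i * y i)"

definition sym_on :: "nat \<Rightarrow> (nat \<Rightarrow> nat \<Rightarrow> real) \<Rightarrow> bool" where
  "sym_on n P \<longleftrightarrow> (\<forall>i<n. \<forall>j<n. P i j = P j i)"

definition psd :: "nat \<Rightarrow> (nat \<Rightarrow> nat \<Rightarrow> real) \<Rightarrow> bool" where
  "psd n P \<longleftrightarrow> sym_on n P \<and> (\<forall>x. 0 \<le> bf n P x x)"

definition pd :: "nat \<Rightarrow> (nat \<Rightarrow> nat \<Rightarrow> real) \<Rightarrow> bool" where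
  "pd n P \<longleftrightarrow> sym_on n P \<and> (\<forall>x. (\<exists>i<n. x i \<noteq> 0) \<longrightarrow> 0 < bf n P x x)"

text \<open>Only \<open>H P = I\<close> is asked for: this is what row elimination delivers, and it
  is the side on which the rows of \<open>H\<close> meet the form \<open>P\<close>.\<close>

definition inverse_on :: "nat \<Rightarrow> (nat \<Rightarrow> nat \<Rightarrow> real) \<Rightarrow> (nat \<Rightarrow> nat \<Rightarrow> real) \<Rightarrow> bool" where
  "inverse_on n P H \<longleftrightarrow> (\<forall>i<n. \<forall>j<n. (\<Sum>l<n. H i l * P l j) = (if i = j then 1 else 0))"

definition tr :: "nat \<Rightarrow> (nat \<Rightarrow> nat \<Rightarrow> real) \<Rightarrow> real" where
  "tr n H = (\<Sum>i<n. H i i)"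

text \<open>The row vector v^T H. It is this product that pairs with \<open>P\<close> in
  \<open>bf_vm_inverse\<close> for a left inverse; for symmetric \<open>H\<close> it equals H
  v.\<close>

definition vm :: "nat \<Rightarrow> (nat \<Rightarrow> real) \<Rightarrow> (nat \<Rightarrow> nat \<Rightarrow> real) \<Rightarrow> nat \<Rightarrow> real" where
  "vm n v H k = (\<Sum>i<n. v i * H i k)"

lemma bf_cong:
  assumes "\<And>i j. i < n \<Longrightarrow> j < n \<Longrightarrow> P i j = P' i j" "\<And>i. i < n \<Longrightarrow> x i = x' i" "\<And>i. i < n \<Longrightarrow> y i = y' i"
  shows "bf n P x y = bf n P' x' y'"
  unfolding bf_def using assms by (intro sum.cong) auto

lemma bf_add_left: "bf n P (\<lambda>i. x i + y i) z = bf n P x z + bf n P y z"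
  by (simp add: bf_def algebra_simps sum.distrib)
lemma bf_scale_left: "bf n P (\<lambda>i. c * x i) z = c * bf n P x z"
  by (simp add: bf_def sum_distrib_left mult.assoc)
lemma bf_add_right: "bf n P z (\<lambda>i. x i + y i) = bf n P z x + bf n P z y"
  by (simp add: bf_def algebra_simps sum.distrib)
lemma bf_scale_right: "bf n P z (\<lambda>i. c * x i) = c * bf n P z x"
  by (simp add: bf_def sum_distrib_left mult_ac)
lemma bf_add_mat: "bf n (\<lambda>i j. P i j + Q i j) x y = bf n P x y + bf n Q x y"
  by (simp add: bf_def algebra_simps sum.distrib)
lemma bf_scale_mat: "bf n (\<lambda>i j. c * P i j) x y = c * bf n P x y"
  by (simp add: bf_def sum_distrib_left mult_ac)
lemma bf_id: "bf n (\<lambda>i j. if i = j then u else 0) x y = u * ip n x y"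
proof -
  have "bf n (\<lambda>i j. if i = j then u else 0) x y = (\<Sum>i<n. \<Sum>j<n. if i = j then x i * u * y j else 0)"
    unfolding bf_def by (intro sum.cong refl) auto
  also have "\<dots> = u * ip n x y" by (simp add: ip_def sum_distrib_left mult_ac)
  finally show ?thesis .
qed
lemma bf_rank1: "bf n (\<lambda>i j. v i * v j) x y = ip n v x * ip n v y"
  by (simp add: bf_def ip_def sum_product mult_ac)

lemma ip_unit: "i < n \<Longrightarrow> ip n x (\<lambda>k. if k = i then 1 else 0) = x i"
  by (simp add: ip_def if_distrib[of "(*) _"] cong: if_cong)

lemma bf_unit_right:
  assumes "j < n" shows "bf n P x (\<lambda>k. if k = j then 1 else 0) = (\<Sum>i<n. x i * P i j)"
  using assms by (simp add: bf_def if_distrib[of "(*) _"] cong: if_cong)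

lemma bf_unit:
  assumes "i < n" "j < n"
  shows "bf n P (\<lambda>k. if k = i then 1 else 0) (\<lambda>k. if k = j then 1 else 0) = P i j"
proof -
  have "(\<Sum>k<n. (if k = i then 1 else 0) * P k j) = (\<Sum>k<n. if k = i then P k j else 0)"
    by (intro sum.cong) auto
  then show ?thesis using assms by (simp add: bf_unit_right)
qed

lemma ip_commute: "ip n x y = ip n y x"
  by (simp add: ip_def mult.commute)
lemma ip_self_nonneg: "0 \<le> ip n x x"
  by (simp add: ip_def sum_nonneg)

lemma bf_commute: assumes "sym_on n P" shows "bf n P x y = bf n P y x"
proof -
  have "bf n P x y = (\<Sum>j<n. \<Sum>i<n. x i * P i j * y j)"
    unfolding bf_def by (rule sum.swap)
  also have "\<dots> = bf n P y x"
    unfolding bf_def using assms by (intro sum.cong refl) (auto simp: sym_on_def)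
  finally show ?thesis .
qed

lemma pd_imp_psd: assumes "pd n P" shows "psd n P"
proof -
  have "0 \<le> bf n P x x" for x
  proof (cases "\<exists>i<n. x i \<noteq> 0")
    case True then show ?thesis using assms by (auto simp: pd_def less_imp_le)
  next
    case False then have "bf n P x x = 0" by (simp add: bf_def)
    then show ?thesis by simp
  qed
  then show ?thesis using assms by (auto simp: psd_def pd_def)
qed

section \<open>Cauchy-Schwarz inequalities\<close>

lemma discriminant_nonpos:
  fixes a b c :: real
  assumes "\<And>t. 0 \<le> a + 2 * t * b + t\<^sup>2 * c" "0 \<le> c"
  shows "b\<^sup>2 \<le> a * c"
proof (cases "c = 0")
  case True
  show ?thesis
  proof (rule ccontr)
    assume "\<not> ?thesis"
    then have b: "b \<noteq> 0" using True by auto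
    \<comment> \<open>With c = 0 the polynomial is affine in t with nonzero slope; this t gives it
      the value -1.\<close>
    have "0 \<le> a + 2 * (- (a + 1) / (2 * b)) * b" using assms(1)[of "- (a + 1) / (2 * b)"] True by simp
    also have "\<dots> = -1" using b by (simp add: field_simps)
    finally show False by simp
  qed
next
  case False
  then have c: "c > 0" using assms by auto
  have "0 \<le> a + 2 * (- b / c) * b + (- b / c)\<^sup>2 * c" using assms(1) .
  also have "\<dots> = a - b\<^sup>2 / c" using c by (simp add: field_simps power2_eq_square)
  finally show ?thesis using c by (simp add: field_simps)
qed

lemma psd_Cauchy_Schwarz:
  assumes "psd n P" shows "(bf n P x y)\<^sup>2 \<le> bf n P x x * bf n P y y"
proof (rule discriminant_nonpos)
  fix t
  have "0 \<le> bf n P (\<lambda>i. x i + t * y i) (\<lambda>i. x i + t * y i)" using assms by (auto simp: psd_def)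
  also have "\<dots> = bf n P x x + 2 * t * bf n P x y + t\<^sup>2 * bf n P y y"
    using bf_commute[of n P x y] assms
    by (simp add: psd_def bf_add_left bf_add_right bf_scale_left bf_scale_right power2_eq_square algebra_simps)
  finally show "0 \<le> \<dots>" .
qed (use assms in \<open>auto simp: psd_def\<close>)

lemma ip_Cauchy_Schwarz: "(ip n x y)\<^sup>2 \<le> ip n x x * ip n y y"
proof -
  have p: "psd n (\<lambda>i j. if i = j then 1 else 0)"
    by (auto simp: psd_def sym_on_def bf_id ip_self_nonneg)
  show ?thesis using psd_Cauchy_Schwarz[OF p, of x y] by (simp add: bf_id)
qed

text \<open>\<open>H P = I\<close> makes row i of \<open>H\<close> represent the functional y -> y i
  for the form \<open>P\<close>. With y = \<open>H i\<close> it yields \<open>H i i\<close> as the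
  value of the form at that row, the identity behind all trace estimates.\<close>

lemma bf_inverse_row:
  assumes "inverse_on n P H" "i < n" shows "bf n P (H i) y = y i"
proof -
  have "bf n P (H i) y = (\<Sum>b<n. \<Sum>a<n. H i a * P a b * y b)" unfolding bf_def by (rule sum.swap)
  also have "\<dots> = (\<Sum>b<n. (\<Sum>a<n. H i a * P a b) * y b)" by (simp add: sum_distrib_right)
  also have "\<dots> = (\<Sum>b<n. (if i = b then 1 else 0) * y b)"
    using assms by (intro sum.cong) (auto simp: inverse_on_def)
  also have "\<dots> = y i" using assms(2) by (simp add: if_distrib if_distribR cong: if_cong)
  finally show ?thesis .
qed

lemma bf_vm_inverse:
  assumes "inverse_on n P H" shows "bf n P (vm n v H) y = ip n v y"
proof -
  have "bf n P (vm n v H) y = (\<Sum>a<n. \<Sum>b<n. \<Sum>i<n. v i * H i a * P a b * y b)"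
    by (simp add: bf_def vm_def sum_distrib_right)
  also have "\<dots> = (\<Sum>a<n. \<Sum>i<n. \<Sum>b<n. v i * H i a * P a b * y b)"
    by (rule sum.cong[OF refl]) (rule sum.swap)
  also have "\<dots> = (\<Sum>i<n. \<Sum>a<n. \<Sum>b<n. v i * H i a * P a b * y b)"
    by (rule sum.swap)
  also have "\<dots> = (\<Sum>i<n. v i * bf n P (H i) y)" by (simp add: bf_def sum_distrib_left mult.assoc)
  also have "\<dots> = ip n v y" using assms by (simp add: ip_def bf_inverse_row)
  finally show ?thesis .
qed

text \<open>Both entries are the value of the symmetric form \<open>P\<close> at rows i and j of
  \<open>H\<close>.\<close>

lemma inverse_on_sym:
  assumes "inverse_on n P H" "sym_on n P" shows "sym_on n H"
  unfolding sym_on_def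
proof (intro allI impI)
  fix i j assume ij: "i < n" "j < n"
  have "H i j = bf n P (H j) (H i)" using assms ij by (simp add: bf_inverse_row)
  also have "\<dots> = bf n P (H i) (H j)" using assms(2) by (rule bf_commute)
  also have "\<dots> = H j i" using assms ij by (simp add: bf_inverse_row)
  finally show "H i j = H j i" .
qed

lemma ip_vm: "ip n (vm n v H) w = bf n H v w"
  unfolding ip_def vm_def bf_def sum_distrib_right by (rule sum.swap)

lemma inverse_psd:
  assumes "inverse_on n P H" "psd n P" shows "psd n H"
proof -
  have "0 \<le> bf n H x x" for x
  proof -
    have "bf n P (vm n x H) (vm n x H) = bf n H x x"
      using assms by (simp add: bf_vm_inverse ip_commute[of _ x] ip_vm)
    then show ?thesis using assms by (metis psd_def)
  qed
  then show ?thesis using assms inverse_on_sym by (auto simp: psd_def)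
qed

text \<open>Multiplying v^T H by \<open>P\<close> recovers v. This rules out a degenerate pair
  vector in the barrier step.\<close>

lemma vm_inverse_eq_0:
  assumes "inverse_on n P H" "sym_on n P" and 0: "\<And>k. k < n \<Longrightarrow> vm n v H k = 0" and "i < n"
  shows "v i = 0"
proof -
  have "0 = bf n P (vm n v H) (\<lambda>k. if k = i then 1 else 0)" using 0 by (simp add: bf_def)
  also have "\<dots> = v i" using assms(1,4) by (simp add: bf_vm_inverse ip_unit)
  finally show ?thesis by simp
qed

text \<open>The variational form \<open>(P\<^sup>-\<^sup>1)\<^sub>i\<^sub>i = max\<^sub>y (2 y\<^sub>i - y\<^sup>T P y)\<close>, which replaces operator convexity.\<close>

lemma inverse_diag_variational:
  assumes "inverse_on n P H" "psd n P" "i < n"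
  shows "2 * y i - bf n P y y \<le> H i i"
proof -
  have "0 \<le> bf n P (\<lambda>k. y k + (-1) * H i k) (\<lambda>k. y k + (-1) * H i k)" using assms by (auto simp: psd_def)
  also have "\<dots> = bf n P y y - bf n P (H i) y - bf n P y (H i) + bf n P (H i) (H i)"
    unfolding bf_add_left bf_add_right bf_scale_left bf_scale_right by simp
  also have "bf n P y (H i) = bf n P (H i) y" using assms by (intro bf_commute) (auto simp: psd_def)
  finally show ?thesis using assms by (simp add: bf_inverse_row)
qed

text \<open>The test vector for the diagonal entry of \<open>H0\<close> is row i of the new inverse
  \<open>H\<close>, at which \<open>P\<close> has the value \<open>H i i\<close>. \<open>N\<close>
  may be indefinite, so the same estimate serves the upper shift \<eta> I + \<tau> M and the lower
  shift \<eta> I - \<tau> M.\<close>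

lemma trace_inverse_shift:
  assumes "inverse_on n P0 H0" "psd n P0" "inverse_on n P H"
    and N: "\<And>i j. i < n \<Longrightarrow> j < n \<Longrightarrow> P i j = P0 i j + N i j"
  shows "tr n H + (\<Sum>i<n. bf n N (H i) (H i)) \<le> tr n H0"
proof -
  have "H i i + bf n N (H i) (H i) \<le> H0 i i" if i: "i < n" for i
  proof -
    have "bf n P (H i) (H i) = bf n P0 (H i) (H i) + bf n N (H i) (H i)"
      unfolding bf_add_mat[symmetric] by (rule bf_cong) (use N in auto)
    then show ?thesis using inverse_diag_variational[OF assms(1,2) i, of "H i"] i assms(3)
      by (simp add: bf_inverse_row)
  qed
  then show ?thesis unfolding tr_def sum.distrib[symmetric] by (intro sum_mono) auto
qed

text \<open>Expanding the product leaves, besides the identity, only multiples of g_i v_j; the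
  coefficient of g g^T is chosen so that they cancel. A negative s describes an added term, which is
  how the lower barrier uses it.\<close>

lemma sherman_morrison_inverse:
  assumes "inverse_on n P H" "sym_on n P" "1 - s * bf n H v v \<noteq> 0"
  defines "g \<equiv> vm n v H"
  shows "inverse_on n (\<lambda>i j. P i j - s * v i * v j)
    (\<lambda>i k. H i k + s / (1 - s * bf n H v v) * g i * g k)"
  unfolding inverse_on_def
proof (intro allI impI)
  fix i j assume ij: "i < n" "j < n"
  define c where "c = s / (1 - s * bf n H v v)"
  have gP: "(\<Sum>l<n. g l * P l j) = v j"
  proof -
    have "(\<Sum>l<n. g l * P l j) = bf n P g (\<lambda>k. if k = j then 1 else 0)"
      using ij by (simp add: bf_unit_right)
    also have "\<dots> = v j" using assms(1) ij unfolding g_def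
      by (simp add: bf_vm_inverse ip_unit)
    finally show ?thesis .
  qed
  have Hv: "(\<Sum>l<n. H i l * v l) = g i"
    using inverse_on_sym[OF assms(1,2)] ij unfolding g_def vm_def
    by (intro sum.cong refl) (auto simp: sym_on_def mult.commute)
  have gv: "(\<Sum>l<n. g l * v l) = bf n H v v"
    using ip_vm[of n v H v] by (simp add: g_def ip_def)
  have "(\<Sum>l<n. (H i l + c * g i * g l) * (P l j - s * v l * v j))
    = (\<Sum>l<n. H i l * P l j) + c * g i * (\<Sum>l<n. g l * P l j)
      - s * v j * (\<Sum>l<n. H i l * v l) - c * g i * s * v j * (\<Sum>l<n. g l * v l)"
    by (simp add: algebra_simps sum.distrib sum_subtractf sum_distrib_left)
  also have "\<dots> = (if i = j then 1 else 0) + g i * v j * (c - s - c * s * bf n H v v)"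
    unfolding gP Hv gv using assms(1) ij by (simp add: inverse_on_def algebra_simps)
  also have "c - s - c * s * bf n H v v = 0" using assms(3) by (simp add: c_def field_simps)
  finally show "(\<Sum>l<n. (H i l + s / (1 - s * bf n H v v) * g i * g l) * (P l j - s * v l * v j)) = (if i = j then 1 else 0)"
    by (simp add: c_def)
qed

lemma sherman_morrison_trace:
  "tr n (\<lambda>i k. H i k + c * g i * g k) = tr n H + c * ip n g g"
  by (simp add: tr_def ip_def sum.distrib sum_distrib_left mult.assoc)

text \<open>Cauchy-Schwarz for the form \<open>P\<close> at v^T H and x. As an operator inequality:
  v v^T \<le> (v^T H v) P.\<close>

lemma inverse_bound:
  assumes "inverse_on n P H" "psd n P"
  shows "(ip n v x)\<^sup>2 \<le> bf n H v v * bf n P x x"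
proof -
  have "(ip n v x)\<^sup>2 = (bf n P (vm n v H) x)\<^sup>2" using assms by (simp add: bf_vm_inverse)
  also have "\<dots> \<le> bf n P (vm n v H) (vm n v H) * bf n P x x" using assms by (intro psd_Cauchy_Schwarz)
  also have "bf n P (vm n v H) (vm n v H) = bf n H v v"
    using assms by (simp add: bf_vm_inverse ip_commute[of _ v] ip_vm)
  finally show ?thesis .
qed

text \<open>For s > 0, \<open>inverse_bound\<close> gives P - s v v^T \<ge> (1 - s v^T H v) P; for s
  \<le> 0 the term only adds.\<close>

lemma pd_rank1_update:
  assumes "inverse_on n P H" "pd n P" "0 < 1 - s * bf n H v v"
  shows "pd n (\<lambda>i j. P i j - s * v i * v j)"
  unfolding pd_def
proof (intro conjI allI impI)
  show "sym_on n (\<lambda>i j. P i j - s * v i * v j)"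
    using assms(2) by (auto simp: pd_def sym_on_def)
  fix x :: "nat \<Rightarrow> real" assume x: "\<exists>i<n. x i \<noteq> 0"
  have pos: "0 < bf n P x x" using assms(2) x by (auto simp: pd_def)
  have eq: "bf n (\<lambda>i j. P i j - s * v i * v j) x x = bf n P x x - s * (ip n v x)\<^sup>2"
  proof -
    have "bf n (\<lambda>i j. P i j - s * v i * v j) x x = bf n (\<lambda>i j. P i j + (-s) * (v i * v j)) x x"
      by (rule bf_cong) auto
    also have "\<dots> = bf n P x x - s * (ip n v x)\<^sup>2"
      unfolding bf_add_mat bf_scale_mat bf_rank1 by (simp add: power2_eq_square)
    finally show ?thesis .
  qed
  show "0 < bf n (\<lambda>i j. P i j - s * v i * v j) x x"
  proof (cases "s \<le> 0")
    case True
    then have "s * (ip n v x)\<^sup>2 \<le> 0" by (simp add: mult_nonpos_nonneg)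
    then show ?thesis using eq pos by simp
  next
    case False
    then have "s * (ip n v x)\<^sup>2 \<le> s * (bf n H v v * bf n P x x)"
      using inverse_bound[OF assms(1) pd_imp_psd[OF assms(2)], of v x] by (intro mult_left_mono) auto
    moreover have "0 < (1 - s * bf n H v v) * bf n P x x" using assms(3) pos by simp
    ultimately show ?thesis using eq by (simp add: algebra_simps)
  qed
qed

text \<open>Cauchy-Schwarz at two unit vectors gives \<bar>H i j\<bar> \<le> r i r j with r i = sqrt
  (H i i). The form is then dominated by the square of the inner product of r with \<bar>x\<bar>,
  and r has squared norm tr H.\<close>

lemma psd_le_trace:
  assumes "psd n H" shows "bf n H x x \<le> tr n H * ip n x x"
proof -
  define r where "r i = sqrt (H i i)" for i
  have unit: "bf n H (\<lambda>k. if k = i then 1 else 0) (\<lambda>k. if k = j then 1 else 0) = H i j" if "i < n" "j < n" for i j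
    using that by (simp add: bf_unit)
  have d: "0 \<le> H i i" if "i < n" for i using assms unit[OF that that] by (metis psd_def)
  have H: "\<bar>H i j\<bar> \<le> r i * r j" if ij: "i < n" "j < n" for i j
  proof -
    have "(H i j)\<^sup>2 \<le> H i i * H j j"
      using psd_Cauchy_Schwarz[OF assms, of "\<lambda>k. if k = i then 1 else 0" "\<lambda>k. if k = j then 1 else 0"] ij
      by (simp add: unit)
    then have "sqrt ((H i j)\<^sup>2) \<le> sqrt (H i i * H j j)" by (rule real_sqrt_le_mono)
    then show ?thesis by (simp add: r_def real_sqrt_mult)
  qed
  have "bf n H x x \<le> (\<Sum>i<n. \<Sum>j<n. \<bar>x i\<bar> * (r i * r j) * \<bar>x j\<bar>)"
    unfolding bf_def
  proof (intro sum_mono)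
    fix i j assume "i \<in> {..<n}" "j \<in> {..<n}"
    then have "\<bar>x i\<bar> * \<bar>H i j\<bar> * \<bar>x j\<bar> \<le> \<bar>x i\<bar> * (r i * r j) * \<bar>x j\<bar>"
      using H by (intro mult_left_mono mult_right_mono) auto
    then show "x i * H i j * x j \<le> \<bar>x i\<bar> * (r i * r j) * \<bar>x j\<bar>"
      using abs_ge_self[of "x i * H i j * x j"] by (simp add: abs_mult)
  qed
  also have "\<dots> = (ip n r (\<lambda>i. \<bar>x i\<bar>))\<^sup>2"
    by (simp add: ip_def power2_eq_square sum_product mult_ac)
  also have "\<dots> \<le> ip n r r * ip n (\<lambda>i. \<bar>x i\<bar>) (\<lambda>i. \<bar>x i\<bar>)" by (rule ip_Cauchy_Schwarz)
  also have "ip n r r = tr n H" unfolding ip_def tr_def r_def using d by (intro sum.cong) auto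
  also have "ip n (\<lambda>i. \<bar>x i\<bar>) (\<lambda>i. \<bar>x i\<bar>) = ip n x x" by (simp add: ip_def)
  finally show ?thesis .
qed

text \<open>\<open>inverse_bound\<close> with v = x, combined with \<open>psd_le_trace\<close>. This
  is how a bound on the potential becomes a distance from the barrier.\<close>

lemma pd_ge_inverse_trace:
  assumes "inverse_on n P H" "psd n P" shows "ip n x x \<le> tr n H * bf n P x x"
proof (cases "ip n x x = 0")
  case True
  have "0 \<le> tr n H"
    using inverse_psd[OF assms] unfolding tr_def
  proof (intro sum_nonneg)
    fix i assume i: "i \<in> {..<n}" and p: "psd n H"
    have "bf n H (\<lambda>k. if k = i then 1 else 0) (\<lambda>k. if k = i then 1 else 0) = H i i"
      using i by (simp add: bf_unit)
    then show "0 \<le> H i i" using p by (metis psd_def)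
  qed
  then show ?thesis using True assms(2) by (auto simp: psd_def)
next
  case False
  then have pos: "0 < ip n x x" using ip_self_nonneg[of n x] by linarith
  have "(ip n x x)\<^sup>2 \<le> bf n H x x * bf n P x x" by (rule inverse_bound[OF assms])
  also have "\<dots> \<le> tr n H * ip n x x * bf n P x x"
    using psd_le_trace[OF inverse_psd[OF assms], of x] assms(2) by (intro mult_right_mono) (auto simp: psd_def)
  finally show ?thesis using pos by (simp add: power2_eq_square mult.assoc mult.left_commute)
qed

text \<open>Supplies a fixed bound on the lower trace, where the gain term of
  \<open>trace_inverse_shift\<close> may be negative.\<close>

lemma trace_inverse_le_double:
  assumes "inverse_on n Q0 K0" "psd n Q0" "inverse_on n Q K" "psd n Q"
    and half: "\<And>x. bf n Q0 x x \<le> 2 * bf n Q x x"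
  shows "tr n K \<le> 2 * tr n K0"
proof -
  have "K i i \<le> 2 * K0 i i" if i: "i < n" for i
  proof -
    \<comment> \<open>Half of row i of \<open>K\<close> is the test vector: with \<open>Q0\<close>
      \<le> 2 \<open>Q\<close> the left side is at least K i i - K i i / 2.\<close>
    have "K i i - bf n Q0 (K i) (K i) / 4 \<le> K0 i i"
      using inverse_diag_variational[OF assms(1,2) i, of "\<lambda>k. 1/2 * K i k"]
      unfolding bf_scale_left bf_scale_right by simp
    moreover have "bf n Q (K i) (K i) = K i i" using assms(3) i by (simp add: bf_inverse_row)
    ultimately show ?thesis using half[of "K i"] by simp
  qed
  then show ?thesis unfolding tr_def sum_distrib_left by (intro sum_mono) auto
qed

text \<open>The two indicators are added, so i = j is legitimate: the vector is then 2 e_i for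
  \<sigma> = 1 and zero for \<sigma> = -1.\<close>

definition pvec :: "real \<Rightarrow> nat \<Rightarrow> nat \<Rightarrow> nat \<Rightarrow> real" where
  "pvec \<sigma> i j = (\<lambda>k. (if k = i then 1 else 0) + \<sigma> * (if k = j then 1 else 0))"

lemma ip_pvec: "i < n \<Longrightarrow> j < n \<Longrightarrow> ip n (pvec \<sigma> i j) x = x i + \<sigma> * x j"
proof -
  assume ij: "i < n" "j < n"
  have "ip n (pvec \<sigma> i j) x = ip n x (\<lambda>k. if k = i then 1 else 0) + \<sigma> * ip n x (\<lambda>k. if k = j then 1 else 0)"
    by (simp add: ip_def pvec_def algebra_simps sum.distrib sum_distrib_left)
  then show ?thesis using ij by (simp add: ip_unit)
qed

lemma vm_pvec: "i < n \<Longrightarrow> j < n \<Longrightarrow> vm n (pvec \<sigma> i j) H k = H i k + \<sigma> * H j k"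
  using ip_pvec[of i n j \<sigma> "\<lambda>l. H l k"] by (simp add: vm_def ip_def)

lemma bf_pvec:
  assumes "i < n" "j < n" "sym_on n H" "\<sigma>\<^sup>2 = 1"
  shows "bf n H (pvec \<sigma> i j) (pvec \<sigma> i j) = H i i + H j j + 2 * \<sigma> * H i j"
proof -
  have "bf n H (pvec \<sigma> i j) (pvec \<sigma> i j) = ip n (pvec \<sigma> i j) (vm n (pvec \<sigma> i j) H)"
    by (simp add: ip_vm[symmetric] ip_commute)
  also have "\<dots> = (H i i + \<sigma> * H j i) + \<sigma> * (H i j + \<sigma> * H j j)"
    using assms(1,2) by (simp add: ip_pvec vm_pvec)
  also have "\<dots> = H i i + H j j + 2 * \<sigma> * H i j"
    using assms by (simp add: sym_on_def algebra_simps power2_eq_square)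
  finally show ?thesis .
qed

lemma inverse_on_id: "u \<noteq> 0 \<Longrightarrow> inverse_on n (\<lambda>i j. if i = j then u else 0) (\<lambda>i j. if i = j then 1 / u else 0)"
  by (auto simp: inverse_on_def if_distrib[of "(*) _"] cong: if_cong)

lemma pd_id: "0 < u \<Longrightarrow> pd n (\<lambda>i j. if i = j then u else 0)"
  unfolding pd_def
proof (intro conjI allI impI)
  fix x :: "nat \<Rightarrow> real" assume u: "0 < u" and "\<exists>i<n. x i \<noteq> 0"
  then obtain i where i: "i < n" "x i \<noteq> 0" by blast
  then have "0 < ip n x x"
    unfolding ip_def by (intro sum_pos2[of _ i]) (auto simp: zero_less_mult_iff)
  then show "0 < bf n (\<lambda>i j. if i = j then u else 0) x x" using u by (simp add: bf_id)
qed (simp add: sym_on_def)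

section \<open>The barrier step\<close>

locale signed_matrix =
  fixes n :: nat and A :: "nat \<Rightarrow> nat \<Rightarrow> real" and R :: real
  assumes A_sym: "sym_on n A"
    and row_le: "\<And>i. i < n \<Longrightarrow> (\<Sum>j<n. \<bar>A i j\<bar>) \<le> R"
begin

text \<open>Zero entries get the sign 1, so that \<open>S_sq\<close> holds throughout. Such pairs
  have weight 0 in every average, although the selection may still pick one.\<close>

definition S :: "nat \<Rightarrow> nat \<Rightarrow> real" where "S i j = (if A i j < 0 then -1 else 1)"

definition M :: "nat \<Rightarrow> nat \<Rightarrow> real" where
  "M i j = A i j + (if i = j then \<Sum>k<n. \<bar>A i k\<bar> else 0)"

abbreviation v :: "nat \<Rightarrow> nat \<Rightarrow> nat \<Rightarrow> real" where "v i j \<equiv> pvec (S i j) i j"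

text \<open>The half compensates for each off-diagonal pair occurring in both orders. On the
  diagonal a positive entry contributes A_ii/2 times the square of 2 e_i, that is 2 A_ii, and a
  negative one contributes nothing; both agree with A_ii + \<bar>A_ii\<bar> in
  \<open>M\<close>.\<close>

definition wsum :: "(nat \<Rightarrow> nat \<Rightarrow> real) \<Rightarrow> real" where
  "wsum F = (\<Sum>i<n. \<Sum>j<n. \<bar>A i j\<bar> / 2 * F i j)"

lemma S_sq: "(S i j)\<^sup>2 = 1" by (simp add: S_def)
lemma S_abs: "S i j * A i j = \<bar>A i j\<bar>" by (simp add: S_def)
lemma abs_S: "\<bar>A i j\<bar> * S i j = A i j" by (simp add: S_def)

lemma wsum_split: "wsum (\<lambda>i j. f i + f j) = (\<Sum>i<n. (\<Sum>j<n. \<bar>A i j\<bar>) * f i)"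
proof -
  have "(\<Sum>i<n. \<Sum>j<n. \<bar>A i j\<bar> / 2 * f j) = (\<Sum>i<n. \<Sum>j<n. \<bar>A j i\<bar> / 2 * f i)"
    by (rule sum.swap)
  also have "\<dots> = (\<Sum>i<n. \<Sum>j<n. \<bar>A i j\<bar> / 2 * f i)"
    using A_sym by (intro sum.cong refl) (auto simp: sym_on_def)
  finally have "wsum (\<lambda>i j. f i + f j) = (\<Sum>i<n. \<Sum>j<n. \<bar>A i j\<bar> / 2 * f i) + (\<Sum>i<n. \<Sum>j<n. \<bar>A i j\<bar> / 2 * f i)"
    by (simp add: wsum_def distrib_left sum.distrib)
  also have "\<dots> = (\<Sum>i<n. (\<Sum>j<n. \<bar>A i j\<bar>) * f i)"
    unfolding sum.distrib[symmetric] sum_distrib_right by (intro sum.cong refl) simp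
  finally show ?thesis .
qed

lemma wsum_mono: "(\<And>i j. i < n \<Longrightarrow> j < n \<Longrightarrow> F i j \<le> G i j) \<Longrightarrow> wsum F \<le> wsum G"
  unfolding wsum_def by (intro sum_mono mult_left_mono) auto

lemma wsum_add: "wsum (\<lambda>i j. F i j + G i j) = wsum F + wsum G"
  by (simp add: wsum_def distrib_left sum.distrib)

lemma wsum_scale: "wsum (\<lambda>i j. c * F i j) = c * wsum F"
  by (simp add: wsum_def sum_distrib_left mult_ac)

text \<open>By symmetry both summands average to the same weighted row sum, and each row sum is at
  most \<open>R\<close>. The bounds on \<open>M\<close>, \<open>m1\<close> and \<open>m2\<close> are
  all instances.\<close>

lemma wsum_le:
  assumes "\<And>i j. i < n \<Longrightarrow> j < n \<Longrightarrow> F i j \<le> 2 * (f i + f j)" "\<And>i. i < n \<Longrightarrow> 0 \<le> f i"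
  shows "wsum F \<le> 2 * R * (\<Sum>i<n. f i)"
proof -
  have "wsum F \<le> wsum (\<lambda>i j. 2 * (f i + f j))" by (rule wsum_mono) (rule assms(1))
  also have "\<dots> = 2 * (\<Sum>i<n. (\<Sum>j<n. \<bar>A i j\<bar>) * f i)" by (simp only: wsum_scale wsum_split)
  also have "\<dots> \<le> 2 * (\<Sum>i<n. R * f i)"
    using row_le assms(2) by (intro mult_left_mono sum_mono mult_right_mono) auto
  finally show ?thesis by (simp add: sum_distrib_left mult_ac)
qed

lemma M_sym: "sym_on n M" using A_sym by (auto simp: sym_on_def M_def)

text \<open>The squares of the coordinates collect into the diagonal part of \<open>M\<close>, the
  mixed products into \<open>A\<close>, because \<bar>A\<bar> times the sign is
  \<open>A\<close>.\<close>

lemma bf_M: "bf n M x x = wsum (\<lambda>i j. (ip n (v i j) x)\<^sup>2)"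
proof -
  have "wsum (\<lambda>i j. (ip n (v i j) x)\<^sup>2) = wsum (\<lambda>i j. ((x i)\<^sup>2 + (x j)\<^sup>2) + 2 * (S i j * x i * x j))"
    unfolding wsum_def
  proof (intro sum.cong refl)
    fix i j assume "i \<in> {..<n}" "j \<in> {..<n}"
    then have "(ip n (v i j) x)\<^sup>2 = (x i)\<^sup>2 + (S i j)\<^sup>2 * (x j)\<^sup>2 + 2 * (S i j * x i * x j)"
      by (simp add: ip_pvec power2_eq_square algebra_simps)
    then show "\<bar>A i j\<bar> / 2 * (ip n (v i j) x)\<^sup>2 = \<bar>A i j\<bar> / 2 * (((x i)\<^sup>2 + (x j)\<^sup>2) + 2 * (S i j * x i * x j))"
      by (simp add: S_sq)
  qed
  also have "\<dots> = (\<Sum>i<n. (\<Sum>j<n. \<bar>A i j\<bar>) * (x i)\<^sup>2) + 2 * wsum (\<lambda>i j. S i j * x i * x j)"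
    by (simp only: wsum_add[of "\<lambda>i j. (x i)\<^sup>2 + (x j)\<^sup>2"] wsum_scale wsum_split)
  also have "2 * wsum (\<lambda>i j. S i j * x i * x j) = bf n A x x"
    unfolding wsum_def bf_def sum_distrib_left
  proof (intro sum.cong refl)
    fix i j
    have "2 * (\<bar>A i j\<bar> / 2 * (S i j * x i * x j)) = x i * (\<bar>A i j\<bar> * S i j) * x j" by simp
    then show "2 * (\<bar>A i j\<bar> / 2 * (S i j * x i * x j)) = x i * A i j * x j" by (simp only: abs_S)
  qed
  also have "(\<Sum>i<n. (\<Sum>j<n. \<bar>A i j\<bar>) * (x i)\<^sup>2) = bf n (\<lambda>i j. if i = j then \<Sum>k<n. \<bar>A i k\<bar> else 0) x x"
  proof -
    have "bf n (\<lambda>i j. if i = j then \<Sum>k<n. \<bar>A i k\<bar> else 0) x x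
      = (\<Sum>i<n. \<Sum>j<n. if i = j then x i * (\<Sum>k<n. \<bar>A i k\<bar>) * x j else 0)"
      unfolding bf_def by (intro sum.cong refl) auto
    also have "\<dots> = (\<Sum>i<n. (\<Sum>j<n. \<bar>A i j\<bar>) * (x i)\<^sup>2)"
      by (simp add: power2_eq_square mult_ac)
    finally show ?thesis by simp
  qed
  also have "bf n (\<lambda>i j. if i = j then \<Sum>k<n. \<bar>A i k\<bar> else 0) x x + bf n A x x = bf n M x x"
    unfolding bf_add_mat[symmetric] M_def by (rule bf_cong) auto
  finally show ?thesis by simp
qed

lemma wsum_nonneg: "(\<And>i j. i < n \<Longrightarrow> j < n \<Longrightarrow> 0 \<le> F i j) \<Longrightarrow> 0 \<le> wsum F"
  unfolding wsum_def by (intro sum_nonneg mult_nonneg_nonneg) auto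

lemma bf_M_nonneg: "0 \<le> bf n M x x"
  unfolding bf_M by (rule wsum_nonneg) simp

lemma sq_sum_le: "(a + S i j * b)\<^sup>2 \<le> 2 * (a\<^sup>2 + b\<^sup>2)"
proof -
  have "0 \<le> (a - S i j * b)\<^sup>2" by simp
  then show ?thesis using S_sq[of i j] by (simp add: power2_eq_square algebra_simps)
qed

lemma bf_M_le: "bf n M x x \<le> 2 * R * ip n x x"
proof -
  have "bf n M x x \<le> 2 * R * (\<Sum>i<n. (x i)\<^sup>2)"
    unfolding bf_M
  proof (rule wsum_le)
    show "(ip n (v i j) x)\<^sup>2 \<le> 2 * ((x i)\<^sup>2 + (x j)\<^sup>2)" if "i < n" "j < n" for i j
      using that sq_sum_le by (simp add: ip_pvec)
  qed auto
  then show ?thesis by (simp add: ip_def power2_eq_square)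
qed

text \<open>The square of the Frobenius norm; tr(H^2) for symmetric \<open>H\<close>.\<close>

definition fro :: "(nat \<Rightarrow> nat \<Rightarrow> real) \<Rightarrow> real" where "fro H = (\<Sum>i<n. ip n (H i) (H i))"

text \<open>For symmetric \<open>H\<close> these are tr(M H) and tr(M H^2). They are written as
  averages over pairs because the selection argument compares them pair by pair.\<close>

definition m1 where "m1 H = wsum (\<lambda>i j. bf n H (v i j) (v i j))"
definition m2 where "m2 H = wsum (\<lambda>i j. ip n (vm n (v i j) H) (vm n (v i j) H))"

text \<open>Evaluates the gain term of \<open>trace_inverse_shift\<close> for the shift \<eta> I + s
  M. Symmetry of \<open>H\<close> lets the sum over rows k of (v . H k)^2 become the squared norm of
  v^T H.\<close>

lemma trace_shift_form:
  assumes "sym_on n H"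
  shows "(\<Sum>k<n. bf n (\<lambda>i j. (if i = j then \<eta> else 0) + s * M i j) (H k) (H k)) = \<eta> * fro H + s * m2 H"
proof -
  have "(\<Sum>k<n. bf n M (H k) (H k)) = (\<Sum>k<n. wsum (\<lambda>i j. (ip n (v i j) (H k))\<^sup>2))"
    by (simp only: bf_M)
  also have "\<dots> = (\<Sum>i<n. \<Sum>k<n. \<Sum>j<n. \<bar>A i j\<bar> / 2 * (ip n (v i j) (H k))\<^sup>2)"
    unfolding wsum_def by (rule sum.swap)
  also have "\<dots> = (\<Sum>i<n. \<Sum>j<n. \<Sum>k<n. \<bar>A i j\<bar> / 2 * (ip n (v i j) (H k))\<^sup>2)"
    by (rule sum.cong[OF refl]) (rule sum.swap)
  also have "\<dots> = m2 H"
    unfolding m2_def wsum_def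
  proof (intro sum.cong refl)
    fix i j assume ij: "i \<in> {..<n}" "j \<in> {..<n}"
    have "ip n (v i j) (H k) = vm n (v i j) H k" if "k < n" for k
      using ij that assms by (simp add: ip_pvec vm_pvec sym_on_def)
    then show "(\<Sum>k<n. \<bar>A i j\<bar> / 2 * (ip n (v i j) (H k))\<^sup>2) = \<bar>A i j\<bar> / 2 * ip n (vm n (v i j) H) (vm n (v i j) H)"
      by (simp add: ip_def[of n "vm n (v i j) H"] sum_distrib_left power2_eq_square)
  qed
  finally have "(\<Sum>k<n. bf n M (H k) (H k)) = m2 H" .
  then show ?thesis
    by (simp only: bf_add_mat bf_scale_mat bf_id sum.distrib fro_def sum_distrib_left[symmetric])
qed

lemma psd_diag_nonneg: "psd n H \<Longrightarrow> i < n \<Longrightarrow> 0 \<le> H i i"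
  by (metis psd_def bf_unit)

lemma m1_le: assumes "psd n H" shows "m1 H \<le> 2 * R * tr n H"
  unfolding m1_def tr_def
proof (rule wsum_le)
  fix i j assume ij: "i < n" "j < n"
  have s: "sym_on n H" using assms by (simp add: psd_def)
  \<comment> \<open>The forms at e_i + S e_j and e_i - S e_j add up to 2 (H i i + H j j); dropping
    the second leaves the bound.\<close>
  have "0 \<le> bf n H (pvec (- S i j) i j) (pvec (- S i j) i j)" using assms by (simp add: psd_def)
  then show "bf n H (v i j) (v i j) \<le> 2 * (H i i + H j j)"
    using ij s by (simp add: bf_pvec S_sq)
qed (use assms psd_diag_nonneg in auto)

lemma m2_le: "m2 H \<le> 2 * R * fro H"
  unfolding m2_def fro_def
proof (rule wsum_le)
  fix i j assume ij: "i < n" "j < n"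
  have "ip n (vm n (v i j) H) (vm n (v i j) H) = (\<Sum>k<n. (H i k + S i j * H j k)\<^sup>2)"
    using ij by (simp add: ip_def vm_pvec power2_eq_square)
  also have "\<dots> \<le> (\<Sum>k<n. 2 * ((H i k)\<^sup>2 + (H j k)\<^sup>2))"
    by (intro sum_mono sq_sum_le)
  also have "\<dots> = 2 * (ip n (H i) (H i) + ip n (H j) (H j))"
    by (simp add: ip_def power2_eq_square sum.distrib sum_distrib_left algebra_simps)
  finally show "ip n (vm n (v i j) H) (vm n (v i j) H) \<le> 2 * (ip n (H i) (H i) + ip n (H j) (H j))" .
qed (simp add: ip_self_nonneg)

lemma m2_nonneg: "0 \<le> m2 H" unfolding m2_def by (rule wsum_nonneg) (rule ip_self_nonneg)

lemma fro_pos: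
  assumes "inverse_on n P H" "0 < n" shows "0 < fro H"
proof -
  have "0 \<le> fro H" unfolding fro_def by (intro sum_nonneg ip_self_nonneg)
  moreover have "fro H \<noteq> 0"
  proof
    assume "fro H = 0"
    then have "ip n (H 0) (H 0) = 0" using assms(2) unfolding fro_def
      by (subst (asm) sum_nonneg_eq_0_iff) (auto intro: ip_self_nonneg)
    then have "\<forall>l<n. H 0 l = 0" unfolding ip_def by (subst (asm) sum_nonneg_eq_0_iff) auto
    then have "(\<Sum>l<n. H 0 l * P l 0) = 0" by simp
    then show False using assms by (simp add: inverse_on_def)
  qed
  ultimately show ?thesis by simp
qed

definition barrier :: "real \<Rightarrow> (nat \<Rightarrow> nat \<Rightarrow> real) \<Rightarrow> nat \<Rightarrow> nat \<Rightarrow> real" where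
  "barrier u X i j = (if i = j then u else 0) - X i j"

text \<open>Positive definiteness places X strictly below u, and \<Phi> is the budget for the
  barrier potential. The lower barrier is the same predicate for -X, so no second notion is
  introduced.\<close>

definition confined :: "real \<Rightarrow> real \<Rightarrow> (nat \<Rightarrow> nat \<Rightarrow> real) \<Rightarrow> bool" where
  "confined \<Phi> u X \<longleftrightarrow> (\<exists>H. inverse_on n (barrier u X) H \<and> pd n (barrier u X) \<and> tr n H \<le> \<Phi>)"

lemma confined_init: "0 < u \<Longrightarrow> confined (n / u) u (\<lambda>i j. 0)"
  unfolding confined_def barrier_def
  by (rule exI[of _ "\<lambda>i j. if i = j then 1 / u else 0"]) (auto simp: inverse_on_id pd_id tr_def)

end

text \<open>The situation before one step: \<tau> = 1/T is the share of \<open>M\<close> subtracted,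
  u the current barrier, while \<Phi> stays fixed at its initial value. \<open>eta_eq\<close> is the
  equality on which the averaging argument turns, and \<open>tau_small\<close> keeps the subtraction
  from crossing the lower barrier.\<close>

locale barrier_step = signed_matrix +
  fixes \<Phi> \<tau> \<eta> u :: real and X :: "nat \<Rightarrow> nat \<Rightarrow> real"
  assumes n_pos: "0 < n" and R_pos: "0 < R" and tau_pos: "0 < \<tau>" and Phi_pos: "0 < \<Phi>"
    and eta_eq: "\<eta> = 6 * R\<^sup>2 * \<Phi> * \<tau>\<^sup>2" and tau_small: "4 * R * \<tau> * \<Phi> \<le> 1"
    and upper: "confined \<Phi> u X" and lower: "confined \<Phi> u (\<lambda>i j. - X i j)"
begin

text \<open>The two barrier matrices after the shift by -\<tau> M and the widening by \<eta>, before
  a rank-one term is added.\<close>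

abbreviation P where "P \<equiv> barrier (u + \<eta>) (\<lambda>i j. X i j - \<tau> * M i j)"
abbreviation Q where "Q \<equiv> barrier (u + \<eta>) (\<lambda>i j. - (X i j - \<tau> * M i j))"

lemma eta_pos: "0 < \<eta>" using R_pos tau_pos Phi_pos by (simp add: eta_eq)

lemma P_eq: "P i j = barrier u X i j + ((if i = j then \<eta> else 0) + \<tau> * M i j)"
  by (simp add: barrier_def)
lemma Q_eq: "Q i j = barrier u (\<lambda>i j. - X i j) i j + ((if i = j then \<eta> else 0) + (- \<tau>) * M i j)"
  by (simp add: barrier_def)

lemma pd_P: "pd n P"
  unfolding pd_def
proof (intro conjI allI impI)
  show "sym_on n P" using upper M_sym by (auto simp: confined_def pd_def sym_on_def P_eq)
  fix x :: "nat \<Rightarrow> real" assume "\<exists>i<n. x i \<noteq> 0"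
  then have "0 < bf n (barrier u X) x x" using upper by (auto simp: confined_def pd_def)
  moreover have "bf n P x x = bf n (barrier u X) x x + (\<eta> * ip n x x + \<tau> * bf n M x x)"
    unfolding bf_scale_mat[symmetric] bf_id[symmetric] bf_add_mat[symmetric] P_eq ..
  moreover have "0 \<le> \<eta> * ip n x x" "0 \<le> \<tau> * bf n M x x"
    using eta_pos tau_pos bf_M_nonneg[of x] by (auto simp: ip_self_nonneg)
  ultimately show "0 < bf n P x x" by linarith
qed

text \<open>The shift moves X towards the lower barrier. The old form q satisfies q \<ge>
  |x|^2/\<Phi> by the trace budget, so \<tau> M \<le> 2 R \<tau> \<Phi> q \<le> q/2 by
  \<open>tau_small\<close>.\<close>

lemma Q_ge_half: "bf n (barrier u (\<lambda>i j. - X i j)) x x \<le> 2 * bf n Q x x"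
proof -
  let ?q = "bf n (barrier u (\<lambda>i j. - X i j)) x x"
  obtain K where K: "inverse_on n (barrier u (\<lambda>i j. - X i j)) K" "pd n (barrier u (\<lambda>i j. - X i j))" "tr n K \<le> \<Phi>"
    using lower by (auto simp: confined_def)
  have q0: "0 \<le> ?q" using pd_imp_psd[OF K(2)] by (simp add: psd_def)
  have "ip n x x \<le> tr n K * ?q" using pd_ge_inverse_trace[OF K(1) pd_imp_psd[OF K(2)]] .
  also have "\<dots> \<le> \<Phi> * ?q" using K(3) q0 by (rule mult_right_mono)
  finally have ip: "ip n x x \<le> \<Phi> * ?q" .
  have "\<tau> * bf n M x x \<le> \<tau> * (2 * R * (\<Phi> * ?q))"
    using bf_M_le[of x] ip R_pos tau_pos
    by (intro mult_left_mono) (auto intro: order_trans mult_left_mono)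
  also have "\<dots> = (4 * R * \<tau> * \<Phi>) * (?q / 2)" by simp
  also have "\<dots> \<le> 1 * (?q / 2)" using tau_small q0 by (intro mult_right_mono) auto
  finally have "\<tau> * bf n M x x \<le> ?q / 2" by simp
  moreover have "bf n Q x x = ?q + (\<eta> * ip n x x + (- \<tau>) * bf n M x x)"
    unfolding bf_scale_mat[symmetric] bf_id[symmetric] bf_add_mat[symmetric] Q_eq ..
  moreover have "0 \<le> \<eta> * ip n x x" using eta_pos by (simp add: ip_self_nonneg)
  ultimately show ?thesis by simp
qed

lemma pd_Q: "pd n Q"
  unfolding pd_def
proof (intro conjI allI impI)
  show "sym_on n Q" using lower M_sym unfolding confined_def pd_def sym_on_def Q_eq by auto
  fix x :: "nat \<Rightarrow> real" assume "\<exists>i<n. x i \<noteq> 0"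
  then have "0 < bf n (barrier u (\<lambda>i j. - X i j)) x x" using lower by (auto simp: confined_def pd_def)
  then show "0 < bf n Q x x" using Q_ge_half[of x] by linarith
qed

context
  fixes H K :: "nat \<Rightarrow> nat \<Rightarrow> real"
  assumes H: "inverse_on n P H" and K: "inverse_on n Q K"
begin

text \<open>\<open>al\<close> and \<open>al'\<close> are the slacks left below \<Phi> in the upper
  and lower trace; a negative \<open>al'\<close> is a deficit to be made up. \<open>aa\<close>,
  \<open>bb\<close> for \<open>H\<close> and \<open>cc\<close>, \<open>dd\<close> for
  \<open>K\<close> are the quantities entering the two rank-one trace formulas.\<close>

abbreviation "al \<equiv> \<eta> * fro H + \<tau> * m2 H"
abbreviation "al' \<equiv> \<eta> * fro K + (- \<tau>) * m2 K"
abbreviation "aa i j \<equiv> ip n (vm n (v i j) H) (vm n (v i j) H)"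
abbreviation "cc i j \<equiv> ip n (vm n (v i j) K) (vm n (v i j) K)"
abbreviation "bb i j \<equiv> bf n H (v i j) (v i j)"
abbreviation "dd i j \<equiv> bf n K (v i j) (v i j)"

text \<open>With 1/s = aa/al + bb the upper trace rises by exactly \<open>al\<close>, and the lower
  trace falls by s cc/(1 + s dd). The inequality says that this fall exceeds -al'.\<close>

definition chosen :: "nat \<Rightarrow> nat \<Rightarrow> bool" where
  "chosen i j \<longleftrightarrow> - al' * (aa i j / al + bb i j + dd i j) < cc i j"

lemma psd_H: "psd n H" using inverse_psd[OF H pd_imp_psd[OF pd_P]] .
lemma psd_K: "psd n K" using inverse_psd[OF K pd_imp_psd[OF pd_Q]] .

lemma tr_H: "tr n H + al \<le> \<Phi>"
proof -
  obtain H0 where H0: "inverse_on n (barrier u X) H0" "pd n (barrier u X)" "tr n H0 \<le> \<Phi>"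
    using upper by (auto simp: confined_def)
  have "tr n H + al \<le> tr n H0"
    using trace_inverse_shift[OF H0(1) pd_imp_psd[OF H0(2)] H P_eq]
      trace_shift_form[of H \<eta> \<tau>] psd_H by (simp add: psd_def)
  then show ?thesis using H0(3) by simp
qed

lemma tr_K: "tr n K + al' \<le> \<Phi>" "tr n K \<le> 2 * \<Phi>"
proof -
  obtain K0 where K0: "inverse_on n (barrier u (\<lambda>i j. - X i j)) K0" "pd n (barrier u (\<lambda>i j. - X i j))" "tr n K0 \<le> \<Phi>"
    using lower by (auto simp: confined_def)
  have "tr n K + al' \<le> tr n K0"
    using trace_inverse_shift[OF K0(1) pd_imp_psd[OF K0(2)] K Q_eq]
      trace_shift_form[of K \<eta> "- \<tau>"] psd_K by (simp add: psd_def)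
  then show "tr n K + al' \<le> \<Phi>" using K0(3) by simp
  show "tr n K \<le> 2 * \<Phi>"
    using trace_inverse_le_double[OF K0(1) pd_imp_psd[OF K0(2)] K pd_imp_psd[OF pd_Q] Q_ge_half] K0(3)
    by simp
qed

lemma al_pos: "0 < al"
  using fro_pos[OF H n_pos] eta_pos tau_pos m2_nonneg[of H] by (simp add: add_pos_nonneg)

text \<open>If every pair failed, averaging the failed inequalities would give m2 K \<le> -al' (m2
  H/al + m1 H + m1 K). Since -al' > 0, the bracket can be replaced by an upper bound, and
  \<open>eta_eq\<close> makes the result too small.\<close>

lemma exists_chosen:
  assumes neg: "al' < 0" shows "\<exists>i<n. \<exists>j<n. chosen i j"
proof (rule ccontr)
  assume no: "\<not> ?thesis"
  \<comment> \<open>r expresses \<eta> on the scale of \<tau>: m2 \<le> 2 R fro means r m2 \<le>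
    \<eta> fro, hence al \<ge> (\<tau> + r) m2 H and -al' \<le> (\<tau> - r) m2 K.\<close>
  define r where "r = \<eta> / (2 * R)"
  have r: "0 < r" "\<eta> = 2 * R * r" using eta_pos R_pos by (auto simp: r_def)
  have "cc i j \<le> - al' / al * aa i j + (- al') * bb i j + (- al') * dd i j" if "i < n" "j < n" for i j
  proof -
    have "\<not> chosen i j" using no that by blast
    then have "cc i j \<le> - al' * (aa i j / al + bb i j + dd i j)" by (simp add: chosen_def)
    then show ?thesis by (simp add: distrib_left)
  qed
  then have "m2 K \<le> wsum (\<lambda>i j. - al' / al * aa i j + (- al') * bb i j + (- al') * dd i j)"
    unfolding m2_def by (rule wsum_mono)
  also have "\<dots> = - al' / al * m2 H + (- al') * m1 H + (- al') * m1 K"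
    unfolding wsum_add wsum_scale m1_def m2_def ..
  also have "\<dots> = (- al') * (m2 H / al + m1 H + m1 K)" by (simp add: distrib_left)
  also have "\<dots> \<le> (- al') * (1 / (\<tau> + r) + 6 * R * \<Phi>)"
  proof (rule mult_left_mono)
    have "(\<tau> + r) * m2 H \<le> al"
      using m2_le[of H] r R_pos mult_left_mono[OF m2_le[of H], of r] by (simp add: algebra_simps)
    then have "m2 H / al \<le> 1 / (\<tau> + r)" using al_pos r tau_pos by (simp add: field_simps)
    moreover have "m1 H \<le> 2 * R * \<Phi>"
      using m1_le[OF psd_H] tr_H al_pos R_pos by (smt (verit) mult_left_mono)
    \<comment> \<open>Only tr K \<le> 2 \<Phi> is available here, so the constant is 4 and not 2;
      together with \<open>m1 H\<close> this is the 6 of \<open>eta_eq\<close>.\<close>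
    moreover have "m1 K \<le> 4 * R * \<Phi>"
      using m1_le[OF psd_K] mult_left_mono[OF tr_K(2), of "2 * R"] R_pos by linarith
    ultimately show "m2 H / al + m1 H + m1 K \<le> 1 / (\<tau> + r) + 6 * R * \<Phi>" by linarith
  qed (use neg in simp)
  finally have le: "m2 K \<le> (- al') * (1 / (\<tau> + r) + 6 * R * \<Phi>)" .
  have "- al' \<le> (\<tau> - r) * m2 K"
    using mult_left_mono[OF m2_le[of K], of r] r by (simp add: algebra_simps)
  then have "(- al') * (1 / (\<tau> + r) + 6 * R * \<Phi>) \<le> (\<tau> - r) * m2 K * (1 / (\<tau> + r) + 6 * R * \<Phi>)"
    using r tau_pos R_pos Phi_pos by (intro mult_right_mono) auto
  with le have le2: "m2 K \<le> m2 K * ((\<tau> - r) * (1 / (\<tau> + r) + 6 * R * \<Phi>))" by (simp add: mult_ac)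
  \<comment> \<open>Otherwise al' = \<eta> fro K > 0, against the assumption; positivity allows
    cancelling \<open>m2 K\<close>.\<close>
  have "m2 K > 0"
  proof (rule ccontr)
    assume "\<not> 0 < m2 K"
    then have "m2 K = 0" using m2_nonneg[of K] by simp
    then show False using neg fro_pos[OF K n_pos] eta_pos by (simp add: mult_less_0_iff)
  qed
  with le2 have one: "1 \<le> (\<tau> - r) * (1 / (\<tau> + r) + 6 * R * \<Phi>)"
    by (metis mult_le_cancel_left_pos mult.right_neutral)
  have "1 * (\<tau> + r) \<le> (\<tau> - r) * (1 / (\<tau> + r) + 6 * R * \<Phi>) * (\<tau> + r)"
    using one r tau_pos by (intro mult_right_mono) auto
  also have "\<dots> = (\<tau> - r) + 6 * R * \<Phi> * (\<tau>\<^sup>2 - r\<^sup>2)"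
    using r tau_pos by (simp add: field_simps power2_eq_square)
  \<comment> \<open>By \<open>eta_eq\<close>, 2 r equals the first term on the right, and the
    subtracted r^2 term is strictly positive.\<close>
  finally have "2 * r \<le> 6 * R * \<Phi> * \<tau>\<^sup>2 - 6 * R * \<Phi> * r\<^sup>2" by (simp add: algebra_simps)
  moreover have "2 * r = 6 * R * \<Phi> * \<tau>\<^sup>2"
    using R_pos by (simp add: r_def eta_eq power2_eq_square)
  moreover have "0 < 6 * R * \<Phi> * r\<^sup>2" using R_pos Phi_pos r by simp
  ultimately show False by linarith
qed

text \<open>The weight s is the largest one the upper budget allows; \<open>chosen\<close>
  guarantees that it suffices for the lower one.\<close>

lemma confined_step:
  assumes ij: "i < n" "j < n" and ch: "chosen i j" and s: "s = 1 / (aa i j / al + bb i j)"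
  shows "confined \<Phi> (u + \<eta>) (\<lambda>k l. X k l - \<tau> * M k l + s * v i j k * v i j l)"
    "confined \<Phi> (u + \<eta>) (\<lambda>k l. - (X k l - \<tau> * M k l + s * v i j k * v i j l))"
proof -
  let ?a = "aa i j" and ?b = "bb i j" and ?c = "cc i j" and ?d = "dd i j" and ?v = "v i j"
  have b0: "0 \<le> ?b" and d0: "0 \<le> ?d" using psd_H psd_K by (auto simp: psd_def)
  \<comment> \<open>If this norm vanished, then v = 0 and the strict inequality in
    \<open>chosen\<close> would read 0 < 0. This covers the zero vector attached to a negative
    diagonal entry.\<close>
  have a0: "0 < ?a"
  proof (rule ccontr)
    assume "\<not> 0 < ?a"
    then have "?a = 0" using ip_self_nonneg[of n "vm n ?v H"] by linarith
    then have "\<And>k. k < n \<Longrightarrow> vm n ?v H k = 0"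
      unfolding ip_def by (subst (asm) sum_nonneg_eq_0_iff) auto
    then have v0: "\<And>k. k < n \<Longrightarrow> ?v k = 0"
      using vm_inverse_eq_0[OF H] pd_P by (auto simp: pd_def)
    have "?b = 0" "?d = 0" using v0 by (auto simp: bf_def)
    moreover have "\<And>k. vm n ?v K k = 0" using v0 by (simp add: vm_def)
    ultimately show False using ch \<open>?a = 0\<close> by (simp add: chosen_def ip_def)
  qed
  have al0: "0 < ?a / al" using a0 al_pos by simp
  have s0: "0 < s" and inv_s: "?a / al + ?b = 1 / s" using al0 b0 by (auto simp: s)
  have sb: "1 - s * ?b = s * (?a / al)" using inv_s s0 by (simp add: field_simps)
  have sbpos: "0 < 1 - s * ?b" unfolding sb using s0 al0 by (rule mult_pos_pos)
  \<comment> \<open>The increase of the upper trace equals its slack; this equation determines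
    s.\<close>
  have frac: "s / (1 - s * ?b) * ?a = al" unfolding sb using s0 a0 al_pos by simp
  let ?H = "\<lambda>i' k. H i' k + s / (1 - s * ?b) * vm n ?v H i' * vm n ?v H k"
  have PX: "(\<lambda>k l. P k l - s * ?v k * ?v l) = barrier (u + \<eta>) (\<lambda>k l. X k l - \<tau> * M k l + s * ?v k * ?v l)"
    by (simp add: barrier_def fun_eq_iff)
  have i1: "inverse_on n (\<lambda>k l. P k l - s * ?v k * ?v l) ?H"
    using sherman_morrison_inverse[OF H, of s ?v] pd_P sbpos by (auto simp: pd_def)
  have p1: "pd n (\<lambda>k l. P k l - s * ?v k * ?v l)" by (rule pd_rank1_update[OF H pd_P sbpos])
  have t1: "tr n ?H \<le> \<Phi>" unfolding sherman_morrison_trace frac by (rule tr_H)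
  show "confined \<Phi> (u + \<eta>) (\<lambda>k l. X k l - \<tau> * M k l + s * ?v k * ?v l)"
    unfolding confined_def PX[symmetric] using i1 p1 t1 by blast
  have dpos: "0 < 1 - (- s) * ?d" using s0 d0 by (simp add: add_pos_nonneg)
  let ?K = "\<lambda>i' k. K i' k + (- s) / (1 - (- s) * ?d) * vm n ?v K i' * vm n ?v K k"
  have QX: "(\<lambda>k l. Q k l - (- s) * ?v k * ?v l) = barrier (u + \<eta>) (\<lambda>k l. - (X k l - \<tau> * M k l + s * ?v k * ?v l))"
    by (simp add: barrier_def fun_eq_iff)
  have i2: "inverse_on n (\<lambda>k l. Q k l - (- s) * ?v k * ?v l) ?K"
    using sherman_morrison_inverse[OF K, of "- s" ?v] pd_Q dpos by (auto simp: pd_def)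
  have p2: "pd n (\<lambda>k l. Q k l - (- s) * ?v k * ?v l)" by (rule pd_rank1_update[OF K pd_Q dpos])
  have "- al' * (1 / s + ?d) < ?c" using ch unfolding chosen_def inv_s .
  then have "- al' * (1 / s + ?d) * s \<le> ?c * s" using s0 by (intro mult_right_mono) auto
  also have "- al' * (1 / s + ?d) * s = - al' * (1 + s * ?d)" using s0 by (simp add: distrib_left distrib_right mult.assoc)
  finally have "- al' * (1 + s * ?d) \<le> s * ?c" by (simp only: mult.commute)
  then have "- al' \<le> s * ?c / (1 + s * ?d)" using dpos by (simp add: pos_le_divide_eq)
  then have "(- s) / (1 - (- s) * ?d) * ?c \<le> al'" by simp
  then have t2: "tr n ?K \<le> \<Phi>" unfolding sherman_morrison_trace using tr_K(1) by linarith
  show "confined \<Phi> (u + \<eta>) (\<lambda>k l. - (X k l - \<tau> * M k l + s * ?v k * ?v l))"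
    unfolding confined_def QX[symmetric] using i2 p2 t2 by blast
qed

text \<open>By \<open>exists_chosen\<close> there is then no lower deficit, so the shift alone
  respects both budgets and the step may add nothing.\<close>

lemma confined_no_step:
  assumes no: "\<not> (\<exists>i<n. \<exists>j<n. chosen i j)"
  shows "confined \<Phi> (u + \<eta>) (\<lambda>k l. X k l - \<tau> * M k l)"
    "confined \<Phi> (u + \<eta>) (\<lambda>k l. - (X k l - \<tau> * M k l))"
proof -
  have "0 \<le> al'" using exists_chosen no by fastforce
  then show "confined \<Phi> (u + \<eta>) (\<lambda>k l. - (X k l - \<tau> * M k l))"
    unfolding confined_def using K pd_Q tr_K(1) by (intro exI[of _ K]) auto
  show "confined \<Phi> (u + \<eta>) (\<lambda>k l. X k l - \<tau> * M k l)"
    unfolding confined_def using H pd_P tr_H al_pos by (intro exI[of _ H]) auto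
qed

end
end

section \<open>Gauss--Jordan elimination without pivoting\<close>

text \<open>The multipliers always come from \<open>W\<close>, so that one and the same row
  operation can be applied to \<open>W\<close> itself and to \<open>H\<close>.\<close>

definition elim_row :: "nat \<Rightarrow> (nat \<Rightarrow> nat \<Rightarrow> real) \<Rightarrow> (nat \<Rightarrow> nat \<Rightarrow> real) \<Rightarrow> nat \<Rightarrow> nat \<Rightarrow> real" where
  "elim_row k W X i j = (if i = k then X k j / W k k else X i j - W i k * (X k j / W k k))"

text \<open>The condition on the columns of \<open>H\<close> from k on records that only earlier
  rows have been used so far; it identifies the next pivot with a value of the form in
  \<open>gj_pivot_pos\<close>.\<close>

definition gj_inv :: "nat \<Rightarrow> (nat \<Rightarrow> nat \<Rightarrow> real) \<Rightarrow> nat \<Rightarrow> (nat \<Rightarrow> nat \<Rightarrow> real) \<Rightarrow> (nat \<Rightarrow> nat \<Rightarrow> real) \<Rightarrow> bool" where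
  "gj_inv n P k W H \<longleftrightarrow> (\<forall>i<n. \<forall>j<n. (\<Sum>l<n. H i l * P l j) = W i j)
    \<and> (\<forall>i<n. \<forall>j<n. j < k \<longrightarrow> W i j = (if i = j then 1 else 0))
    \<and> (\<forall>i<n. \<forall>j<n. k \<le> j \<longrightarrow> H i j = (if i = j then 1 else 0))"

lemma gj_inv_cong:
  assumes "gj_inv n P k W H" "\<And>i j. i < n \<Longrightarrow> j < n \<Longrightarrow> W' i j = W i j" "\<And>i j. i < n \<Longrightarrow> j < n \<Longrightarrow> H' i j = H i j"
  shows "gj_inv n P k W' H'"
  using assms by (simp add: gj_inv_def)

lemma gj_inv_0: "gj_inv n P 0 P (\<lambda>i j. if i = j then 1 else 0)"
  by (auto simp: gj_inv_def if_distrib[of "\<lambda>x. x * _"] cong: if_cong)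

lemma gj_inv_n: "gj_inv n P n W H \<Longrightarrow> inverse_on n P H"
  by (auto simp: gj_inv_def inverse_on_def)

text \<open>Row \<open>k\<close> of \<open>H\<close> is \<open>(h\<^sub>0, ..., h\<^sub>k\<^sub>-\<^sub>1, 1, 0, ..., 0)\<close> and row \<open>k\<close> of \<open>W = H P\<close> starts with \<open>k\<close> zeros,
  so the pivot equals the quadratic form of \<open>P\<close> at that row of \<open>H\<close>; hence no pivoting is needed.\<close>

lemma gj_pivot_pos:
  assumes "pd n P" "gj_inv n P k W H" "k < n"
  shows "0 < W k k"
proof -
  have "bf n P (H k) (H k) = (\<Sum>j<n. \<Sum>i<n. H k i * P i j * H k j)"
    unfolding bf_def by (rule sum.swap)
  also have "\<dots> = (\<Sum>j<n. W k j * H k j)"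
    using assms(2,3) by (simp add: sum_distrib_right[symmetric] gj_inv_def)
  also have "\<dots> = (\<Sum>j<n. if j = k then W k k else 0)"
  proof (rule sum.cong[OF refl])
    fix j assume "j \<in> {..<n}"
    then show "W k j * H k j = (if j = k then W k k else 0)"
      using assms(2,3) by (cases "j < k") (auto simp: gj_inv_def)
  qed
  also have "\<dots> = W k k" using assms(3) by simp
  finally have "bf n P (H k) (H k) = W k k" .
  moreover have "H k k = 1" using assms(2,3) by (simp add: gj_inv_def)
  ultimately show ?thesis using assms(1,3) unfolding pd_def by (metis zero_neq_one)
qed

lemma gj_inv_step:
  assumes "pd n P" "gj_inv n P k W H" "k < n"
  shows "gj_inv n P (Suc k) (elim_row k W W) (elim_row k W H)"
proof -
  have W: "0 < W k k" using gj_pivot_pos[OF assms] .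
  have HP: "(\<Sum>l<n. H i l * P l j) = W i j" if "i < n" "j < n" for i j
    using assms(2) that by (simp add: gj_inv_def)
  have kP: "(\<Sum>l<n. H k l / W k k * P l j) = W k j / W k k" if "j < n" for j
    using HP[OF assms(3) that] by (simp add: sum_divide_distrib[symmetric])
  have "(\<Sum>l<n. elim_row k W H i l * P l j) = elim_row k W W i j" if ij: "i < n" "j < n" for i j
  proof (cases "i = k")
    case True then show ?thesis using kP[OF ij(2)] by (simp add: elim_row_def)
  next
    case False
    have "(\<Sum>l<n. elim_row k W H i l * P l j)
      = (\<Sum>l<n. H i l * P l j) - W i k * (\<Sum>l<n. H k l / W k k * P l j)"
      using False by (simp add: elim_row_def sum_subtractf sum_distrib_left left_diff_distrib mult.assoc)
    also have "\<dots> = elim_row k W W i j" unfolding HP[OF ij] kP[OF ij(2)] using False by (simp add: elim_row_def)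
    finally show ?thesis .
  qed
  moreover have "elim_row k W W i j = (if i = j then 1 else 0)" if "i < n" "j < n" "j < Suc k" for i j
    using assms(2,3) that W by (cases "j = k") (auto simp: elim_row_def gj_inv_def)
  moreover have "elim_row k W H i j = (if i = j then 1 else 0)" if "i < n" "j < n" "Suc k \<le> j" for i j
    using assms(2,3) that by (auto simp: elim_row_def gj_inv_def)
  ultimately show ?thesis by (simp add: gj_inv_def)
qed

section \<open>Norms and powers\<close>

definition mv :: "nat \<Rightarrow> (nat \<Rightarrow> nat \<Rightarrow> real) \<Rightarrow> (nat \<Rightarrow> real) \<Rightarrow> nat \<Rightarrow> real" where
  "mv n A x i = (\<Sum>j<n. A i j * x j)"

lemma ip_mv: "ip n x (mv n A y) = bf n A x y"
  by (simp add: ip_def mv_def bf_def sum_distrib_left mult.assoc)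

lemma mv_cong: "(\<And>j. j < n \<Longrightarrow> x j = y j) \<Longrightarrow> mv n A x = mv n A y"
  by (simp add: mv_def fun_eq_iff)

lemma mv_scale: "mv n A (\<lambda>i. c * x i) = (\<lambda>i. c * mv n A x i)"
  by (simp add: mv_def sum_distrib_left mult_ac fun_eq_iff)

definition nrm :: "nat \<Rightarrow> (nat \<Rightarrow> real) \<Rightarrow> real" where "nrm n x = sqrt (ip n x x)"

lemma nrm_nonneg: "0 \<le> nrm n x" by (simp add: nrm_def ip_self_nonneg)
lemma nrm_sq: "(nrm n x)\<^sup>2 = ip n x x" by (simp add: nrm_def ip_self_nonneg)

lemma nrm_scale: "nrm n (\<lambda>i. c * x i) = \<bar>c\<bar> * nrm n x"
proof -
  have "ip n (\<lambda>i. c * x i) (\<lambda>i. c * x i) = c\<^sup>2 * ip n x x"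
    by (simp add: ip_def sum_distrib_left power2_eq_square mult_ac)
  then show ?thesis by (simp add: nrm_def real_sqrt_mult)
qed

lemma ip_le_nrm: "ip n x y \<le> nrm n x * nrm n y"
proof -
  have "(ip n x y)\<^sup>2 \<le> (nrm n x * nrm n y)\<^sup>2"
    using ip_Cauchy_Schwarz[of n x y] by (simp add: power_mult_distrib nrm_sq)
  then show ?thesis using nrm_nonneg by (metis abs_le_square_iff abs_le_D1 abs_of_nonneg mult_nonneg_nonneg)
qed

text \<open>The Schur test: each \<bar>A i j\<bar> is split into two square roots for
  Cauchy-Schwarz. Row sums bound one factor and, after exchanging the sums, column sums bound the
  other; by symmetry these are row sums too.\<close>

lemma (in signed_matrix) nrm_mv_le: "0 \<le> R \<Longrightarrow> nrm n (mv n A x) \<le> R * nrm n x"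
proof -
  assume R: "0 \<le> R"
  have "(mv n A x i)\<^sup>2 \<le> R * (\<Sum>j<n. \<bar>A i j\<bar> * (x j)\<^sup>2)" if i: "i < n" for i
  proof -
    let ?p = "\<lambda>j. sqrt \<bar>A i j\<bar>" and ?q = "\<lambda>j. sqrt \<bar>A i j\<bar> * \<bar>x j\<bar>"
    have "\<bar>mv n A x i\<bar> \<le> (\<Sum>j<n. \<bar>A i j * x j\<bar>)" unfolding mv_def by (rule sum_abs)
    also have "\<dots> = ip n ?p ?q" by (simp add: ip_def abs_mult flip: mult.assoc)
    finally have "\<bar>mv n A x i\<bar>\<^sup>2 \<le> (ip n ?p ?q)\<^sup>2" by (intro power_mono) auto
    also have "\<dots> \<le> ip n ?p ?p * ip n ?q ?q" by (rule ip_Cauchy_Schwarz)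
    also have "ip n ?p ?p = (\<Sum>j<n. \<bar>A i j\<bar>)" by (simp add: ip_def)
    also have "ip n ?q ?q = (\<Sum>j<n. \<bar>A i j\<bar> * (x j)\<^sup>2)"
      unfolding ip_def by (intro sum.cong refl) (simp add: power2_eq_square mult_ac)
    also have "(\<Sum>j<n. \<bar>A i j\<bar>) * (\<Sum>j<n. \<bar>A i j\<bar> * (x j)\<^sup>2) \<le> R * (\<Sum>j<n. \<bar>A i j\<bar> * (x j)\<^sup>2)"
      using row_le[OF i] by (intro mult_right_mono sum_nonneg) auto
    finally show ?thesis by simp
  qed
  then have "ip n (mv n A x) (mv n A x) \<le> (\<Sum>i<n. R * (\<Sum>j<n. \<bar>A i j\<bar> * (x j)\<^sup>2))"
    unfolding ip_def power2_eq_square[symmetric] by (intro sum_mono) auto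
  also have "\<dots> = R * (\<Sum>j<n. \<Sum>i<n. \<bar>A i j\<bar> * (x j)\<^sup>2)"
    unfolding sum_distrib_left[symmetric] by (subst sum.swap) simp
  also have "\<dots> = R * (\<Sum>j<n. (\<Sum>i<n. \<bar>A j i\<bar>) * (x j)\<^sup>2)"
    using A_sym by (simp add: sum_distrib_right sym_on_def)
  also have "\<dots> \<le> R * (\<Sum>j<n. R * (x j)\<^sup>2)"
    using row_le R by (intro mult_left_mono sum_mono mult_right_mono) auto
  also have "\<dots> = R\<^sup>2 * ip n x x" by (simp add: ip_def power2_eq_square sum_distrib_left mult_ac)
  finally show ?thesis using R unfolding nrm_def
    by (metis real_sqrt_le_iff real_sqrt_mult real_sqrt_abs abs_of_nonneg)
qed

text \<open>Polarisation: for w the multiple of X x with |w| = |x|, 4 w^T X x is the difference of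
  the form at x + w and x - w. The parallelogram law bounds it by 4 u |x|^2, while w^T X x = |x| |X
  x|.\<close>

lemma nrm_le_of_form:
  assumes "sym_on n X" "\<And>x. \<bar>bf n X x x\<bar> \<le> u * ip n x x" "0 \<le> u"
  shows "nrm n (mv n X x) \<le> u * nrm n x"
proof (cases "nrm n (mv n X x) = 0")
  case True then show ?thesis using assms(3) nrm_nonneg by simp
next
  case False
  then have N: "0 < nrm n (mv n X x)" using nrm_nonneg[of n "mv n X x"] by linarith
  define t where "t = nrm n x / nrm n (mv n X x)"
  define w where "w = (\<lambda>i. t * mv n X x i)"
  have t0: "0 \<le> t" using N nrm_nonneg by (simp add: t_def)
  have ww: "ip n w w = ip n x x"
  proof -
    have "nrm n w = nrm n x" using N nrm_nonneg[of n x] unfolding w_def nrm_scale t_def by simp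
    then show ?thesis by (simp only: nrm_sq[symmetric])
  qed
  have "4 * bf n X w x = bf n X (\<lambda>i. x i + w i) (\<lambda>i. x i + w i) - bf n X (\<lambda>i. x i + (-1) * w i) (\<lambda>i. x i + (-1) * w i)"
    unfolding bf_add_left bf_add_right bf_scale_left bf_scale_right
    using bf_commute[OF assms(1), of x w] by simp
  also have "\<dots> \<le> u * ip n (\<lambda>i. x i + w i) (\<lambda>i. x i + w i) + u * ip n (\<lambda>i. x i + (-1) * w i) (\<lambda>i. x i + (-1) * w i)"
    using assms(2)[of "\<lambda>i. x i + w i"] assms(2)[of "\<lambda>i. x i + (-1) * w i"] by linarith
  also have "\<dots> = 2 * u * (ip n x x + ip n w w)"
    by (simp add: ip_def algebra_simps sum.distrib sum_subtractf sum_distrib_left)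
  finally have "bf n X w x \<le> u * ip n x x" by (simp add: ww)
  also have "bf n X w x = t * (nrm n (mv n X x))\<^sup>2"
    by (simp add: ip_mv[symmetric] w_def nrm_sq) (simp add: ip_def sum_distrib_left mult_ac)
  also have "\<dots> = nrm n x * nrm n (mv n X x)" using N by (simp add: t_def power2_eq_square)
  finally have *: "nrm n x * nrm n (mv n X x) \<le> nrm n x * (u * nrm n x)"
    by (simp add: nrm_sq[symmetric] power2_eq_square mult_ac)
  show ?thesis
  proof (cases "nrm n x = 0")
    case True
    then have "\<forall>j<n. x j = 0"
      unfolding nrm_def ip_def by (simp add: sum_nonneg_eq_0_iff)
    then have "mv n X x = (\<lambda>_. 0)" by (simp add: mv_def fun_eq_iff)
    then show ?thesis using N by (simp add: nrm_def ip_def)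
  next
    case False
    then show ?thesis using * nrm_nonneg[of n x] by simp
  qed
qed

lemma confined_form_le:
  assumes "signed_matrix.confined n \<Phi> u X" "signed_matrix n A R"
  shows "bf n X x x \<le> u * ip n x x"
proof -
  interpret signed_matrix n A R by (rule assms(2))
  have "0 \<le> bf n (barrier u X) x x"
    using assms(1) pd_imp_psd by (auto simp: confined_def psd_def)
  also have "bf n (barrier u X) x x = bf n (\<lambda>i j. (if i = j then u else 0) + (-1) * X i j) x x"
    by (rule bf_cong) (auto simp: barrier_def)
  also have "\<dots> = u * ip n x x - bf n X x x" unfolding bf_add_mat bf_scale_mat bf_id by simp
  finally show ?thesis by simp
qed

text \<open>Log-convexity of \<open>k \<mapsto> \<parallel>A\<^sup>k x\<parallel>\<close>.\<close>

lemma power_ratio: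
  assumes "sym_on n A"
  shows "nrm n ((mv n A ^^ k) x) * nrm n (mv n A x) \<le> nrm n ((mv n A ^^ Suc k) x) * nrm n x"
proof (induction k)
  case 0 then show ?case by simp
next
  case (Suc k)
  let ?a = "\<lambda>k. nrm n ((mv n A ^^ k) x)"
  \<comment> \<open>Symmetry moves one application of \<open>A\<close> to the other argument,
    leaving an inner product of the neighbouring iterates.\<close>
  have "(?a (Suc k))\<^sup>2 = ip n ((mv n A ^^ Suc k) x) (mv n A ((mv n A ^^ k) x))" by (simp add: nrm_sq)
  also have "\<dots> = ip n ((mv n A ^^ k) x) ((mv n A ^^ Suc (Suc k)) x)"
    using bf_commute[OF assms] by (simp add: ip_mv)
  also have "\<dots> \<le> ?a k * ?a (Suc (Suc k))" by (rule ip_le_nrm)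
  finally have sq: "(?a (Suc k))\<^sup>2 \<le> ?a k * ?a (Suc (Suc k))" .
  show ?case
  proof (cases "?a (Suc k) = 0")
    case True then show ?thesis using nrm_nonneg by simp
  next
    case False
    then have pos: "0 < ?a (Suc k)" using nrm_nonneg[of n "(mv n A ^^ Suc k) x"] by linarith
    have "?a (Suc k) * (?a (Suc k) * nrm n (mv n A x)) = (?a (Suc k))\<^sup>2 * nrm n (mv n A x)"
      by (simp add: power2_eq_square)
    also have "\<dots> \<le> ?a k * ?a (Suc (Suc k)) * nrm n (mv n A x)"
      using sq nrm_nonneg by (rule mult_right_mono)
    also have "\<dots> = ?a (Suc (Suc k)) * (?a k * nrm n (mv n A x))" by simp
    also have "\<dots> \<le> ?a (Suc (Suc k)) * (?a (Suc k) * nrm n x)"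
      using Suc nrm_nonneg by (rule mult_left_mono)
    also have "\<dots> = ?a (Suc k) * (?a (Suc (Suc k)) * nrm n x)" by simp
    finally show ?thesis using pos by (simp only: mult_le_cancel_left_pos)
  qed
qed

text \<open>By \<open>power_ratio\<close> each further application of \<open>A\<close> stretches by
  at least |A x|/|x|, and |x| \<le> 1. That every x is covered lets the bound pass to the supremum
  later.\<close>

lemma power_lower:
  assumes "sym_on n A" "nrm n x \<le> 1"
  shows "nrm n (mv n A x) ^ Suc k \<le> nrm n ((mv n A ^^ Suc k) x)"
proof (induction k)
  case 0 then show ?case by simp
next
  case (Suc k)
  have "nrm n (mv n A x) ^ Suc (Suc k) \<le> nrm n ((mv n A ^^ Suc k) x) * nrm n (mv n A x)"
    using mult_right_mono[OF Suc nrm_nonneg[of n "mv n A x"]] by (simp only: power_Suc2)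
  also have "\<dots> \<le> nrm n ((mv n A ^^ Suc (Suc k)) x) * nrm n x" by (rule power_ratio[OF assms(1)])
  also have "\<dots> \<le> nrm n ((mv n A ^^ Suc (Suc k)) x)"
    using mult_left_mono[OF assms(2) nrm_nonneg[of n "(mv n A ^^ Suc (Suc k)) x"]] by simp
  finally show ?case .
qed

definition unit :: "nat \<Rightarrow> nat \<Rightarrow> real" where "unit j = (\<lambda>k. if k = j then 1 else 0)"

text \<open>The squared Frobenius norm of A^k, column by column.\<close>

definition power_sum :: "nat \<Rightarrow> (nat \<Rightarrow> nat \<Rightarrow> real) \<Rightarrow> nat \<Rightarrow> real" where
  "power_sum n A k = (\<Sum>j<n. ip n ((mv n A ^^ k) (unit j)) ((mv n A ^^ k) (unit j)))"

lemma power_expand: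
  "i < n \<Longrightarrow> (mv n A ^^ k) x i = (\<Sum>j<n. x j * (mv n A ^^ k) (unit j) i)"
proof (induction k arbitrary: i)
  case 0
  have "(\<Sum>j<n. x j * unit j i) = (\<Sum>j<n. if j = i then x j else 0)"
    by (intro sum.cong) (auto simp: unit_def)
  then show ?case using 0 by simp
next
  case (Suc k)
  have "(mv n A ^^ Suc k) x i = (\<Sum>l<n. A i l * (\<Sum>j<n. x j * (mv n A ^^ k) (unit j) l))"
    using Suc.IH unfolding funpow.simps o_def mv_def[of n A "(mv n A ^^ k) x"] by simp
  also have "\<dots> = (\<Sum>l<n. \<Sum>j<n. x j * (A i l * (mv n A ^^ k) (unit j) l))"
    by (simp add: sum_distrib_left mult_ac)
  also have "\<dots> = (\<Sum>j<n. x j * (mv n A ^^ Suc k) (unit j) i)"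
    by (subst sum.swap) (simp add: mv_def sum_distrib_left)
  finally show ?case .
qed

text \<open>\<open>power_lower\<close> followed by the bound of the operator norm of A^k by its
  Frobenius norm, which is Cauchy-Schwarz in each coordinate.\<close>

lemma power_sum_lower:
  assumes "sym_on n A" "nrm n x \<le> 1" "0 < k"
  shows "nrm n (mv n A x) ^ (2 * k) \<le> power_sum n A k"
proof -
  obtain k' where k: "k = Suc k'" using assms(3) by (cases k) auto
  let ?y = "\<lambda>j. (mv n A ^^ k) (unit j)"
  have "nrm n (mv n A x) ^ (2 * k) = (nrm n (mv n A x) ^ k)\<^sup>2" by (simp add: power_mult[symmetric] mult.commute)
  also have "\<dots> \<le> (nrm n ((mv n A ^^ k) x))\<^sup>2"
    using power_lower[OF assms(1,2), of k'] nrm_nonneg unfolding k by (intro power_mono) auto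
  also have "\<dots> = (\<Sum>i<n. ((mv n A ^^ k) x i)\<^sup>2)" unfolding nrm_sq by (simp add: ip_def power2_eq_square)
  also have "\<dots> \<le> (\<Sum>i<n. \<Sum>j<n. (?y j i)\<^sup>2)"
  proof (rule sum_mono)
    fix i assume "i \<in> {..<n}"
    then have "((mv n A ^^ k) x i)\<^sup>2 = (ip n x (\<lambda>j. ?y j i))\<^sup>2"
      using power_expand[where A = A and n = n and k = k and x = x and i = i] by (simp add: ip_def)
    also have "\<dots> \<le> ip n x x * ip n (\<lambda>j. ?y j i) (\<lambda>j. ?y j i)" by (rule ip_Cauchy_Schwarz)
    also have "\<dots> \<le> 1 * ip n (\<lambda>j. ?y j i) (\<lambda>j. ?y j i)"
      using assms(2) nrm_nonneg[of n x] ip_self_nonneg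
      by (intro mult_right_mono) (auto simp: nrm_sq[symmetric] power_le_one)
    finally show "((mv n A ^^ k) x i)\<^sup>2 \<le> (\<Sum>j<n. (?y j i)\<^sup>2)" by (simp add: ip_def power2_eq_square)
  qed
  also have "\<dots> = power_sum n A k"
    unfolding power_sum_def ip_def power2_eq_square[symmetric] by (rule sum.swap)
  finally show ?thesis .
qed

lemma power_sum_upper:
  assumes "\<And>x. nrm n (mv n A x) \<le> c * nrm n x" "0 \<le> c"
  shows "power_sum n A k \<le> n * c ^ (2 * k)"
proof -
  have "nrm n ((mv n A ^^ k) x) \<le> c ^ k * nrm n x" for x
  proof (induction k)
    case (Suc k)
    have "nrm n ((mv n A ^^ Suc k) x) \<le> c * nrm n ((mv n A ^^ k) x)" using assms(1) by simp
    also have "\<dots> \<le> c * (c ^ k * nrm n x)" using Suc assms(2) by (rule mult_left_mono)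
    finally show ?case by (simp add: mult.assoc)
  qed simp
  moreover have "nrm n (unit j) = 1" if "j < n" for j
    using ip_unit[OF that, of "unit j"] unfolding nrm_def unit_def by simp
  ultimately have "nrm n ((mv n A ^^ k) (unit j)) \<le> c ^ k" if "j < n" for j
    using that by (metis mult.right_neutral)
  then have "(nrm n ((mv n A ^^ k) (unit j)))\<^sup>2 \<le> (c ^ k)\<^sup>2" if "j < n" for j
    using that nrm_nonneg by (intro power_mono) auto
  then have "power_sum n A k \<le> (\<Sum>j<n. (c ^ k)\<^sup>2)"
    unfolding power_sum_def nrm_sq[symmetric] by (intro sum_mono) auto
  also have "\<dots> = n * c ^ (2 * k)" by (simp add: power_mult[symmetric] mult.commute)
  finally show ?thesis .
qed

section \<open>Reasoning about programs\<close>

text \<open>Total correctness with a time budget. The postcondition may itself be a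
  \<open>runs\<close> statement, which is how \<open>runs_Seq\<close> chains fragments; the budget
  is an upper bound, so costs can be rounded up generously.\<close>

definition runs :: "com \<Rightarrow> nat \<Rightarrow> state \<Rightarrow> (state \<Rightarrow> bool) \<Rightarrow> bool" where
  "runs c b s Q \<longleftrightarrow> (\<exists>t s'. exec c s t s' \<and> t \<le> b \<and> Q s')"

lemma runs_mono: "runs c b s Q \<Longrightarrow> b \<le> b' \<Longrightarrow> (\<And>s'. Q s' \<Longrightarrow> Q' s') \<Longrightarrow> runs c b' s Q'"
  unfolding runs_def by (meson order_trans)

section \<open>Write sets and frame conditions\<close>

primrec iw :: "com \<Rightarrow> name set" where
  "iw Skip = {}"
| "iw (IAssign x a) = {x}"
| "iw (IStore x a b e) = {}"
| "iw (RAssign x e) = {}"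
| "iw (RStore x a b e) = {}"
| "iw (Seq c d) = iw c \<union> iw d"
| "iw (Cond b c d) = iw c \<union> iw d"
| "iw (While b c) = iw c"

primrec rw :: "com \<Rightarrow> name set" where
  "rw Skip = {}"
| "rw (IAssign x a) = {}"
| "rw (IStore x a b e) = {}"
| "rw (RAssign x e) = {x}"
| "rw (RStore x a b e) = {}"
| "rw (Seq c d) = rw c \<union> rw d"
| "rw (Cond b c d) = rw c \<union> rw d"
| "rw (While b c) = rw c"

primrec aw :: "com \<Rightarrow> name set" where
  "aw Skip = {}"
| "aw (IAssign x a) = {}"
| "aw (IStore x a b e) = {}"
| "aw (RAssign x e) = {}"
| "aw (RStore x a b e) = {x}"
| "aw (Seq c d) = aw c \<union> aw d"
| "aw (Cond b c d) = aw c \<union> aw d"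
| "aw (While b c) = aw c"

text \<open>The frame relation for index variables, real variables and real arrays, an array
  counting as a whole. Since the write sets are computed by simplification, most facts about
  unchanged memory follow automatically.\<close>

definition agree :: "com \<Rightarrow> state \<Rightarrow> state \<Rightarrow> bool" where
  "agree c s s' \<longleftrightarrow> (\<forall>x. x \<notin> iw c \<longrightarrow> ivar s' x = ivar s x) \<and> (\<forall>x. x \<notin> rw c \<longrightarrow> rvar s' x = rvar s x)
     \<and> (\<forall>x. x \<notin> aw c \<longrightarrow> rarr s' x = rarr s x)"

lemma agreeI: "agree c s s' \<Longrightarrow> x \<notin> iw c \<Longrightarrow> ivar s' x = ivar s x"
  and agreeR: "agree c s s' \<Longrightarrow> x \<notin> rw c \<Longrightarrow> rvar s' x = rvar s x"
  and agreeA: "agree c s s' \<Longrightarrow> x \<notin> aw c \<Longrightarrow> rarr s' x = rarr s x"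
  by (auto simp: agree_def)

lemma agree_refl: "agree c s s" by (simp add: agree_def)

lemma agree_trans: "agree c s s' \<Longrightarrow> agree c s' s'' \<Longrightarrow> agree c s s''"
  by (simp add: agree_def)

lemma agree_mono: "agree c s s' \<Longrightarrow> iw c \<subseteq> iw d \<Longrightarrow> rw c \<subseteq> rw d \<Longrightarrow> aw c \<subseteq> aw d \<Longrightarrow> agree d s s'"
  unfolding agree_def by blast

lemma exec_agree: "exec c s t s' \<Longrightarrow> agree c s s'"
  by (induction rule: exec.induct) (auto simp: agree_def iupd_def rupd_def istore_def rstore_def)

lemma runs_agree: "runs c b s Q \<Longrightarrow> runs c b s (\<lambda>s'. agree c s s' \<and> Q s')"
  unfolding runs_def using exec_agree by blast

lemma runs_Seq:
  assumes "runs c p s (\<lambda>s'. runs d q s' Q)" "p + q \<le> b" shows "runs (Seq c d) b s Q"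
  using assms unfolding runs_def by (meson add_mono exec.Seq order_trans)

lemma runs_Cond:
  assumes "tval e s \<Longrightarrow> runs c b' s Q" "\<not> tval e s \<Longrightarrow> runs d b' s Q" "tcost e + b' \<le> b"
  shows "runs (Cond e c d) b s Q"
proof (cases "tval e s")
  case True
  then obtain t s' where "exec c s t s'" "t \<le> b'" "Q s'" using assms(1) by (auto simp: runs_def)
  then show ?thesis using assms(3) exec.CondTrue[OF True] unfolding runs_def
    by (intro exI[of _ "tcost e + t"] exI[of _ s']) auto
next
  case False
  then obtain t s' where "exec d s t s'" "t \<le> b'" "Q s'" using assms(2) by (auto simp: runs_def)
  then show ?thesis using assms(3) exec.CondFalse[OF False] unfolding runs_def
    by (intro exI[of _ "tcost e + t"] exI[of _ s']) auto
qed

section \<open>Straight-line code\<close>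

primrec loop_free :: "com \<Rightarrow> bool" where
  "loop_free Skip = True"
| "loop_free (IAssign x a) = True"
| "loop_free (IStore x a b e) = True"
| "loop_free (RAssign x e) = True"
| "loop_free (RStore x a b e) = True"
| "loop_free (Seq c d) = (loop_free c \<and> loop_free d)"
| "loop_free (Cond b c d) = (loop_free c \<and> loop_free d)"
| "loop_free (While b c) = False"

text \<open>A functional semantics that simplification can evaluate. The clause for
  \<open>While\<close> is a default value; \<open>exec_loop_free\<close> assumes
  \<open>loop_free\<close>.\<close>

primrec sem :: "com \<Rightarrow> state \<Rightarrow> state" where
  "sem Skip s = s"
| "sem (IAssign x a) s = iupd x (ival a s) s"
| "sem (IStore x a b e) s = istore x (ival a s) (ival b s) (ival e s) s"
| "sem (RAssign x e) s = rupd x (rval e s) s"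
| "sem (RStore x a b e) s = rstore x (ival a s) (ival b s) (rval e s) s"
| "sem (Seq c d) s = sem d (sem c s)"
| "sem (Cond b c d) s = (if tval b s then sem c s else sem d s)"
| "sem (While b c) s = s"

text \<open>An upper bound that depends on the program alone: for a conditional the costs of both
  branches are added.\<close>

primrec cost :: "com \<Rightarrow> nat" where
  "cost Skip = 1"
| "cost (IAssign x a) = icost a + 1"
| "cost (IStore x a b e) = icost a + icost b + icost e + 1"
| "cost (RAssign x e) = rcost e + 1"
| "cost (RStore x a b e) = icost a + icost b + rcost e + 1"
| "cost (Seq c d) = cost c + cost d"
| "cost (Cond b c d) = tcost b + (cost c + cost d)"
| "cost (While b c) = 0"

lemma exec_loop_free: "loop_free c \<Longrightarrow> \<exists>t \<le> cost c. exec c s t (sem c s)"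
proof (induction c arbitrary: s)
  case (Seq c d)
  then obtain t u where "t \<le> cost c" "exec c s t (sem c s)" "u \<le> cost d" "exec d (sem c s) u (sem d (sem c s))"
    by fastforce
  then show ?case by (intro exI[of _ "t + u"]) (auto intro: exec.Seq)
next
  case (Cond b c d)
  then obtain t u where "t \<le> cost c" "exec c s t (sem c s)" "u \<le> cost d" "exec d s u (sem d s)"
    by fastforce
  then show ?case
    by (intro exI[of _ "tcost b + (if tval b s then t else u)"]) (auto intro: exec.CondTrue exec.CondFalse)
qed (unfold cost.simps sem.simps loop_free.simps, (rule exI, rule conjI, rule order_refl, rule exec.intros | simp)+)

lemma runs_loop_free: "loop_free c \<Longrightarrow> cost c \<le> b \<Longrightarrow> Q (sem c s) \<Longrightarrow> runs c b s Q"
  unfolding runs_def using exec_loop_free[of c s] by (meson order_trans)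

section \<open>Loops\<close>

definition For :: "name \<Rightarrow> name \<Rightarrow> com \<Rightarrow> com" where
  "For x m c = Seq (IAssign x (IConst 0))
     (While (ILess (IVar x) (IVar m)) (Seq c (IAssign x (IAdd (IVar x) (IConst 1)))))"

lemma iw_For [simp]: "iw (For x m c) = insert x (iw c)"
  and rw_For [simp]: "rw (For x m c) = rw c"
  and aw_For [simp]: "aw (For x m c) = aw c"
  by (auto simp: For_def)

text \<open>A round costs 3 for the test and 4 for the increment, rounded up to 8; the initial
  assignment and the final test cost 5, again rounded to 8. \<open>stable\<close> makes the
  invariant independent of the loop variable, so that it speaks of the round number and survives the
  increment.\<close>

lemma runs_For:
  assumes x: "x \<notin> iw c" "m \<notin> iw c" "m \<noteq> x" and N: "ivar s m = N"
    and I0: "I 0 s"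
    and step: "\<And>k s'. k < N \<Longrightarrow> agree (For x m c) s s' \<Longrightarrow> ivar s' x = k \<Longrightarrow> I k s' \<Longrightarrow> runs c b s' (I (Suc k))"
    and stable: "\<And>k z s'. I k s' \<Longrightarrow> I k (iupd x z s')"
    and B: "N * (b + 8) + 8 \<le> B"
    and Q: "\<And>s'. agree (For x m c) s s' \<Longrightarrow> I N s' \<Longrightarrow> Q s'"
  shows "runs (For x m c) B s Q"
proof -
  let ?w = "While (ILess (IVar x) (IVar m)) (Seq c (IAssign x (IAdd (IVar x) (IConst 1))))"
  have loop: "\<exists>t s''. exec ?w s' t s'' \<and> t \<le> d * (b + 8) + 3 \<and> agree (For x m c) s s'' \<and> I N s''"
    if "agree (For x m c) s s'" "ivar s' x = k" "I k s'" "k + d = N" for d k s'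
    using that
  proof (induction d arbitrary: k s')
    case 0
    have "ivar s' m = N" using agreeI[OF 0(1), of m] x N by simp
    then have "exec ?w s' (tcost (ILess (IVar x) (IVar m))) s'"
      using 0 by (intro exec.WhileFalse) auto
    then show ?case using 0 by (intro exI[of _ "tcost (ILess (IVar x) (IVar m))"] exI[of _ s']) auto
  next
    case (Suc d)
    have m: "ivar s' m = N" using agreeI[OF Suc(2), of m] x N by simp
    have "runs c b s' (\<lambda>s''. agree c s' s'' \<and> I (Suc k) s'')"
      using Suc(2-5) by (intro runs_agree step) auto
    then obtain t s1 where t: "exec c s' t s1" "t \<le> b" "agree c s' s1" "I (Suc k) s1"
      unfolding runs_def by blast
    have k1: "ivar s1 x = k" using agreeI[OF t(3) x(1)] Suc(3) by simp
    let ?s2 = "iupd x (Suc k) s1"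
    have "iupd x (ival (IAdd (IVar x) (IConst 1)) s1) s1 = ?s2" using k1 by simp
    then have e2: "exec (IAssign x (IAdd (IVar x) (IConst 1))) s1 (icost (IAdd (IVar x) (IConst 1)) + 1) ?s2"
      by (metis exec.IAssign)
    have "agree (For x m c) s' s1" by (rule agree_mono[OF t(3)]) auto
    then have "agree (For x m c) s s1" using Suc(2) agree_trans by blast
    then have ag: "agree (For x m c) s ?s2" by (simp add: agree_def iupd_def)
    obtain u s'' where u: "exec ?w ?s2 u s''" "u \<le> d * (b + 8) + 3" "agree (For x m c) s s''" "I N s''"
      using Suc.IH[OF ag, of "Suc k"] stable[OF t(4)] Suc(5) by (auto simp: iupd_def)
    have "exec ?w s' (tcost (ILess (IVar x) (IVar m)) + (t + (icost (IAdd (IVar x) (IConst 1)) + 1)) + u) s''"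
      using Suc(3,5) m by (intro exec.WhileTrue[OF _ exec.Seq[OF t(1) e2] u(1)]) auto
    then show ?case using t(2) u by (intro exI[of _ "tcost (ILess (IVar x) (IVar m)) + (t + (icost (IAdd (IVar x) (IConst 1)) + 1)) + u"] exI[of _ s'']) auto
  qed
  let ?s0 = "iupd x 0 s"
  have "agree (For x m c) s ?s0" by (simp add: agree_def iupd_def)
  then obtain t s'' where t: "exec ?w ?s0 t s''" "t \<le> N * (b + 8) + 3" "agree (For x m c) s s''" "I N s''"
    using loop[of ?s0 0 N] stable[OF I0] by (auto simp: iupd_def)
  have "exec (For x m c) s (icost (IConst 0) + 1 + t) s''"
    unfolding For_def
  proof (rule exec.Seq[OF exec.IAssign])
    show "exec ?w (iupd x (ival (IConst 0) s) s) t s''" using t(1) by simp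
  qed
  moreover have "icost (IConst 0) + 1 + t \<le> B" using t(2) B by simp
  moreover have "Q s''" using t(3,4) by (rule Q)
  ultimately show ?thesis unfolding runs_def by blast
qed

text \<open>The counter k exists only in the invariant. Termination comes from the step, which must
  prove k < N whenever the test succeeds.\<close>

lemma runs_While:
  assumes I0: "I 0 s"
    and step: "\<And>k s'. agree c s s' \<Longrightarrow> I k s' \<Longrightarrow> tval e s' \<Longrightarrow> k < N \<and> runs c b s' (I (Suc k))"
    and B: "N * (b + tcost e) + tcost e \<le> B"
    and Q: "\<And>k s'. agree c s s' \<Longrightarrow> I k s' \<Longrightarrow> \<not> tval e s' \<Longrightarrow> Q s'"
  shows "runs (While e c) B s Q"
proof -
  have loop: "\<exists>t s''. exec (While e c) s' t s'' \<and> t \<le> d * (b + tcost e) + tcost e \<and> Q s''"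
    if "agree c s s'" "I k s'" "k + d = N \<or> (k > N \<and> d = 0)" for d k s'
    using that
  proof (induction d arbitrary: k s')
    case 0
    then have "\<not> tval e s'" using step[OF 0(1,2)] by auto
    then show ?case using Q[OF 0(1,2)] exec.WhileFalse by fastforce
  next
    case (Suc d)
    show ?case
    proof (cases "tval e s'")
      case False
      then show ?thesis using Q[OF Suc(2,3)] exec.WhileFalse by fastforce
    next
      case True
      then obtain t s1 where t: "exec c s' t s1" "t \<le> b" "I (Suc k) s1"
        using step[OF Suc(2,3)] unfolding runs_def by blast
      have "agree c s s1" using agree_trans[OF Suc(2) exec_agree[OF t(1)]] .
      then obtain u s'' where u: "exec (While e c) s1 u s''" "u \<le> d * (b + tcost e) + tcost e" "Q s''"
        using Suc.IH[of s1 "Suc k"] t(3) Suc(4) by auto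
      have "exec (While e c) s' (tcost e + t + u) s''" using exec.WhileTrue[OF True t(1) u(1)] .
      then show ?thesis using t(2) u by (intro exI[of _ "tcost e + t + u"] exI[of _ s'']) auto
    qed
  qed
  show ?thesis using loop[OF agree_refl I0, of N] B unfolding runs_def by (meson add_0 order_trans)
qed

lemma state_upd [simp]:
  "ivar (iupd x v s) y = (if y = x then v else ivar s y)" "rvar (iupd x v s) = rvar s" "rarr (iupd x v s) = rarr s"
  "ivar (rupd x r s) = ivar s" "rvar (rupd x r s) y = (if y = x then r else rvar s y)" "rarr (rupd x r s) = rarr s"
  "ivar (rstore X i j r s) = ivar s" "rvar (rstore X i j r s) = rvar s"
  "rarr (rstore X i j r s) Y = (if Y = X then (rarr s X)(i := (rarr s X i)(j := r)) else rarr s Y)"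
  by (simp_all add: iupd_def rupd_def rstore_def)

abbreviation ent :: "name \<Rightarrow> name \<Rightarrow> name \<Rightarrow> rexp" where "ent X i j \<equiv> REntry X (IVar i) (IVar j)"
abbreviation put :: "name \<Rightarrow> name \<Rightarrow> name \<Rightarrow> rexp \<Rightarrow> com" where "put X i j \<equiv> RStore X (IVar i) (IVar j)"

definition Map2 :: "com \<Rightarrow> com" where "Map2 c = For ''i'' ''n'' (For ''j'' ''n'' c)"

lemma iw_Map2 [simp]: "iw (Map2 c) = insert ''i'' (insert ''j'' (iw c))"
  and rw_Map2 [simp]: "rw (Map2 c) = rw c"
  and aw_Map2 [simp]: "aw (Map2 c) = aw c"
  by (auto simp: Map2_def)

text \<open>The step may assume that the entry at the current position still has its initial value.
  This is what permits updates in place that read the entry they overwrite.\<close>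

lemma runs_Map2:
  assumes n: "ivar s ''n'' = n" and c: "''i'' \<notin> iw c" "''j'' \<notin> iw c" "''n'' \<notin> iw c"
    and step: "\<And>s' i j. i < n \<Longrightarrow> j < n \<Longrightarrow> agree (Map2 c) s s' \<Longrightarrow> ivar s' ''i'' = i \<Longrightarrow> ivar s' ''j'' = j \<Longrightarrow>
      rarr s' X i j = rarr s X i j \<Longrightarrow>
      runs c b s' (\<lambda>s''. rarr s'' X = (rarr s' X)(i := (rarr s' X i)(j := f i j)))"
    and B: "n * (n * (b + 8) + 16) + 8 \<le> B"
    and Q: "\<And>s'. agree (Map2 c) s s' \<Longrightarrow> (\<And>i j. i < n \<Longrightarrow> j < n \<Longrightarrow> rarr s' X i j = f i j) \<Longrightarrow> Q s'"
  shows "runs (Map2 c) B s Q"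
proof -
  let ?I = "\<lambda>k s'. \<forall>i j. rarr s' X i j = (if i < k \<and> j < n then f i j else rarr s X i j)"
  show ?thesis unfolding Map2_def
  proof (rule runs_For[where I = ?I and b = "n * (b + 8) + 8"])
    show "n * (n * (b + 8) + 8 + 8) + 8 \<le> B" using B by (simp add: add_ac)
  next
    fix k s' assume k: "k < n" and ag: "agree (For ''i'' ''n'' (For ''j'' ''n'' c)) s s'"
      and iv: "ivar s' ''i'' = k" and I: "?I k s'"
    have n': "ivar s' ''n'' = n" using agreeI[OF ag, of "''n''"] c n by simp
    let ?J = "\<lambda>l s''. \<forall>i j. rarr s'' X i j = (if i < k \<and> j < n \<or> i = k \<and> j < l then f i j else rarr s X i j)"
    show "runs (For ''j'' ''n'' c) (n * (b + 8) + 8) s' (?I (Suc k))"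
    proof (rule runs_For[where I = ?J and b = b and N = n])
      fix l s'' assume l: "l < n" and ag2: "agree (For ''j'' ''n'' c) s' s''" and jv: "ivar s'' ''j'' = l" and J: "?J l s''"
      have ag3: "agree (Map2 c) s s''"
        by (rule agree_trans[OF ag[folded Map2_def]]) (rule agree_mono[OF ag2], auto)
      have iv2: "ivar s'' ''i'' = k" using agreeI[OF ag2, of "''i''"] c iv by simp
      show "runs c b s'' (?J (Suc l))"
        by (rule runs_mono[OF step[OF k l ag3 iv2 jv]]) (use J k l in auto)
    qed (use c n' I in \<open>auto simp: less_Suc_eq\<close>)
  next
    fix s' assume "agree (For ''i'' ''n'' (For ''j'' ''n'' c)) s s'" "?I n s'"
    then show "Q s'" by (intro Q) (auto simp: Map2_def)
  qed (use c n in auto)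
qed

lemma runs_Fill2:
  assumes "ivar s ''n'' = n"
    and "\<And>s' i j. i < n \<Longrightarrow> j < n \<Longrightarrow> agree (Map2 (put X ''i'' ''j'' e)) s s' \<Longrightarrow>
      ivar s' ''i'' = i \<Longrightarrow> ivar s' ''j'' = j \<Longrightarrow> rarr s' X i j = rarr s X i j \<Longrightarrow> rval e s' = f i j"
    and "n * (n * (rcost e + 11) + 16) + 8 \<le> B"
    and "\<And>s'. agree (Map2 (put X ''i'' ''j'' e)) s s' \<Longrightarrow>
      (\<And>i j. i < n \<Longrightarrow> j < n \<Longrightarrow> rarr s' X i j = f i j) \<Longrightarrow> Q s'"
  shows "runs (Map2 (put X ''i'' ''j'' e)) B s Q"
  by (rule runs_Map2[OF assms(1), where b = "rcost e + 3" and X = X and f = f])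
    (use assms(2-4) in \<open>auto intro!: runs_loop_free simp: add_ac\<close>)

text \<open>Vectors are kept in column 0 of a two-index array.\<close>

lemma runs_Fill1:
  assumes "ivar s ''n'' = n" "x \<noteq> ''n''"
    and "\<And>s' k. k < n \<Longrightarrow> agree (For x ''n'' (RStore X (IVar x) (IConst 0) e)) s s' \<Longrightarrow> ivar s' x = k \<Longrightarrow> rval e s' = f k"
    and "n * (rcost e + 11) + 8 \<le> B"
    and "\<And>s'. agree (For x ''n'' (RStore X (IVar x) (IConst 0) e)) s s' \<Longrightarrow>
      (\<And>k. k < n \<Longrightarrow> rarr s' X k 0 = f k) \<Longrightarrow> Q s'"
  shows "runs (For x ''n'' (RStore X (IVar x) (IConst 0) e)) B s Q"
proof (rule runs_For[where I = "\<lambda>k s'. \<forall>a<k. rarr s' X a 0 = f a" and b = "rcost e + 3" and N = n])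
  fix k s' assume "k < n" "agree (For x ''n'' (RStore X (IVar x) (IConst 0) e)) s s'" "ivar s' x = k" "\<forall>a<k. rarr s' X a 0 = f a"
  then show "runs (RStore X (IVar x) (IConst 0) e) (rcost e + 3) s' (\<lambda>s'. \<forall>a<Suc k. rarr s' X a 0 = f a)"
    using assms(3) by (intro runs_loop_free) (auto simp: less_Suc_eq)
qed (use assms in \<open>auto simp: add_ac\<close>)

text \<open>The accumulator is not cleared, so that nested sums can continue the same one; callers
  reset it.\<close>

definition Sum :: "name \<Rightarrow> name \<Rightarrow> rexp \<Rightarrow> com" where
  "Sum x y e = For x ''n'' (RAssign y (RAdd (RVar y) e))"

lemma iw_Sum [simp]: "iw (Sum x y e) = {x}" and rw_Sum [simp]: "rw (Sum x y e) = {y}" and aw_Sum [simp]: "aw (Sum x y e) = {}"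
  by (auto simp: Sum_def)

lemma runs_Sum:
  assumes "ivar s ''n'' = n" "x \<noteq> ''n''"
    and "\<And>s' k. k < n \<Longrightarrow> agree (Sum x y e) s s' \<Longrightarrow> ivar s' x = k \<Longrightarrow> rval e s' = f k"
    and "n * (rcost e + 11) + 8 \<le> B"
    and "\<And>s'. agree (Sum x y e) s s' \<Longrightarrow> rvar s' y = rvar s y + (\<Sum>k<n. f k) \<Longrightarrow> Q s'"
  shows "runs (Sum x y e) B s Q"
  unfolding Sum_def
proof (rule runs_For[where I = "\<lambda>k s'. rvar s' y = rvar s y + (\<Sum>a<k. f a)" and b = "rcost e + 3" and N = n])
  fix k s' assume "k < n" "agree (For x ''n'' (RAssign y (RAdd (RVar y) e))) s s'" "ivar s' x = k"
    "rvar s' y = rvar s y + (\<Sum>a<k. f a)"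
  then show "runs (RAssign y (RAdd (RVar y) e)) (rcost e + 3) s' (\<lambda>s'. rvar s' y = rvar s y + (\<Sum>a<Suc k. f a))"
    using assms(3)[of k s'] by (intro runs_loop_free) (auto simp: Sum_def)
qed (use assms in \<open>auto simp: Sum_def add_ac\<close>)

text \<open>The Kronecker delta by truncated subtraction: the inner sum is the distance of the two
  indices, and 1 minus it is 1 exactly at distance 0.\<close>

definition dlt :: "name \<Rightarrow> name \<Rightarrow> rexp" where
  "dlt x y = ROfIndex (ISub (IConst 1) (IAdd (ISub (IVar x) (IVar y)) (ISub (IVar y) (IVar x))))"

lemma rval_dlt [simp]: "rval (dlt x y) s = (if ivar s x = ivar s y then 1 else 0)"
  by (auto simp: dlt_def)
lemma rcost_dlt [simp]: "rcost (dlt x y) = 10"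
  by (simp add: dlt_def)

section \<open>Program fragments\<close>

text \<open>Expressions have no absolute value; from here on \<bar>A\<bar> is obtained as the
  product of \<open>A\<close> with the stored signs.\<close>

definition prog_sign :: com where
  "prog_sign = Map2 (Cond (RLess (ent ''A'' ''i'' ''j'') (RConst 0))
     (put ''S'' ''i'' ''j'' (RConst (-1))) (put ''S'' ''i'' ''j'' (RConst 1)))"

abbreviation row_sum :: com where
  "row_sum \<equiv> Sum ''j'' ''d'' (RMul (ent ''S'' ''i'' ''j'') (ent ''A'' ''i'' ''j''))"

abbreviation row_store :: com where
  "row_store \<equiv> Seq (RStore ''D'' (IVar ''i'') (IConst 0) (RVar ''d''))
     (Cond (RLess (RVar ''R'') (RVar ''d'')) (RAssign ''R'' (RVar ''d'')) Skip)"

definition prog_rows :: com where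
  "prog_rows = Seq (RAssign ''R'' (RConst 0))
    (For ''i'' ''n'' (Seq (RAssign ''d'' (RConst 0)) (Seq row_sum
      row_store)))"

definition prog_M :: com where
  "prog_M = Map2 (put ''M'' ''i'' ''j''
     (RAdd (ent ''A'' ''i'' ''j'') (RMul (dlt ''i'' ''j'') (REntry ''D'' (IVar ''i'') (IConst 0)))))"

definition prog_setup :: com where "prog_setup = Seq prog_sign (Seq prog_rows prog_M)"

lemma runs_sign:
  assumes "ivar s ''n'' = n"
    and "\<And>s'. agree prog_sign s s' \<Longrightarrow>
      (\<And>i j. i < n \<Longrightarrow> j < n \<Longrightarrow> rarr s' ''S'' i j = (if rarr s ''A'' i j < 0 then -1 else 1)) \<Longrightarrow> Q s'"
  shows "runs prog_sign (n * (n * 30 + 16) + 8) s Q"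
  unfolding prog_sign_def
  by (rule runs_Map2[OF assms(1), where b = 22 and X = "''S''" and f = "\<lambda>i j. if rarr s ''A'' i j < 0 then -1 else 1"])
    (use assms(2) in \<open>auto intro!: runs_loop_free simp: agreeA prog_sign_def\<close>)

text \<open>That \<open>R\<close> is 0 or attained by a row is recorded because it later bounds
  \<open>R\<close> by \<open>inf_norm\<close>.\<close>

lemma runs_rows:
  assumes n: "ivar s ''n'' = n"
    and S: "\<And>i j. i < n \<Longrightarrow> j < n \<Longrightarrow> rarr s ''S'' i j * rarr s ''A'' i j = \<bar>rarr s ''A'' i j\<bar>"
    and Q: "\<And>s'. agree prog_rows s s' \<Longrightarrow>
      (\<And>i. i < n \<Longrightarrow> rarr s' ''D'' i 0 = (\<Sum>j<n. \<bar>rarr s ''A'' i j\<bar>)) \<Longrightarrow>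
      (\<And>i. i < n \<Longrightarrow> (\<Sum>j<n. \<bar>rarr s ''A'' i j\<bar>) \<le> rvar s' ''R'') \<Longrightarrow> 0 \<le> rvar s' ''R'' \<Longrightarrow>
      rvar s' ''R'' = 0 \<or> (\<exists>i<n. rvar s' ''R'' = (\<Sum>j<n. \<bar>rarr s ''A'' i j\<bar>)) \<Longrightarrow> Q s'"
  shows "runs prog_rows (n * (n * 18 + 40) + 10) s Q"
  unfolding prog_rows_def
proof (rule runs_Seq[where p = 2 and q = "n * (n * 18 + 32 + 8) + 8"])
  let ?r = "\<lambda>i. \<Sum>j<n. \<bar>rarr s ''A'' i j\<bar>"
  let ?I = "\<lambda>k s'. (\<forall>i<k. rarr s' ''D'' i 0 = ?r i \<and> ?r i \<le> rvar s' ''R'') \<and> 0 \<le> rvar s' ''R''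
    \<and> (rvar s' ''R'' = 0 \<or> (\<exists>i<k. rvar s' ''R'' = ?r i))"
  let ?body = "Seq (RAssign ''d'' (RConst 0)) (Seq row_sum
      row_store)"
  let ?s0 = "rupd ''R'' 0 s"
  have loop: "runs (For ''i'' ''n'' ?body) (n * (n * 18 + 32 + 8) + 8) ?s0 Q"
  proof (rule runs_For[where I = ?I and b = "n * 18 + 32" and N = n])
    fix k s' assume k: "k < n" and ag: "agree (For ''i'' ''n'' ?body) ?s0 s'" and iv: "ivar s' ''i'' = k" and I: "?I k s'"
    note [simp] = agreeI[OF ag] agreeA[OF ag]
    show "runs ?body (n * 18 + 32) s' (?I (Suc k))"
    proof (rule runs_Seq[where p = 2 and q = "n * 18 + 30"], rule runs_loop_free)
      show "runs (Seq row_sum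
      row_store) (n * 18 + 30) (sem (RAssign ''d'' (RConst 0)) s') (?I (Suc k))"
      proof (rule runs_Seq[where p = "n * 18 + 8" and q = 22],
          rule runs_Sum[where n = n and f = "\<lambda>j. \<bar>rarr s ''A'' k j\<bar>"])
        fix s2 assume ag2: "agree row_sum (sem (RAssign ''d'' (RConst 0)) s') s2"
          and d: "rvar s2 ''d'' = rvar (sem (RAssign ''d'' (RConst 0)) s') ''d'' + ?r k"
        note [simp] = agreeI[OF ag2] agreeA[OF ag2] agreeR[OF ag2]
        show "runs row_store 22 s2 (?I (Suc k))"
          by (rule runs_loop_free) (use I d iv in \<open>auto simp: less_Suc_eq\<close>)
      next
        fix s2 j assume "j < n" and ag2: "agree row_sum (sem (RAssign ''d'' (RConst 0)) s') s2"
          "ivar s2 ''j'' = j"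
        then show "rval (RMul (ent ''S'' ''i'' ''j'') (ent ''A'' ''i'' ''j'')) s2 = \<bar>rarr s ''A'' k j\<bar>"
          using S k iv agreeI[OF ag2(1)] agreeA[OF ag2(1)] by simp
      qed (use n in auto)
    qed auto
  next
    fix s' assume ag: "agree (For ''i'' ''n'' ?body) ?s0 s'" and I: "?I n s'"
    have "agree prog_rows s ?s0" by (simp add: agree_def prog_rows_def)
    moreover have "agree prog_rows ?s0 s'" by (rule agree_mono[OF ag]) (auto simp: prog_rows_def)
    ultimately have "agree prog_rows s s'" by (rule agree_trans)
    then show "Q s'" by (rule Q) (use I in auto)
  qed (use n in auto)
  show "runs (RAssign ''R'' (RConst 0)) 2 s (\<lambda>s'.
    runs (For ''i'' ''n'' ?body) (n * (n * 18 + 32 + 8) + 8) s' Q)"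
    by (rule runs_loop_free) (use loop in auto)
qed auto

lemma runs_M:
  assumes "ivar s ''n'' = n"
    and "\<And>s'. agree prog_M s s' \<Longrightarrow>
      (\<And>i j. i < n \<Longrightarrow> j < n \<Longrightarrow> rarr s' ''M'' i j = rarr s ''A'' i j + (if i = j then rarr s ''D'' i 0 else 0)) \<Longrightarrow> Q s'"
  shows "runs prog_M (n * (n * 30 + 16) + 8) s Q"
  unfolding prog_M_def
  by (rule runs_Fill2[OF assms(1), where f = "\<lambda>i j. rarr s ''A'' i j + (if i = j then rarr s ''D'' i 0 else 0)"])
    (use assms(2) in \<open>auto simp: agreeA prog_M_def\<close>)

section \<open>Gauss-Jordan elimination as a program\<close>

abbreviation gj_col :: com where
  "gj_col \<equiv> For ''i'' ''n'' (RStore ''p'' (IVar ''i'') (IConst 0) (RSub (ent ''W'' ''i'' ''k'') (dlt ''i'' ''k'')))"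

abbreviation gj_row :: "name \<Rightarrow> name \<Rightarrow> com" where
  "gj_row q X \<equiv> For ''j'' ''n'' (RStore q (IVar ''j'') (IConst 0) (RDiv (ent X ''k'' ''j'') (ent ''W'' ''k'' ''k'')))"

abbreviation gj_entry :: "name \<Rightarrow> name \<Rightarrow> rexp" where
  "gj_entry q X \<equiv> RSub (ent X ''i'' ''j'') (RMul (REntry ''p'' (IVar ''i'') (IConst 0)) (REntry q (IVar ''j'') (IConst 0)))"

abbreviation gj_update :: "name \<Rightarrow> name \<Rightarrow> com" where
  "gj_update q X \<equiv> Map2 (put X ''i'' ''j'' (gj_entry q X))"

definition prog_gj :: com where
  "prog_gj = For ''k'' ''n''
    (Seq gj_col
    (Seq (gj_row ''q'' ''W'')
    (Seq (gj_row ''r'' ''H'')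
    (Seq (gj_update ''q'' ''W'')
         (gj_update ''r'' ''H'')))))"

text \<open>Subtracting the delta from the multiplier column makes the pivot row obey the same
  formula as the others: x - (w - 1) (x/w) = x/w. The column and both scaled pivot rows are copied
  beforehand, since the updates overwrite their sources.\<close>

lemma elim_row_uniform:
  "W k k \<noteq> 0 \<Longrightarrow> X i j - (W i k - (if i = k then 1 else 0)) * (X k j / W k k) = elim_row k W X i j"
  by (auto simp: elim_row_def field_simps)

lemma runs_gj:
  assumes n: "ivar s ''n'' = n" and P: "pd n P"
    and W: "\<And>i j. i < n \<Longrightarrow> j < n \<Longrightarrow> rarr s ''W'' i j = P i j"
    and H: "\<And>i j. i < n \<Longrightarrow> j < n \<Longrightarrow> rarr s ''H'' i j = (if i = j then 1 else 0)"
    and Q: "\<And>s'. agree prog_gj s s' \<Longrightarrow> inverse_on n P (rarr s' ''H'') \<Longrightarrow> Q s'"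
  shows "runs prog_gj (n * (n * (n * 50 + 120) + 80) + 8) s Q"
  unfolding prog_gj_def
proof (rule runs_For[where I = "\<lambda>k s'. gj_inv n P k (rarr s' ''W'') (rarr s' ''H'')"
      and b = "n * (n * 50 + 120) + 72" and N = n])
  show "gj_inv n P 0 (rarr s ''W'') (rarr s ''H'')"
    by (rule gj_inv_cong[OF gj_inv_0]) (use W H in auto)
  fix k :: nat and s0 :: state
  let ?W = "rarr s0 ''W''" and ?H = "rarr s0 ''H''"
  assume k: "k < n" and ag: "agree (For ''k'' ''n'' (Seq gj_col (Seq (gj_row ''q'' ''W'') (Seq (gj_row ''r'' ''H'') (Seq (gj_update ''q'' ''W'') (gj_update ''r'' ''H'')))))) s s0"
    and kv: "ivar s0 ''k'' = k" and I: "gj_inv n P k ?W ?H"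
  have n0: "ivar s0 ''n'' = n" using agreeI[OF ag, of "''n''"] n by simp
  have piv: "?W k k \<noteq> 0" using gj_pivot_pos[OF P I k] by simp
  show "runs (Seq gj_col (Seq (gj_row ''q'' ''W'') (Seq (gj_row ''r'' ''H'') (Seq (gj_update ''q'' ''W'') (gj_update ''r'' ''H''))))) (n * (n * 50 + 120) + 72) s0
      (\<lambda>s'. gj_inv n P (Suc k) (rarr s' ''W'') (rarr s' ''H''))"
  proof (rule runs_Seq[where p = "n * 25 + 8" and q = "n * (n * 50 + 95) + 64"],
      rule runs_Fill1[where n = n and f = "\<lambda>i. ?W i k - (if i = k then 1 else 0)"])
    fix s1 assume a1: "agree gj_col s0 s1" and p: "\<And>i. i < n \<Longrightarrow> rarr s1 ''p'' i 0 = ?W i k - (if i = k then 1 else 0)"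
    note s1 = agreeI[OF a1] agreeA[OF a1]
    show "runs (Seq (gj_row ''q'' ''W'') (Seq (gj_row ''r'' ''H'') (Seq (gj_update ''q'' ''W'') (gj_update ''r'' ''H'')))) (n * (n * 50 + 95) + 64) s1
      (\<lambda>s'. gj_inv n P (Suc k) (rarr s' ''W'') (rarr s' ''H''))"
    proof (rule runs_Seq[where p = "n * 25 + 8" and q = "n * (n * 50 + 70) + 56"],
        rule runs_Fill1[where n = n and f = "\<lambda>j. ?W k j / ?W k k"])
      fix s2 assume a2: "agree (gj_row ''q'' ''W'') s1 s2" and q: "\<And>j. j < n \<Longrightarrow> rarr s2 ''q'' j 0 = ?W k j / ?W k k"
      note s2 = agreeI[OF a2] agreeA[OF a2]
      show "runs (Seq (gj_row ''r'' ''H'') (Seq (gj_update ''q'' ''W'') (gj_update ''r'' ''H''))) (n * (n * 50 + 70) + 56) s2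
        (\<lambda>s'. gj_inv n P (Suc k) (rarr s' ''W'') (rarr s' ''H''))"
      proof (rule runs_Seq[where p = "n * 25 + 8" and q = "n * (n * 50 + 45) + 48"],
          rule runs_Fill1[where n = n and f = "\<lambda>j. ?H k j / ?W k k"])
        fix s3 assume a3: "agree (gj_row ''r'' ''H'') s2 s3" and r: "\<And>j. j < n \<Longrightarrow> rarr s3 ''r'' j 0 = ?H k j / ?W k k"
        note s3 = agreeI[OF a3] agreeA[OF a3]
        show "runs (Seq (gj_update ''q'' ''W'') (gj_update ''r'' ''H'')) (n * (n * 50 + 45) + 48) s3
          (\<lambda>s'. gj_inv n P (Suc k) (rarr s' ''W'') (rarr s' ''H''))"
        proof (rule runs_Seq[where p = "n * (n * 25 + 16) + 8" and q = "n * (n * 25 + 16) + 8"],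
            rule runs_Fill2[where n = n and f = "elim_row k ?W ?W"])
          fix s4 assume a4: "agree (gj_update ''q'' ''W'') s3 s4" and W4: "\<And>i j. i < n \<Longrightarrow> j < n \<Longrightarrow> rarr s4 ''W'' i j = elim_row k ?W ?W i j"
          note s4 = agreeI[OF a4] agreeA[OF a4]
          show "runs (gj_update ''r'' ''H'') (n * (n * 25 + 16) + 8) s4
            (\<lambda>s'. gj_inv n P (Suc k) (rarr s' ''W'') (rarr s' ''H''))"
          proof (rule runs_Fill2[where n = n and f = "elim_row k ?W ?H"])
            fix s5 assume a5: "agree (gj_update ''r'' ''H'') s4 s5" and H5: "\<And>i j. i < n \<Longrightarrow> j < n \<Longrightarrow> rarr s5 ''H'' i j = elim_row k ?W ?H i j"
            show "gj_inv n P (Suc k) (rarr s5 ''W'') (rarr s5 ''H'')"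
              by (rule gj_inv_cong[OF gj_inv_step[OF P I k]]) (use W4 H5 agreeA[OF a5] in auto)
          next
            fix s5 i j assume ij: "i < n" "j < n" and a5: "agree (gj_update ''r'' ''H'') s4 s5" and v: "ivar s5 ''i'' = i" "ivar s5 ''j'' = j"
              and old: "rarr s5 ''H'' i j = rarr s4 ''H'' i j"
            have "rarr s4 ''H'' i j = ?H i j" by (simp add: s4 s3 s2 s1)
            moreover have "rarr s5 ''p'' i 0 = ?W i k - (if i = k then 1 else 0)"
              using p[OF ij(1)] by (simp add: agreeA[OF a5] s4 s3 s2 s1)
            moreover have "rarr s5 ''r'' j 0 = ?H k j / ?W k k"
              using r[OF ij(2)] by (simp add: agreeA[OF a5] s4 s3 s2 s1)
            ultimately show "rval (gj_entry ''r'' ''H'') s5 = elim_row k ?W ?H i j"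
              using elim_row_uniform[of ?W k ?H i j] piv old by (simp add: v)
          qed (use n0 in \<open>auto simp: s4 s3 s2 s1\<close>)
        next
          fix s5 i j assume ij: "i < n" "j < n" and a5: "agree (gj_update ''q'' ''W'') s3 s5" and v: "ivar s5 ''i'' = i" "ivar s5 ''j'' = j"
            and old: "rarr s5 ''W'' i j = rarr s3 ''W'' i j"
          have "rarr s3 ''W'' i j = ?W i j" by (simp add: s3 s2 s1)
          moreover have "rarr s5 ''p'' i 0 = ?W i k - (if i = k then 1 else 0)"
            using p[OF ij(1)] by (simp add: agreeA[OF a5] s3 s2 s1)
          moreover have "rarr s5 ''q'' j 0 = ?W k j / ?W k k"
            using q[OF ij(2)] by (simp add: agreeA[OF a5] s3 s2 s1)
          ultimately show "rval (gj_entry ''q'' ''W'') s5 = elim_row k ?W ?W i j"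
            using elim_row_uniform[of ?W k ?W i j] piv old by (simp add: v)
        qed (use n0 in \<open>auto simp: s3 s2 s1 algebra_simps\<close>)
      next
        fix s' j assume a: "agree (gj_row ''r'' ''H'') s2 s'" "ivar s' ''j'' = j"
        show "rval (RDiv (ent ''H'' ''k'' ''j'') (ent ''W'' ''k'' ''k'')) s' = ?H k j / ?W k k"
          using agreeI[OF a(1)] agreeA[OF a(1)] a(2) kv by (simp add: s1 s2)
      qed (use n0 in \<open>auto simp: s2 s1 algebra_simps\<close>)
    next
      fix s' j assume a: "agree (gj_row ''q'' ''W'') s1 s'" "ivar s' ''j'' = j"
      show "rval (RDiv (ent ''W'' ''k'' ''j'') (ent ''W'' ''k'' ''k'')) s' = ?W k j / ?W k k"
        using agreeI[OF a(1)] agreeA[OF a(1)] a(2) kv by (simp add: s1)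
    qed (use n0 in \<open>auto simp: s1 algebra_simps\<close>)
  next
    fix s' i assume a: "agree gj_col s0 s'" "ivar s' ''i'' = i"
    show "rval (RSub (ent ''W'' ''i'' ''k'') (dlt ''i'' ''k'')) s' = ?W i k - (if i = k then 1 else 0)"
      using agreeI[OF a(1)] agreeA[OF a(1)] a(2) kv by simp
  qed (use n0 in \<open>auto simp: algebra_simps\<close>)
next
  fix s' assume "agree (For ''k'' ''n''
    (Seq gj_col
    (Seq (gj_row ''q'' ''W'')
    (Seq (gj_row ''r'' ''H'')
    (Seq (gj_update ''q'' ''W'')
         (gj_update ''r'' ''H''))))) ) s s'"
    "gj_inv n P n (rarr s' ''W'') (rarr s' ''H'')"
  then show "Q s'" by (intro Q gj_inv_n) (auto simp: prog_gj_def)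
qed (use n in auto)

section \<open>Computing the power sum\<close>

abbreviation pow_row :: com where
  "pow_row \<equiv> Seq (RAssign ''d'' (RConst 0)) (Seq (Sum ''l'' ''d'' (RMul (ent ''A'' ''i'' ''l'') (ent ''Y'' ''k'' ''l'')))
        (RStore ''Y'' (IAdd (IVar ''k'') (IConst 1)) (IVar ''i'') (RVar ''d'')))"

abbreviation pow_init :: com where
  "pow_init \<equiv> For ''i'' ''n'' (RStore ''Y'' (IConst 0) (IVar ''i'') (dlt ''i'' ''j''))"

text \<open>Row k of \<open>''Y''\<close> holds A^k e_j for the current j; the rows are overwritten
  for the next j.\<close>

definition prog_pow_vec :: com where
  "prog_pow_vec = Seq pow_init
    (For ''k'' ''n'' (For ''i'' ''n'' pow_row))"

abbreviation pow_acc :: com where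
  "pow_acc \<equiv> Sum ''i'' ''F'' (RMul (ent ''Y'' ''n'' ''i'') (ent ''Y'' ''n'' ''i''))"

definition prog_pow :: com where
  "prog_pow = Seq (RAssign ''F'' (RConst 0)) (For ''j'' ''n'' (Seq prog_pow_vec
     pow_acc))"

lemma runs_pow_vec:
  assumes n: "ivar s ''n'' = n"
    and Q: "\<And>s'. agree prog_pow_vec s s' \<Longrightarrow>
      (\<And>i. i < n \<Longrightarrow> rarr s' ''Y'' n i = (mv n (rarr s ''A'') ^^ n) (unit (ivar s ''j'')) i) \<Longrightarrow> Q s'"
  shows "runs prog_pow_vec (n * (n * (n * 18 + 40) + 40) + 16) s Q"
  unfolding prog_pow_vec_def
proof (rule runs_Seq[where p = "n * 24 + 8" and q = "n * (n * (n * 18 + 40) + 16) + 8"])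
  let ?y = "\<lambda>k. (mv n (rarr s ''A'') ^^ k) (unit (ivar s ''j''))"
  let ?c2 = "For ''k'' ''n'' (For ''i'' ''n'' pow_row)"
  show "runs pow_init (n * 24 + 8) s (\<lambda>s'. runs ?c2 (n * (n * (n * 18 + 40) + 16) + 8) s' Q)"
  proof (rule runs_For[where N = n and b = 15 and I = "\<lambda>m s'. \<forall>i<m. rarr s' ''Y'' 0 i = ?y 0 i"])
    fix m s' assume m: "m < n" and ag: "agree pow_init s s'" and iv: "ivar s' ''i'' = m" and I: "\<forall>i<m. rarr s' ''Y'' 0 i = ?y 0 i"
    show "runs (RStore ''Y'' (IConst 0) (IVar ''i'') (dlt ''i'' ''j'')) 15 s' (\<lambda>s'. \<forall>i<Suc m. rarr s' ''Y'' 0 i = ?y 0 i)"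
      by (rule runs_loop_free) (use I iv agreeI[OF ag] in \<open>auto simp: unit_def less_Suc_eq\<close>)
  next
    fix s1 assume a1: "agree pow_init s s1" and I1: "\<forall>i<n. rarr s1 ''Y'' 0 i = ?y 0 i"
    have n1: "ivar s1 ''n'' = n" using agreeI[OF a1] n by simp
    show "runs ?c2 (n * (n * (n * 18 + 40) + 16) + 8) s1 Q"
    proof (rule runs_For[where N = n and b = "n * (n * 18 + 40) + 8" and I = "\<lambda>k s'. \<forall>i<n. rarr s' ''Y'' k i = ?y k i"])
      fix k s2 assume k: "k < n" and a2: "agree ?c2 s1 s2" and kv: "ivar s2 ''k'' = k"
        and I2: "\<forall>i<n. rarr s2 ''Y'' k i = ?y k i"
      have n2: "ivar s2 ''n'' = n" using agreeI[OF a2] n1 by simp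
      show "runs (For ''i'' ''n'' pow_row) (n * (n * 18 + 40) + 8) s2 (\<lambda>s'. \<forall>i<n. rarr s' ''Y'' (Suc k) i = ?y (Suc k) i)"
      proof (rule runs_For[where N = n and b = "n * 18 + 32" and
            I = "\<lambda>m s'. (\<forall>i<n. rarr s' ''Y'' k i = ?y k i) \<and> (\<forall>i<m. rarr s' ''Y'' (Suc k) i = ?y (Suc k) i)"])
        fix m s3 assume m: "m < n" and a3: "agree (For ''i'' ''n'' pow_row) s2 s3" and iv: "ivar s3 ''i'' = m"
          and I3: "(\<forall>i<n. rarr s3 ''Y'' k i = ?y k i) \<and> (\<forall>i<m. rarr s3 ''Y'' (Suc k) i = ?y (Suc k) i)"
        have n3: "ivar s3 ''n'' = n" and k3: "ivar s3 ''k'' = k" and A3: "rarr s3 ''A'' = rarr s ''A''"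
          using agreeI[OF a3] agreeA[OF a3] agreeA[OF a2] agreeA[OF a1] n2 kv by auto
        let ?s4 = "sem (RAssign ''d'' (RConst 0)) s3"
        let ?sum = "Sum ''l'' ''d'' (RMul (ent ''A'' ''i'' ''l'') (ent ''Y'' ''k'' ''l''))"
        show "runs pow_row (n * 18 + 32) s3
          (\<lambda>s'. (\<forall>i<n. rarr s' ''Y'' k i = ?y k i) \<and> (\<forall>i<Suc m. rarr s' ''Y'' (Suc k) i = ?y (Suc k) i))"
        proof (rule runs_Seq[where p = 2 and q = "n * 18 + 30"], rule runs_loop_free,
            rule_tac [3] runs_Seq[where p = "n * 18 + 8" and q = 20],
            rule_tac [3] runs_Sum[where n = n and f = "\<lambda>l. rarr s ''A'' m l * ?y k l"])
          fix s4 l assume l: "l < n" and a4: "agree ?sum ?s4 s4" and lv: "ivar s4 ''l'' = l"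
          show "rval (RMul (ent ''A'' ''i'' ''l'') (ent ''Y'' ''k'' ''l'')) s4 = rarr s ''A'' m l * ?y k l"
            using agreeI[OF a4] agreeA[OF a4] lv iv k3 A3 I3 l by simp
        next
          fix s4 assume a4: "agree ?sum ?s4 s4" and d: "rvar s4 ''d'' = rvar ?s4 ''d'' + (\<Sum>l<n. rarr s ''A'' m l * ?y k l)"
          have d': "rvar s4 ''d'' = ?y (Suc k) m" using d by (simp add: mv_def)
          show "runs (RStore ''Y'' (IAdd (IVar ''k'') (IConst 1)) (IVar ''i'') (RVar ''d'')) 20 s4
           (\<lambda>s'. (\<forall>i<n. rarr s' ''Y'' k i = ?y k i) \<and> (\<forall>i<Suc m. rarr s' ''Y'' (Suc k) i = ?y (Suc k) i))"
            by (rule runs_loop_free) (use d' agreeI[OF a4] agreeA[OF a4] iv k3 I3 in \<open>auto simp: less_Suc_eq simp del: funpow.simps\<close>)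
        qed (use n3 in auto)
      qed (use n2 I2 in auto)
    next
      fix s2 assume a2: "agree ?c2 s1 s2" and I2: "\<forall>i<n. rarr s2 ''Y'' n i = ?y n i"
      have "agree prog_pow_vec s s2"
        by (rule agree_trans[OF agree_mono[OF a1] agree_mono[OF a2]]) (auto simp: prog_pow_vec_def)
      then show "Q s2" by (rule Q) (use I2 in auto)
    qed (use n1 I1 in \<open>auto simp: algebra_simps\<close>)
  qed (use n in auto)
qed (auto simp: algebra_simps)

lemma iw_pow_vec [simp]: "iw prog_pow_vec = {''i'', ''k'', ''l''}"
  and rw_pow_vec [simp]: "rw prog_pow_vec = {''d''}" and aw_pow_vec [simp]: "aw prog_pow_vec = {''Y''}"
  by (auto simp: prog_pow_vec_def)

lemma runs_pow:
  assumes n: "ivar s ''n'' = n"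
    and Q: "\<And>s'. agree prog_pow s s' \<Longrightarrow> rvar s' ''F'' = power_sum n (rarr s ''A'') n \<Longrightarrow> Q s'"
  shows "runs prog_pow (n * (n * (n * (n * 18 + 40) + 60) + 40) + 10) s Q"
  unfolding prog_pow_def
proof (rule runs_Seq[where p = 2 and q = "n * (n * (n * (n * 18 + 40) + 60) + 40) + 8"], rule runs_loop_free)
  let ?y = "\<lambda>j. (mv n (rarr s ''A'') ^^ n) (unit j)"
  let ?s0 = "sem (RAssign ''F'' (RConst 0)) s"
  show "runs (For ''j'' ''n'' (Seq prog_pow_vec pow_acc)) (n * (n * (n * (n * 18 + 40) + 60) + 40) + 8) ?s0 Q"
  proof (rule runs_For[where N = n and b = "n * (n * (n * 18 + 40) + 60) + 32" and
        I = "\<lambda>m s'. rvar s' ''F'' = (\<Sum>j<m. ip n (?y j) (?y j))"])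
    fix m s1 assume m: "m < n" and a1: "agree (For ''j'' ''n'' (Seq prog_pow_vec pow_acc)) ?s0 s1" and jv: "ivar s1 ''j'' = m"
      and I: "rvar s1 ''F'' = (\<Sum>j<m. ip n (?y j) (?y j))"
    have n1: "ivar s1 ''n'' = n" and A1: "rarr s1 ''A'' = rarr s ''A''" using agreeI[OF a1] agreeA[OF a1] n by auto
    show "runs (Seq prog_pow_vec pow_acc) (n * (n * (n * 18 + 40) + 60) + 32) s1 (\<lambda>s'. rvar s' ''F'' = (\<Sum>j<Suc m. ip n (?y j) (?y j)))"
    proof (rule runs_Seq[where p = "n * (n * (n * 18 + 40) + 40) + 16" and q = "n * 18 + 8"], rule runs_pow_vec[OF n1])
      fix s2 assume a2: "agree prog_pow_vec s1 s2"
        and Y: "\<And>i. i < n \<Longrightarrow> rarr s2 ''Y'' n i = (mv n (rarr s1 ''A'') ^^ n) (unit (ivar s1 ''j'')) i"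
      have n2: "ivar s2 ''n'' = n" using agreeI[OF a2] n1 by simp
      show "runs pow_acc (n * 18 + 8) s2 (\<lambda>s'. rvar s' ''F'' = (\<Sum>j<Suc m. ip n (?y j) (?y j)))"
      proof (rule runs_Sum[OF n2, where f = "\<lambda>i. ?y m i * ?y m i"])
        fix s3 i assume i: "i < n" and a3: "agree pow_acc s2 s3" and iv: "ivar s3 ''i'' = i"
        show "rval (RMul (ent ''Y'' ''n'' ''i'') (ent ''Y'' ''n'' ''i'')) s3 = ?y m i * ?y m i"
          using agreeI[OF a3] agreeA[OF a3] iv n2 Y[OF i] A1 jv by simp
      next
        fix s3 assume "agree pow_acc s2 s3" and F: "rvar s3 ''F'' = rvar s2 ''F'' + (\<Sum>i<n. ?y m i * ?y m i)"
        then show "rvar s3 ''F'' = (\<Sum>j<Suc m. ip n (?y j) (?y j))"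
          using agreeR[OF a2, of "''F''"] I by (simp add: ip_def)
      qed auto
    qed (simp add: algebra_simps)
  next
    fix s' assume a: "agree (For ''j'' ''n'' (Seq prog_pow_vec pow_acc)) ?s0 s'" and I: "rvar s' ''F'' = (\<Sum>j<n. ip n (?y j) (?y j))"
    have "agree prog_pow s ?s0" by (simp add: agree_def prog_pow_def)
    moreover have "agree prog_pow ?s0 s'" by (rule agree_mono[OF a]) (auto simp: prog_pow_def)
    ultimately have "agree prog_pow s s'" by (rule agree_trans)
    then show "Q s'" by (rule Q) (simp add: I power_sum_def)
  qed (use n in \<open>auto simp: algebra_simps\<close>)
qed auto

text \<open>Throughout the halving loop \<open>p = n lam\<^sup>2\<^sup>n\<close>, and \<open>h = 4\<^sup>-\<^sup>n\<close> updates it in constant time.\<close>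

definition prog_halve :: com where
  "prog_halve = Seq (RAssign ''lam'' (RDiv (RVar ''lam'') (RConst 2))) (RAssign ''p'' (RMul (RVar ''p'') (RVar ''h'')))"

abbreviation lam_quarter :: com where
  "lam_quarter \<equiv> For ''i'' ''n'' (RAssign ''h'' (RDiv (RVar ''h'') (RConst 4)))"

abbreviation lam_power :: com where
  "lam_power \<equiv> For ''i'' ''n'' (RAssign ''p'' (RMul (RVar ''p'') (RMul (RVar ''lam'') (RVar ''lam''))))"

definition prog_lam :: com where
  "prog_lam = Seq (Seq (RAssign ''lam'' (RVar ''R'')) (RAssign ''p'' (ROfIndex (IVar ''n''))))
    (Seq lam_power
    (Seq (RAssign ''h'' (RConst 1))
    (Seq lam_quarter
      (While (RLess (RVar ''F'') (RVar ''p'')) prog_halve))))"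

text \<open>The spurious factor n is less than 4^n, so it is absorbed by doubling \<open>lam\<close>
  under the power 2n: a^(2n) < (2 lam)^(2n).\<close>

lemma halve_step:
  fixes a F lam :: real
  assumes "0 < n" "0 < a" "0 < lam" "a ^ (2 * n) \<le> F" "F < n * lam ^ (2 * n)" shows "a < 2 * lam"
proof -
  have "real n < 2 ^ n" by (rule of_nat_less_two_power)
  also have "\<dots> \<le> 2 ^ (2 * n)" by (rule power_increasing) auto
  finally have "n * lam ^ (2 * n) \<le> 2 ^ (2 * n) * lam ^ (2 * n)"
    using assms(3) by (intro mult_right_mono) auto
  then have "a ^ (2 * n) < (2 * lam) ^ (2 * n)" using assms(4,5) by (simp add: power_mult_distrib)
  then show ?thesis by (rule power_less_imp_less_base) (use assms(3) in simp)
qed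

text \<open>In round k, lam = R/2^k; while the test succeeds, a < 2 lam, so k < 2^k < 2 R/a. The
  same inequality shows that a < 4 lam survives the halving about to take place.\<close>

lemma runs_lam:
  assumes n: "ivar s ''n'' = n" "0 < n" and R: "rvar s ''R'' = R" "a \<le> R" and a: "0 < a" "a ^ (2 * n) \<le> rvar s ''F''"
    and N: "2 * R / a \<le> real N"
    and Q: "\<And>s'. agree prog_lam s s' \<Longrightarrow> 0 < rvar s' ''lam'' \<Longrightarrow> rvar s' ''lam'' \<le> R \<Longrightarrow>
      n * rvar s' ''lam'' ^ (2 * n) \<le> rvar s ''F'' \<Longrightarrow> a < 4 * rvar s' ''lam'' \<Longrightarrow> Q s'"
  shows "runs prog_lam (N * 20 + n * 40 + 40) s Q"
  unfolding prog_lam_def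
proof (rule runs_Seq[where p = 5 and q = "N * 20 + n * 40 + 35"], rule runs_loop_free)
  let ?s1 = "sem (Seq (RAssign ''lam'' (RVar ''R'')) (RAssign ''p'' (ROfIndex (IVar ''n'')))) s"
  let ?w = "While (RLess (RVar ''F'') (RVar ''p'')) prog_halve"
  let ?h = "RAssign ''h'' (RConst 1)"
  have R0: "0 < R" using R a by simp
  show "runs (Seq lam_power (Seq ?h (Seq lam_quarter ?w))) (N * 20 + n * 40 + 35) ?s1 Q"
  proof (rule runs_Seq[where p = "n * 14 + 8" and q = "N * 20 + n * 26 + 27"],
      rule runs_For[where N = n and b = 6 and I = "\<lambda>k s'. rvar s' ''p'' = n * R ^ (2 * k)"])
    fix k s2 assume a2: "agree lam_power ?s1 s2" and p: "rvar s2 ''p'' = n * R ^ (2 * k)"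
    show "runs (RAssign ''p'' (RMul (RVar ''p'') (RMul (RVar ''lam'') (RVar ''lam'')))) 6 s2 (\<lambda>s'. rvar s' ''p'' = n * R ^ (2 * Suc k))"
      by (rule runs_loop_free) (use agreeR[OF a2] p R in \<open>auto simp: power2_eq_square power_add\<close>)
  next
    fix s2 assume a2: "agree lam_power ?s1 s2" and p2: "rvar s2 ''p'' = n * R ^ (2 * n)"
    let ?s3 = "sem ?h s2"
    show "runs (Seq ?h (Seq lam_quarter ?w)) (N * 20 + n * 26 + 27) s2 Q"
    proof (rule runs_Seq[where p = 2 and q = "N * 20 + n * 26 + 25"], rule runs_loop_free)
      show "runs (Seq lam_quarter ?w) (N * 20 + n * 26 + 25) ?s3 Q"
      proof (rule runs_Seq[where p = "n * 12 + 8" and q = "N * 20 + 17"],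
          rule runs_For[where N = n and b = 4 and I = "\<lambda>k s'. rvar s' ''h'' = (1 / 4) ^ k"])
        fix k and s4 :: state assume "rvar s4 ''h'' = (1 / 4) ^ k"
        then show "runs (RAssign ''h'' (RDiv (RVar ''h'') (RConst 4))) 4 s4 (\<lambda>s'. rvar s' ''h'' = (1 / 4) ^ Suc k)"
          by (intro runs_loop_free) auto
      next
        fix s4 assume a4: "agree lam_quarter ?s3 s4" and h: "rvar s4 ''h'' = (1 / 4) ^ n"
        have s4: "rvar s4 ''p'' = n * R ^ (2 * n)" "rvar s4 ''lam'' = R" "rvar s4 ''F'' = rvar s ''F''"
          using agreeR[OF a4] agreeR[OF a2] p2 R by auto
        let ?I = "\<lambda>k s'. rvar s' ''lam'' = R / 2 ^ k \<and> rvar s' ''p'' = n * rvar s' ''lam'' ^ (2 * n) \<and> a < 4 * rvar s' ''lam''"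
        show "runs ?w (N * 20 + 17) s4 Q"
        proof (rule runs_While[where I = ?I and b = 10 and N = N])
          show "?I 0 s4" using s4 R a by auto
        next
          fix k s5 assume a5: "agree prog_halve s4 s5" and I: "?I k s5" and t: "tval (RLess (RVar ''F'') (RVar ''p'')) s5"
          have F5: "rvar s5 ''F'' = rvar s ''F''" and h5: "rvar s5 ''h'' = (1 / 4) ^ n"
            using agreeR[OF a5] s4 h by (auto simp: prog_halve_def)
          have l0: "0 < rvar s5 ''lam''" using I R0 by simp
          have al: "a < 2 * rvar s5 ''lam''"
            by (rule halve_step[OF n(2) a(1) l0 a(2)]) (use I t F5 in auto)
          have "real k < 2 ^ k" by (rule of_nat_less_two_power)
          also have "\<dots> < 2 * R / a" using al I a(1) by (simp add: field_simps)
          also have "\<dots> \<le> real N" by (rule N)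
          finally have "k < N" by simp
          moreover have "(x / 2) ^ (2 * n) = x ^ (2 * n) * (1 / 4) ^ n" for x :: real
            by (simp add: power_divide power_mult)
          from this[of "R / 2 ^ k"] have "(R / (2 ^ k * 2)) ^ (2 * n) = (R / 2 ^ k) ^ (2 * n) * (1 / 4) ^ n"
            by (simp only: divide_divide_eq_left)
          then have "runs prog_halve 10 s5 (?I (Suc k))"
            unfolding prog_halve_def by (intro runs_loop_free) (use I al h5 in auto)
          ultimately show "k < N \<and> runs prog_halve 10 s5 (?I (Suc k))" by blast
        next
          fix k s5 assume a5: "agree prog_halve s4 s5" and I: "?I k s5" and t: "\<not> tval (RLess (RVar ''F'') (RVar ''p'')) s5"
          have F5: "rvar s5 ''F'' = rvar s ''F''"
            using agreeR[OF a5] s4 by (auto simp: prog_halve_def)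
          have "agree prog_lam s ?s1" by (simp add: agree_def prog_lam_def)
          moreover have "agree prog_lam ?s1 s2" by (rule agree_mono[OF a2]) (auto simp: prog_lam_def)
          moreover have "agree prog_lam s2 ?s3" by (simp add: agree_def prog_lam_def)
          moreover have "agree prog_lam ?s3 s4" by (rule agree_mono[OF a4]) (auto simp: prog_lam_def)
          moreover have "agree prog_lam s4 s5" by (rule agree_mono[OF a5]) (auto simp: prog_lam_def)
          ultimately have "agree prog_lam s s5" using agree_trans by blast
          moreover have "R / 2 ^ k \<le> R" using R0 by (simp add: divide_le_eq mult_left_le one_le_power)
          ultimately show "Q s5" by (intro Q) (use I t F5 R0 in auto)
        qed auto
      qed (use n agreeI[OF a2] in auto)
    qed auto
  qed (use n R in auto)
qed auto

section \<open>Choosing the number of steps\<close>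

abbreviation count_finish :: com where
  "count_finish \<equiv> Seq (RAssign ''tau'' (RDiv (RConst 1) (ROfIndex (IVar ''T''))))
      (Seq (RAssign ''eta'' (RDiv (RMul (RMul (RMul (RConst 6) (RMul (RVar ''R'') (RVar ''R''))) (ROfIndex (IVar ''n'')))
               (RMul (RVar ''tau'') (RVar ''tau''))) (RVar ''u'')))
        (RAssign ''c'' (RConst 0)))"

abbreviation count_incr :: com where
  "count_incr \<equiv> IAssign ''T'' (IAdd (IVar ''T'') (IConst 1))"

abbreviation count_test :: test where
  "count_test \<equiv> RLess (RMul (ROfIndex (IVar ''T'')) (RMul (RVar ''u'') (RVar ''u'')))
            (RMul (RMul (RConst 6) (RMul (RVar ''R'') (RVar ''R''))) (ROfIndex (IVar ''n'')))"

text \<open>A real number cannot be turned into an index, so the least T with T u^2 \<ge> 6 R^2 n is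
  found by counting, in time O(T). This inequality later says that all increments \<eta> together
  are at most u.\<close>

definition prog_count :: com where
  "prog_count = Seq (Seq (RAssign ''u'' (RDiv (RMul (RVar ''eps'') (RVar ''lam'')) (RConst 2))) (IAssign ''T'' (IConst 0)))
    (Seq (While count_test
          count_incr)
      count_finish)"

lemma runs_count:
  assumes n: "ivar s ''n'' = n" and u: "u = rvar s ''eps'' * rvar s ''lam'' / 2" "0 < u" and R: "rvar s ''R'' = R"
    and N: "6 * R\<^sup>2 * n / u\<^sup>2 \<le> real N"
    and Q: "\<And>s' T. agree prog_count s s' \<Longrightarrow> ivar s' ''T'' = T \<Longrightarrow> 6 * R\<^sup>2 * n \<le> T * u\<^sup>2 \<Longrightarrow> T \<le> N \<Longrightarrow>
      rvar s' ''u'' = u \<Longrightarrow> rvar s' ''tau'' = 1 / T \<Longrightarrow> rvar s' ''eta'' = 6 * R\<^sup>2 * n * (1 / T)\<^sup>2 / u \<Longrightarrow> rvar s' ''c'' = 0 \<Longrightarrow> Q s'"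
  shows "runs prog_count (N * 40 + 80) s Q"
  unfolding prog_count_def
proof (rule runs_Seq[where p = 10 and q = "N * 40 + 70"], rule runs_loop_free)
  let ?s1 = "sem (Seq (RAssign ''u'' (RDiv (RMul (RVar ''eps'') (RVar ''lam'')) (RConst 2))) (IAssign ''T'' (IConst 0))) s"
  show "runs (Seq (While count_test count_incr) count_finish) (N * 40 + 70) ?s1 Q"
  proof (rule runs_Seq[where p = "N * 40 + 30" and q = 40],
      rule runs_While[where I = "\<lambda>k s'. ivar s' ''T'' = k \<and> k \<le> N" and N = N and b = 10])
    fix k s2 assume a2: "agree count_incr ?s1 s2" and I: "ivar s2 ''T'' = k \<and> k \<le> N" and t: "tval count_test s2"
    have "ivar s2 ''n'' = n" "rvar s2 ''u'' = u" "rvar s2 ''R'' = R"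
      using agreeI[OF a2] agreeR[OF a2] n R u(1) by auto
    then have "real k * u\<^sup>2 < 6 * R\<^sup>2 * n"
      using t I by (simp add: power2_eq_square)
    then have "real k < 6 * R\<^sup>2 * n / u\<^sup>2" using u(2) by (simp add: pos_less_divide_eq)
    then have kN: "k < N" using N by linarith
    then show "k < N \<and> runs count_incr 10 s2 (\<lambda>s'. ivar s' ''T'' = Suc k \<and> Suc k \<le> N)"
      using I by (intro conjI runs_loop_free) auto
  next
    fix k s2 assume a2: "agree count_incr ?s1 s2" and I: "ivar s2 ''T'' = k \<and> k \<le> N" and t: "\<not> tval count_test s2"
    have s2: "ivar s2 ''n'' = n" "rvar s2 ''u'' = u" "rvar s2 ''R'' = R" using agreeI[OF a2] agreeR[OF a2] n R u(1) by auto
    have le: "6 * R\<^sup>2 * n \<le> k * u\<^sup>2"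
      using t s2 I by (simp add: power2_eq_square not_less)
    have "agree prog_count s ?s1" by (simp add: agree_def prog_count_def)
    moreover have "agree prog_count ?s1 s2" by (rule agree_mono[OF a2]) (auto simp: prog_count_def)
    moreover have "agree prog_count s2 (sem count_finish s2)" by (simp add: agree_def prog_count_def)
    ultimately have ag: "agree prog_count s (sem count_finish s2)" using agree_trans by blast
    show "runs count_finish 40 s2 Q"
    proof (rule runs_loop_free)
      show "Q (sem count_finish s2)"
        by (rule Q[OF ag, of k]) (use I s2 le in \<open>auto simp: power2_eq_square\<close>)
    qed auto
  qed auto
qed auto

section \<open>Evaluating one barrier\<close>

definition quad_entry :: rexp where
  "quad_entry = RAdd (RAdd (ent ''H'' ''i'' ''i'') (ent ''H'' ''j'' ''j''))
     (RMul (RMul (RConst 2) (ent ''S'' ''i'' ''j'')) (ent ''H'' ''i'' ''j''))"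

definition row_entry :: rexp where
  "row_entry = RAdd (ent ''H'' ''i'' ''l'') (RMul (ent ''S'' ''i'' ''j'') (ent ''H'' ''j'' ''l''))"

definition prog_sq :: "name \<Rightarrow> com" where
  "prog_sq X2 = Map2 (Seq (RAssign ''d'' (RConst 0)) (Seq (Sum ''l'' ''d'' (RMul row_entry row_entry))
     (put X2 ''i'' ''j'' (RVar ''d''))))"

text \<open>Summed over i and j this is \<eta> fro H + sg \<tau> m2 H, the slack of one side: the
  sign times \<open>A\<close>, halved, is the weight of the pair and \<open>X2\<close> holds the
  squared norm of v^T H.\<close>

definition shift_entry :: "rat \<Rightarrow> name \<Rightarrow> rexp" where
  "shift_entry sg X2 = RAdd (RMul (RVar ''eta'') (RMul (ent ''H'' ''i'' ''j'') (ent ''H'' ''i'' ''j'')))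
     (RMul (RConst sg) (RMul (RVar ''tau'') (RMul (RDiv (RMul (ent ''S'' ''i'' ''j'') (ent ''A'' ''i'' ''j'')) (RConst 2)) (ent X2 ''i'' ''j''))))"

definition prog_shift :: "rat \<Rightarrow> name \<Rightarrow> name \<Rightarrow> com" where
  "prog_shift sg X2 y = Seq (RAssign y (RConst 0)) (For ''i'' ''n'' (Sum ''j'' y (shift_entry sg X2)))"

abbreviation barrier_entry :: "rat \<Rightarrow> rexp" where
  "barrier_entry sg \<equiv> RAdd (RMul (dlt ''i'' ''j'') (RVar ''u''))
     (RMul (RConst sg) (RSub (RMul (RVar ''c'') (ent ''M'' ''i'' ''j'')) (ent ''G'' ''i'' ''j'')))"

text \<open>One program for both barriers: \<open>sg\<close> = 1 gives the upper matrix, -1 the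
  lower one. The second call overwrites \<open>''H''\<close>, so all that the selection needs is
  saved in \<open>X1\<close>, \<open>X2\<close> and \<open>y\<close>.\<close>

definition prog_side :: "rat \<Rightarrow> name \<Rightarrow> name \<Rightarrow> name \<Rightarrow> com" where
  "prog_side sg X1 X2 y =
    Seq (Map2 (put ''W'' ''i'' ''j'' (barrier_entry sg)))
    (Seq (Map2 (put ''H'' ''i'' ''j'' (dlt ''i'' ''j'')))
    (Seq prog_gj
    (Seq (Map2 (put X1 ''i'' ''j'' quad_entry))
    (Seq (prog_sq X2) (prog_shift sg X2 y)))))"

lemma writes_gj [simp]: "iw prog_gj = {''i'', ''j'', ''k''}" "rw prog_gj = {}" "aw prog_gj = {''p'', ''q'', ''r'', ''W'', ''H''}"
  by (auto simp: prog_gj_def)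

lemma writes_sq [simp]: "iw (prog_sq X2) = {''i'', ''j'', ''l''}" "rw (prog_sq X2) = {''d''}" "aw (prog_sq X2) = {X2}"
  by (auto simp: prog_sq_def)

lemma writes_shift [simp]: "iw (prog_shift sg X2 y) = {''i'', ''j''}" "rw (prog_shift sg X2 y) = {y}" "aw (prog_shift sg X2 y) = {}"
  by (auto simp: prog_shift_def)

lemma writes_side [simp]: "iw (prog_side sg X1 X2 y) = {''i'', ''j'', ''k'', ''l''}" "rw (prog_side sg X1 X2 y) = {''d'', y}"
  "aw (prog_side sg X1 X2 y) = {''p'', ''q'', ''r'', ''W'', ''H'', X1, X2}"
  by (auto simp: prog_side_def)

lemma runs_sq:
  assumes n: "ivar s ''n'' = n" and X2: "X2 \<notin> {''H'', ''S''}"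
    and Q: "\<And>s'. agree (prog_sq X2) s s' \<Longrightarrow> (\<And>i j. i < n \<Longrightarrow> j < n \<Longrightarrow>
      rarr s' X2 i j = (\<Sum>l<n. (rarr s ''H'' i l + rarr s ''S'' i j * rarr s ''H'' j l)\<^sup>2)) \<Longrightarrow> Q s'"
  shows "runs (prog_sq X2) (n * (n * (n * 34 + 32) + 16) + 8) s Q"
  unfolding prog_sq_def
proof (rule runs_Map2[OF n, where b = "n * 34 + 24" and X = X2
      and f = "\<lambda>i j. \<Sum>l<n. (rarr s ''H'' i l + rarr s ''S'' i j * rarr s ''H'' j l)\<^sup>2"])
  let ?sum = "Sum ''l'' ''d'' (RMul row_entry row_entry)"
  let ?st = "put X2 ''i'' ''j'' (RVar ''d'')"
  fix s1 i j assume ij: "i < n" "j < n" and a1: "agree (Map2 (Seq (RAssign ''d'' (RConst 0)) (Seq ?sum ?st))) s s1"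
    and v: "ivar s1 ''i'' = i" "ivar s1 ''j'' = j"
  let ?f = "\<lambda>l. (rarr s ''H'' i l + rarr s ''S'' i j * rarr s ''H'' j l)\<^sup>2"
  have n1: "ivar s1 ''n'' = n" using agreeI[OF a1] n by simp
  have A1: "rarr s1 ''H'' = rarr s ''H''" "rarr s1 ''S'' = rarr s ''S''" using agreeA[OF a1] X2 by auto
  show "runs (Seq (RAssign ''d'' (RConst 0)) (Seq ?sum ?st)) (n * 34 + 24) s1
    (\<lambda>s''. rarr s'' X2 = (rarr s1 X2)(i := (rarr s1 X2 i)(j := sum ?f {..<n})))"
  proof (rule runs_Seq[where p = 2 and q = "n * 34 + 22"], rule runs_loop_free,
      rule_tac [3] runs_Seq[where p = "n * 34 + 8" and q = 14],
      rule_tac [3] runs_Sum[where n = n and f = ?f])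
    fix s2 l assume l: "l < n" and a2: "agree ?sum (sem (RAssign ''d'' (RConst 0)) s1) s2" and lv: "ivar s2 ''l'' = l"
    show "rval (RMul row_entry row_entry) s2 = ?f l"
      using agreeI[OF a2] agreeA[OF a2] lv v A1 by (simp add: row_entry_def power2_eq_square)
  next
    fix s2 assume a2: "agree ?sum (sem (RAssign ''d'' (RConst 0)) s1) s2"
      and d: "rvar s2 ''d'' = rvar (sem (RAssign ''d'' (RConst 0)) s1) ''d'' + sum ?f {..<n}"
    show "runs ?st 14 s2 (\<lambda>s''. rarr s'' X2 = (rarr s1 X2)(i := (rarr s1 X2 i)(j := sum ?f {..<n})))"
      by (rule runs_loop_free) (use d agreeI[OF a2] agreeA[OF a2] v in auto)
  qed (use n1 in \<open>auto simp: row_entry_def\<close>)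
next
  fix s' assume "agree (Map2 (Seq (RAssign ''d'' (RConst 0)) (Seq (Sum ''l'' ''d'' (RMul row_entry row_entry))
     (put X2 ''i'' ''j'' (RVar ''d''))))) s s'"
    "\<And>i j. i < n \<Longrightarrow> j < n \<Longrightarrow> rarr s' X2 i j = (\<Sum>l<n. (rarr s ''H'' i l + rarr s ''S'' i j * rarr s ''H'' j l)\<^sup>2)"
  then show "Q s'" by (intro Q) (auto simp: prog_sq_def)
qed auto

lemma runs_shift:
  assumes n: "ivar s ''n'' = n" and y: "y \<notin> {''eta'', ''tau''}"
    and Q: "\<And>s'. agree (prog_shift sg X2 y) s s' \<Longrightarrow>
      rvar s' y = (\<Sum>i<n. \<Sum>j<n. rvar s ''eta'' * (rarr s ''H'' i j * rarr s ''H'' i j)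
        + of_rat sg * (rvar s ''tau'' * (rarr s ''S'' i j * rarr s ''A'' i j / 2 * rarr s X2 i j))) \<Longrightarrow> Q s'"
  shows "runs (prog_shift sg X2 y) (n * (n * 50 + 20) + 10) s Q"
  unfolding prog_shift_def
proof (rule runs_Seq[where p = 2 and q = "n * (n * 50 + 20) + 8"], rule runs_loop_free)
  let ?f = "\<lambda>i j. rvar s ''eta'' * (rarr s ''H'' i j * rarr s ''H'' i j)
        + of_rat sg * (rvar s ''tau'' * (rarr s ''S'' i j * rarr s ''A'' i j / 2 * rarr s X2 i j))"
  let ?s0 = "sem (RAssign y (RConst 0)) s"
  let ?sum = "Sum ''j'' y (shift_entry sg X2)"
  show "runs (For ''i'' ''n'' ?sum) (n * (n * 50 + 20) + 8) ?s0 Q"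
  proof (rule runs_For[where N = n and b = "n * 50 + 8" and I = "\<lambda>k s'. rvar s' y = (\<Sum>i<k. sum (?f i) {..<n})"])
    fix i s1 assume i: "i < n" and a1: "agree (For ''i'' ''n'' ?sum) ?s0 s1" and iv: "ivar s1 ''i'' = i"
      and I: "rvar s1 y = (\<Sum>i<i. sum (?f i) {..<n})"
    have n1: "ivar s1 ''n'' = n" using agreeI[OF a1] n by simp
    show "runs ?sum (n * 50 + 8) s1 (\<lambda>s'. rvar s' y = (\<Sum>i<Suc i. sum (?f i) {..<n}))"
    proof (rule runs_Sum[OF n1, where f = "?f i"])
      fix s2 j assume j: "j < n" and a2: "agree ?sum s1 s2" and jv: "ivar s2 ''j'' = j"
      have "rvar s2 ''eta'' = rvar s ''eta''" "rvar s2 ''tau'' = rvar s ''tau''" "rarr s2 = rarr s" "ivar s2 ''i'' = i"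
        using agreeR[OF a2] agreeR[OF a1] agreeA[OF a2] agreeA[OF a1] agreeI[OF a2] iv y by (auto simp: fun_eq_iff)
      then show "rval (shift_entry sg X2) s2 = ?f i j" using jv by (simp add: shift_entry_def)
    qed (use I in \<open>auto simp: shift_entry_def\<close>)
  next
    fix s' assume a: "agree (For ''i'' ''n'' ?sum) ?s0 s'" and I: "rvar s' y = (\<Sum>i<n. sum (?f i) {..<n})"
    have "agree (prog_shift sg X2 y) s ?s0" by (simp add: agree_def)
    moreover have "agree (prog_shift sg X2 y) ?s0 s'" by (rule agree_mono[OF a]) auto
    ultimately have "agree (prog_shift sg X2 y) s s'" by (rule agree_trans)
    then show "Q s'" using I by (rule Q)
  qed (use n in \<open>auto simp: algebra_simps\<close>)
qed auto

lemma runs_side: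
  assumes n: "ivar s ''n'' = n"
    and X: "X1 \<notin> {''H'', ''S'', ''A'', X2}" "X2 \<notin> {''H'', ''S'', ''A''}" "y \<notin> {''eta'', ''tau''}"
    and P: "pd n P"
    and PW: "\<And>i j. i < n \<Longrightarrow> j < n \<Longrightarrow>
      P i j = (if i = j then rvar s ''u'' else 0) + of_rat sg * (rvar s ''c'' * rarr s ''M'' i j - rarr s ''G'' i j)"
    and Q: "\<And>s' H. agree (prog_side sg X1 X2 y) s s' \<Longrightarrow> inverse_on n P H \<Longrightarrow>
      (\<And>i j. i < n \<Longrightarrow> j < n \<Longrightarrow> rarr s' X1 i j = H i i + H j j + 2 * rarr s ''S'' i j * H i j) \<Longrightarrow>
      (\<And>i j. i < n \<Longrightarrow> j < n \<Longrightarrow> rarr s' X2 i j = (\<Sum>l<n. (H i l + rarr s ''S'' i j * H j l)\<^sup>2)) \<Longrightarrow>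
      rvar s' y = (\<Sum>i<n. \<Sum>j<n. rvar s ''eta'' * (H i j * H i j)
        + of_rat sg * (rvar s ''tau'' * (rarr s ''S'' i j * rarr s ''A'' i j / 2 *
          (\<Sum>l<n. (H i l + rarr s ''S'' i j * H j l)\<^sup>2)))) \<Longrightarrow> Q s'"
  shows "runs (prog_side sg X1 X2 y) (n * (n * (n * 84 + 400) + 200) + 100) s Q"
  unfolding prog_side_def
proof (rule runs_Seq[where p = "n * (n * 50 + 16) + 8" and q = "n * (n * (n * 84 + 350) + 184) + 92"],
    rule runs_Fill2[OF n, where f = P])
  let ?c1 = "Map2 (put ''W'' ''i'' ''j'' (barrier_entry sg))"
  let ?c2 = "Map2 (put ''H'' ''i'' ''j'' (dlt ''i'' ''j''))"
  let ?c4 = "Map2 (put X1 ''i'' ''j'' quad_entry)"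
  fix s1 i j assume ij: "i < n" "j < n" and a1: "agree ?c1 s s1" and v: "ivar s1 ''i'' = i" "ivar s1 ''j'' = j"
  show "rval (barrier_entry sg) s1 = P i j" using PW[OF ij] agreeA[OF a1] agreeR[OF a1] v by simp
next
  let ?c1 = "Map2 (put ''W'' ''i'' ''j'' (barrier_entry sg))"
  let ?c2 = "Map2 (put ''H'' ''i'' ''j'' (dlt ''i'' ''j''))"
  let ?c4 = "Map2 (put X1 ''i'' ''j'' quad_entry)"
  fix s1 assume a1: "agree ?c1 s s1" and W1: "\<And>i j. i < n \<Longrightarrow> j < n \<Longrightarrow> rarr s1 ''W'' i j = P i j"
  have n1: "ivar s1 ''n'' = n" using agreeI[OF a1] n by simp
  show "runs (Seq ?c2 (Seq prog_gj (Seq ?c4 (Seq (prog_sq X2) (prog_shift sg X2 y))))) (n * (n * (n * 84 + 350) + 184) + 92) s1 Q"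
  proof (rule runs_Seq[where p = "n * (n * 21 + 16) + 8" and q = "n * (n * (n * 84 + 329) + 168) + 84"],
      rule runs_Fill2[OF n1, where f = "\<lambda>i j. if i = j then 1 else 0"])
    fix s2 assume a2: "agree ?c2 s1 s2" and H2: "\<And>i j. i < n \<Longrightarrow> j < n \<Longrightarrow> rarr s2 ''H'' i j = (if i = j then 1 else 0)"
    have n2: "ivar s2 ''n'' = n" using agreeI[OF a2] n1 by simp
    have W2: "\<And>i j. i < n \<Longrightarrow> j < n \<Longrightarrow> rarr s2 ''W'' i j = P i j" using agreeA[OF a2] W1 by simp
    show "runs (Seq prog_gj (Seq ?c4 (Seq (prog_sq X2) (prog_shift sg X2 y)))) (n * (n * (n * 84 + 329) + 168) + 84) s2 Q"
    proof (rule runs_Seq[where p = "n * (n * (n * 50 + 120) + 80) + 8" and q = "n * (n * (n * 34 + 209) + 88) + 76"],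
        rule runs_gj[OF n2 P W2 H2])
      fix s3 assume a3: "agree prog_gj s2 s3" and inv: "inverse_on n P (rarr s3 ''H'')"
      let ?H = "rarr s3 ''H''"
      have n3: "ivar s3 ''n'' = n" using agreeI[OF a3] n2 by simp
      have S3: "rarr s3 ''S'' = rarr s ''S''" using agreeA[OF a3] agreeA[OF a2] agreeA[OF a1] by simp
      show "runs (Seq ?c4 (Seq (prog_sq X2) (prog_shift sg X2 y))) (n * (n * (n * 34 + 209) + 88) + 76) s3 Q"
      proof (rule runs_Seq[where p = "n * (n * 40 + 16) + 8" and q = "n * (n * (n * 34 + 169) + 72) + 68"],
          rule runs_Fill2[OF n3, where f = "\<lambda>i j. ?H i i + ?H j j + 2 * rarr s ''S'' i j * ?H i j"])
        fix s4 i j assume ij: "i < n" "j < n" and a4: "agree ?c4 s3 s4" and v: "ivar s4 ''i'' = i" "ivar s4 ''j'' = j"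
        show "rval quad_entry s4 = ?H i i + ?H j j + 2 * rarr s ''S'' i j * ?H i j"
        proof -
          have "rarr s4 ''H'' = ?H" "rarr s4 ''S'' = rarr s ''S''" using agreeA[OF a4] S3 X by auto
          then show ?thesis using v by (simp add: quad_entry_def)
        qed
      next
        fix s4 assume a4: "agree ?c4 s3 s4"
          and X1: "\<And>i j. i < n \<Longrightarrow> j < n \<Longrightarrow> rarr s4 X1 i j = ?H i i + ?H j j + 2 * rarr s ''S'' i j * ?H i j"
        have n4: "ivar s4 ''n'' = n" using agreeI[OF a4] n3 by simp
        have X2': "X2 \<notin> {''H'', ''S''}" using X by simp
        show "runs (Seq (prog_sq X2) (prog_shift sg X2 y)) (n * (n * (n * 34 + 169) + 72) + 68) s4 Q"
        proof (rule runs_Seq[where p = "n * (n * (n * 34 + 32) + 16) + 8" and q = "n * (n * 50 + 20) + 10"],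
            rule runs_sq[OF n4 X2'])
          fix s5 assume a5: "agree (prog_sq X2) s4 s5"
            and X2: "\<And>i j. i < n \<Longrightarrow> j < n \<Longrightarrow>
              rarr s5 X2 i j = (\<Sum>l<n. (rarr s4 ''H'' i l + rarr s4 ''S'' i j * rarr s4 ''H'' j l)\<^sup>2)"
          have n5: "ivar s5 ''n'' = n" using agreeI[OF a5] n4 by simp
          have H5: "rarr s5 ''H'' = ?H" "rarr s4 ''H'' = ?H" "rarr s4 ''S'' = rarr s ''S''"
              "rarr s5 ''S'' = rarr s ''S''" "rarr s5 ''A'' = rarr s ''A''"
              "rvar s5 ''eta'' = rvar s ''eta''" "rvar s5 ''tau'' = rvar s ''tau''"
            using agreeA[OF a5] agreeA[OF a4] agreeA[OF a3] agreeA[OF a2] agreeA[OF a1] X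
              agreeR[OF a5] agreeR[OF a4] agreeR[OF a3] agreeR[OF a2] agreeR[OF a1] by auto
          have X1': "rarr s5 X1 = rarr s4 X1" using agreeA[OF a5] X by simp
          show "runs (prog_shift sg X2 y) (n * (n * 50 + 20) + 10) s5 Q"
          proof (rule runs_shift[OF n5 X(3)])
            fix s6 assume a6: "agree (prog_shift sg X2 y) s5 s6"
              and y: "rvar s6 y = (\<Sum>i<n. \<Sum>j<n. rvar s5 ''eta'' * (rarr s5 ''H'' i j * rarr s5 ''H'' i j)
                + of_rat sg * (rvar s5 ''tau'' * (rarr s5 ''S'' i j * rarr s5 ''A'' i j / 2 * rarr s5 X2 i j)))"
            have ag: "agree (prog_side sg X1 X2 y) s s1"  "agree (prog_side sg X1 X2 y) s1 s2"
              "agree (prog_side sg X1 X2 y) s2 s3" "agree (prog_side sg X1 X2 y) s3 s4"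
              "agree (prog_side sg X1 X2 y) s4 s5" "agree (prog_side sg X1 X2 y) s5 s6"
              by (rule agree_mono[OF a1] agree_mono[OF a2] agree_mono[OF a3] agree_mono[OF a4]
                  agree_mono[OF a5] agree_mono[OF a6]; auto)+
            have "agree (prog_side sg X1 X2 y) s s6"
              using ag agree_trans by blast
            moreover note inv
            moreover have "rarr s6 X1 i j = ?H i i + ?H j j + 2 * rarr s ''S'' i j * ?H i j" if "i < n" "j < n" for i j
              using X1[OF that] X1' agreeA[OF a6] by simp
            moreover have "rarr s6 X2 i j = (\<Sum>l<n. (?H i l + rarr s ''S'' i j * ?H j l)\<^sup>2)" if "i < n" "j < n" for i j
              using X2[OF that] H5 agreeA[OF a6] by simp
            moreover have "rvar s6 y = (\<Sum>i<n. \<Sum>j<n. rvar s ''eta'' * (?H i j * ?H i j)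
              + of_rat sg * (rvar s ''tau'' * (rarr s ''S'' i j * rarr s ''A'' i j / 2 *
              (\<Sum>l<n. (?H i l + rarr s ''S'' i j * ?H j l)\<^sup>2))))"
              unfolding y H5 by (intro sum.cong refl) (simp add: X2 H5)
            ultimately show "Q s6" by (rule Q)
          qed
        qed (simp add: algebra_simps)
      qed (auto simp: quad_entry_def algebra_simps)
    qed (auto simp: distrib_left)
  qed (auto simp: algebra_simps)
qed (auto simp: algebra_simps)

section \<open>Selecting a pair and updating G\<close>

abbreviation sel_threshold :: rexp where
  "sel_threshold \<equiv> RAdd (RDiv (ent ''P2'' ''i'' ''j'') (RVar ''yp'')) (ent ''P1'' ''i'' ''j'')"

abbreviation sel_test :: test where
  "sel_test \<equiv> RLess (RMul (RSub (RConst 0) (RVar ''yq'')) (RAdd sel_threshold (ent ''Q1'' ''i'' ''j''))) (ent ''Q2'' ''i'' ''j'')"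

abbreviation sel_pick :: com where
  "sel_pick \<equiv> Seq (IAssign ''bi'' (IVar ''i'')) (Seq (IAssign ''bj'' (IVar ''j'')) (RAssign ''s'' (RDiv (RConst 1) sel_threshold)))"

text \<open>The last admissible pair wins. The defaults s = 0 and indices 0 encode that there is
  none: the update then adds the zero matrix at a valid position, as n > 0.\<close>

definition prog_select :: com where
  "prog_select = Seq (Seq (RAssign ''s'' (RConst 0)) (Seq (IAssign ''bi'' (IConst 0)) (IAssign ''bj'' (IConst 0))))
    (For ''i'' ''n'' (For ''j'' ''n''
      (Cond sel_test
        sel_pick
        Skip)))"

text \<open>Adds s v v^T. For bi = bj all four stores hit the same cell and add s (2 + 2 S), which
  equals s (1 + S)^2 because S^2 = 1; hence the hypothesis of \<open>runs_update\<close>.\<close>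

definition prog_update :: com where
  "prog_update = Seq (put ''G'' ''bi'' ''bi'' (RAdd (ent ''G'' ''bi'' ''bi'') (RVar ''s'')))
    (Seq (put ''G'' ''bj'' ''bj'' (RAdd (ent ''G'' ''bj'' ''bj'') (RVar ''s'')))
    (Seq (put ''G'' ''bi'' ''bj'' (RAdd (ent ''G'' ''bi'' ''bj'') (RMul (RVar ''s'') (ent ''S'' ''bi'' ''bj''))))
    (put ''G'' ''bj'' ''bi'' (RAdd (ent ''G'' ''bj'' ''bi'') (RMul (RVar ''s'') (ent ''S'' ''bi'' ''bj''))))))"

lemma runs_update:
  assumes "(rarr s ''S'' (ivar s ''bi'') (ivar s ''bj''))\<^sup>2 = 1"
    and Q: "\<And>s'. agree prog_update s s' \<Longrightarrow>
      (\<And>k l. rarr s' ''G'' k l = rarr s ''G'' k l + rvar s ''s''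
        * pvec (rarr s ''S'' (ivar s ''bi'') (ivar s ''bj'')) (ivar s ''bi'') (ivar s ''bj'') k
        * pvec (rarr s ''S'' (ivar s ''bi'') (ivar s ''bj'')) (ivar s ''bi'') (ivar s ''bj'') l) \<Longrightarrow> Q s'"
  shows "runs prog_update 60 s Q"
proof (rule runs_loop_free)
  show "Q (sem prog_update s)"
  proof (rule Q)
    show "agree prog_update s (sem prog_update s)" by (auto simp: agree_def prog_update_def)
    fix k l
    show "rarr (sem prog_update s) ''G'' k l = rarr s ''G'' k l + rvar s ''s''
        * pvec (rarr s ''S'' (ivar s ''bi'') (ivar s ''bj'')) (ivar s ''bi'') (ivar s ''bj'') k
        * pvec (rarr s ''S'' (ivar s ''bi'') (ivar s ''bj'')) (ivar s ''bi'') (ivar s ''bj'') l"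
      using assms(1) by (auto simp: prog_update_def pvec_def power2_eq_square algebra_simps)
  qed
qed (auto simp: prog_update_def)

lemma runs_select:
  assumes n: "ivar s ''n'' = n" "0 < n"
  defines "th \<equiv> \<lambda>i j. rarr s ''P2'' i j / rvar s ''yp'' + rarr s ''P1'' i j"
  defines "ch \<equiv> \<lambda>i j. - rvar s ''yq'' * (th i j + rarr s ''Q1'' i j) < rarr s ''Q2'' i j"
  assumes Q: "\<And>s' p q. agree prog_select s s' \<Longrightarrow> ivar s' ''bi'' = p \<Longrightarrow> ivar s' ''bj'' = q \<Longrightarrow> p < n \<Longrightarrow> q < n \<Longrightarrow>
      rvar s' ''s'' = 0 \<and> \<not> (\<exists>i<n. \<exists>j<n. ch i j) \<or> ch p q \<and> rvar s' ''s'' = 1 / th p q \<Longrightarrow> Q s'"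
  shows "runs prog_select (n * (n * 80 + 20) + 20) s Q"
  unfolding prog_select_def
proof (rule runs_Seq[where p = 10 and q = "n * (n * 80 + 16) + 8"], rule runs_loop_free)
  let ?s0 = "sem (Seq (RAssign ''s'' (RConst 0)) (Seq (IAssign ''bi'' (IConst 0)) (IAssign ''bj'' (IConst 0)))) s"
  let ?b = "Cond sel_test
        sel_pick
        Skip"
  \<comment> \<open>\<open>V\<close> is the region of pairs already scanned; the nested loops differ
    only in this region.\<close>
  let ?J = "\<lambda>V s'. ivar s' ''bi'' < n \<and> ivar s' ''bj'' < n \<and> (rvar s' ''s'' = 0 \<and> \<not> (\<exists>i j. V i j \<and> ch i j)
    \<or> ch (ivar s' ''bi'') (ivar s' ''bj'') \<and> rvar s' ''s'' = 1 / th (ivar s' ''bi'') (ivar s' ''bj''))"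
  let ?I = "\<lambda>k s'. ?J (\<lambda>i j. i < k \<and> j < n) s'"
  show "runs (For ''i'' ''n'' (For ''j'' ''n'' ?b)) (n * (n * 80 + 16) + 8) ?s0 Q"
  proof (rule runs_For[where N = n and b = "n * 80 + 8" and I = "\<lambda>k s'. ?J (\<lambda>i j. i < k \<and> j < n) s'"])
    fix k s1 assume k: "k < n" and a1: "agree (For ''i'' ''n'' (For ''j'' ''n'' ?b)) ?s0 s1" and iv: "ivar s1 ''i'' = k"
      and I: "?J (\<lambda>i j. i < k \<and> j < n) s1"
    have n1: "ivar s1 ''n'' = n" using agreeI[OF a1] n by simp
    show "runs (For ''j'' ''n'' ?b) (n * 80 + 8) s1 (\<lambda>s'. ?J (\<lambda>i j. i < Suc k \<and> j < n) s')"
    proof (rule runs_For[where N = n and b = 72 and I = "\<lambda>l s'. ?J (\<lambda>i j. i < k \<and> j < n \<or> i = k \<and> j < l) s'"])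
      fix l s2 assume l: "l < n" and a2: "agree (For ''j'' ''n'' ?b) s1 s2" and jv: "ivar s2 ''j'' = l"
        and I2: "?J (\<lambda>i j. i < k \<and> j < n \<or> i = k \<and> j < l) s2"
      have v: "ivar s2 ''i'' = k" "rarr s2 = rarr s" "rvar s2 ''yp'' = rvar s ''yp''" "rvar s2 ''yq'' = rvar s ''yq''"
        using agreeI[OF a2] agreeA[OF a2] agreeA[OF a1] agreeR[OF a2] agreeR[OF a1] iv by (auto simp: fun_eq_iff)
      show "runs ?b 72 s2 (\<lambda>s'. ?J (\<lambda>i j. i < k \<and> j < n \<or> i = k \<and> j < Suc l) s')"
      proof (rule runs_Cond[where b' = 40])
        assume "tval sel_test s2"
        then have "ch k l" using v jv by (simp add: ch_def th_def)
        then show "runs sel_pick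
          40 s2 (\<lambda>s'. ?J (\<lambda>i j. i < k \<and> j < n \<or> i = k \<and> j < Suc l) s')"
          using v jv k l by (intro runs_loop_free) (simp_all add: th_def)
      next
        assume "\<not> tval sel_test s2"
        then have nc: "\<not> ch k l" using v jv by (simp add: ch_def th_def)
        have "?J (\<lambda>i j. i < k \<and> j < n \<or> i = k \<and> j < Suc l) s2" using I2 nc less_Suc_eq by metis
        then show "runs Skip 40 s2 (\<lambda>s'. ?J (\<lambda>i j. i < k \<and> j < n \<or> i = k \<and> j < Suc l) s')"
          by (intro runs_loop_free) auto
      qed simp
    next
      fix s2 assume "?J (\<lambda>i j. i < k \<and> j < n \<or> i = k \<and> j < n) s2"
      then show "?J (\<lambda>i j. i < Suc k \<and> j < n) s2" using less_Suc_eq by metis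
    qed (use n1 I in auto)
  next
    fix s' assume a: "agree (For ''i'' ''n'' (For ''j'' ''n'' ?b)) ?s0 s'" and I: "?J (\<lambda>i j. i < n \<and> j < n) s'"
    have "agree prog_select s ?s0" by (simp add: agree_def prog_select_def)
    moreover have "agree prog_select ?s0 s'" by (rule agree_mono[OF a]) (auto simp: prog_select_def)
    ultimately have "agree prog_select s s'" by (rule agree_trans)
    then show "Q s'" by (rule Q) (use I in auto)
  qed (use n in auto)
qed (auto simp: algebra_simps)

section \<open>One barrier step and the main loop\<close>

definition prog_body :: com where
  "prog_body = Seq (Seq (RAssign ''u'' (RAdd (RVar ''u'') (RVar ''eta''))) (RAssign ''c'' (RAdd (RVar ''c'') (RVar ''tau''))))
    (Seq (prog_side 1 ''P1'' ''P2'' ''yp'') (Seq (prog_side (-1) ''Q1'' ''Q2'' ''yq'') (Seq prog_select prog_update)))"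

lemma writes_select [simp]: "iw prog_select = {''bi'', ''bj'', ''i'', ''j''}" "rw prog_select = {''s''}" "aw prog_select = {}"
  by (auto simp: prog_select_def)
lemma writes_update [simp]: "iw prog_update = {}" "rw prog_update = {}" "aw prog_update = {''G''}"
  by (auto simp: prog_update_def)
lemma writes_body [simp]: "iw prog_body = {''i'', ''j'', ''k'', ''l'', ''bi'', ''bj''}"
  "rw prog_body = {''u'', ''c'', ''d'', ''yp'', ''yq'', ''s''}"
  "aw prog_body = {''p'', ''q'', ''r'', ''W'', ''H'', ''P1'', ''P2'', ''Q1'', ''Q2'', ''G''}"
  by (auto simp: prog_body_def)

context signed_matrix begin

lemma sum_shift_entries:
  "(\<Sum>i<n. \<Sum>j<n. \<eta> * (H i j * H i j) + \<sigma> * (\<tau> * (\<bar>A i j\<bar> / 2 * (\<Sum>l<n. (H i l + S i j * H j l)\<^sup>2))))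
    = \<eta> * fro H + (\<sigma> * \<tau>) * m2 H"
proof -
  have "m2 H = (\<Sum>i<n. \<Sum>j<n. \<bar>A i j\<bar> / 2 * (\<Sum>l<n. (H i l + S i j * H j l)\<^sup>2))"
    unfolding m2_def wsum_def by (intro sum.cong refl) (simp add: ip_def vm_pvec power2_eq_square)
  then show ?thesis
    by (simp add: sum.distrib sum_distrib_left fro_def ip_def mult.assoc)
qed

text \<open>The weight w in the conclusion is 0 when no pair is admissible; leaving it open lets the
  main loop treat both cases as one rank-one update.\<close>

lemma runs_body:
  assumes n: "ivar s ''n'' = n" and A: "rarr s ''A'' = A"
    and S: "\<And>i j. i < n \<Longrightarrow> j < n \<Longrightarrow> rarr s ''S'' i j = S i j"
    and M: "\<And>i j. i < n \<Longrightarrow> j < n \<Longrightarrow> rarr s ''M'' i j = M i j"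
    and vars: "rvar s ''u'' = u" "rvar s ''c'' = c" "rvar s ''eta'' = \<eta>" "rvar s ''tau'' = \<tau>"
    and bs: "barrier_step n A R \<Phi> \<tau> \<eta> u (\<lambda>i j. rarr s ''G'' i j - c * M i j)"
    and Z: "\<And>s' p q w. agree prog_body s s' \<Longrightarrow> p < n \<Longrightarrow> q < n \<Longrightarrow> rvar s' ''u'' = u + \<eta> \<Longrightarrow> rvar s' ''c'' = c + \<tau> \<Longrightarrow>
      (\<And>k l. rarr s' ''G'' k l = rarr s ''G'' k l + w * v p q k * v p q l) \<Longrightarrow>
      confined \<Phi> (u + \<eta>) (\<lambda>i j. rarr s' ''G'' i j - (c + \<tau>) * M i j) \<Longrightarrow>
      confined \<Phi> (u + \<eta>) (\<lambda>i j. - (rarr s' ''G'' i j - (c + \<tau>) * M i j)) \<Longrightarrow> Z s'"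
  shows "runs prog_body (n * (n * (n * 168 + 880) + 420) + 300) s Z"
proof -
  interpret barrier_step n A R \<Phi> \<tau> \<eta> u "\<lambda>i j. rarr s ''G'' i j - c * M i j" by (rule bs)
  let ?c0 = "Seq (RAssign ''u'' (RAdd (RVar ''u'') (RVar ''eta''))) (RAssign ''c'' (RAdd (RVar ''c'') (RVar ''tau'')))"
  let ?s0 = "sem ?c0 s"
  have ag0: "agree prog_body s ?s0" by (simp add: agree_def)
  show ?thesis unfolding prog_body_def
  proof (rule runs_Seq[where p = 10 and q = "n * (n * (n * 168 + 880) + 420) + 290"], rule runs_loop_free)
    show "runs (Seq (prog_side 1 ''P1'' ''P2'' ''yp'') (Seq (prog_side (-1) ''Q1'' ''Q2'' ''yq'') (Seq prog_select prog_update)))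
      (n * (n * (n * 168 + 880) + 420) + 290) ?s0 Z"
    proof (rule runs_Seq[where p = "n * (n * (n * 84 + 400) + 200) + 100" and q = "n * (n * (n * 84 + 480) + 220) + 190"],
        rule runs_side[OF _ _ _ _ pd_P])
      fix i j assume "i < n" "j < n"
      then show "P i j = (if i = j then rvar ?s0 ''u'' else 0)
          + of_rat 1 * (rvar ?s0 ''c'' * rarr ?s0 ''M'' i j - rarr ?s0 ''G'' i j)"
        by (simp add: barrier_def vars M algebra_simps)
    next
      fix s1 H assume a1: "agree (prog_side 1 ''P1'' ''P2'' ''yp'') ?s0 s1" and H: "inverse_on n P H"
        and P1: "\<And>i j. i < n \<Longrightarrow> j < n \<Longrightarrow> rarr s1 ''P1'' i j = H i i + H j j + 2 * rarr ?s0 ''S'' i j * H i j"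
        and P2: "\<And>i j. i < n \<Longrightarrow> j < n \<Longrightarrow> rarr s1 ''P2'' i j = (\<Sum>l<n. (H i l + rarr ?s0 ''S'' i j * H j l)\<^sup>2)"
        and yp: "rvar s1 ''yp'' = (\<Sum>i<n. \<Sum>j<n. rvar ?s0 ''eta'' * (H i j * H i j)
          + of_rat 1 * (rvar ?s0 ''tau'' * (rarr ?s0 ''S'' i j * rarr ?s0 ''A'' i j / 2 *
          (\<Sum>l<n. (H i l + rarr ?s0 ''S'' i j * H j l)\<^sup>2))))"
      have s1: "ivar s1 ''n'' = n" "rarr s1 ''A'' = A" "rarr s1 ''S'' = rarr s ''S''" "rarr s1 ''M'' = rarr s ''M''"
        "rarr s1 ''G'' = rarr s ''G''" "rvar s1 ''u'' = u + \<eta>" "rvar s1 ''c'' = c + \<tau>" "rvar s1 ''eta'' = \<eta>" "rvar s1 ''tau'' = \<tau>"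
        using agreeI[OF a1] agreeA[OF a1] agreeR[OF a1] n A vars by auto
      have "sym_on n H" using inverse_on_sym[OF H] pd_P by (simp add: pd_def)
      then have P1': "rarr s1 ''P1'' i j = bf n H (v i j) (v i j)" if "i < n" "j < n" for i j
        using P1[OF that] S[OF that] that by (simp add: bf_pvec S_sq)
      have P2': "rarr s1 ''P2'' i j = ip n (vm n (v i j) H) (vm n (v i j) H)" if "i < n" "j < n" for i j
        using P2[OF that] S[OF that] that by (simp add: ip_def vm_pvec power2_eq_square)
      have yp': "rvar s1 ''yp'' = \<eta> * fro H + \<tau> * m2 H"
      proof -
        have "rvar s1 ''yp'' = (\<Sum>i<n. \<Sum>j<n. \<eta> * (H i j * H i j) + 1 * (\<tau> * (\<bar>A i j\<bar> / 2 * (\<Sum>l<n. (H i l + S i j * H j l)\<^sup>2))))"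
          unfolding yp by (intro sum.cong refl) (simp add: vars A S S_abs)
        then show ?thesis unfolding sum_shift_entries by simp
      qed
      show "runs (Seq (prog_side (-1) ''Q1'' ''Q2'' ''yq'') (Seq prog_select prog_update))
        (n * (n * (n * 84 + 480) + 220) + 190) s1 Z"
      proof (rule runs_Seq[where p = "n * (n * (n * 84 + 400) + 200) + 100" and q = "n * (n * 80 + 20) + 90"],
          rule runs_side[OF s1(1) _ _ _ pd_Q])
        fix i j assume "i < n" "j < n"
        then show "Q i j = (if i = j then rvar s1 ''u'' else 0)
            + of_rat (-1) * (rvar s1 ''c'' * rarr s1 ''M'' i j - rarr s1 ''G'' i j)"
          by (simp add: barrier_def s1 M algebra_simps)
      next
        fix s2 K assume a2: "agree (prog_side (-1) ''Q1'' ''Q2'' ''yq'') s1 s2" and K: "inverse_on n Q K"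
          and Q1: "\<And>i j. i < n \<Longrightarrow> j < n \<Longrightarrow> rarr s2 ''Q1'' i j = K i i + K j j + 2 * rarr s1 ''S'' i j * K i j"
          and Q2: "\<And>i j. i < n \<Longrightarrow> j < n \<Longrightarrow> rarr s2 ''Q2'' i j = (\<Sum>l<n. (K i l + rarr s1 ''S'' i j * K j l)\<^sup>2)"
          and yq: "rvar s2 ''yq'' = (\<Sum>i<n. \<Sum>j<n. rvar s1 ''eta'' * (K i j * K i j)
            + of_rat (-1) * (rvar s1 ''tau'' * (rarr s1 ''S'' i j * rarr s1 ''A'' i j / 2 *
            (\<Sum>l<n. (K i l + rarr s1 ''S'' i j * K j l)\<^sup>2))))"
        have s2: "ivar s2 ''n'' = n" "rarr s2 ''S'' = rarr s ''S''"
          "rarr s2 ''G'' = rarr s ''G''" "rvar s2 ''u'' = u + \<eta>" "rvar s2 ''c'' = c + \<tau>"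
          "rarr s2 ''P1'' = rarr s1 ''P1''" "rarr s2 ''P2'' = rarr s1 ''P2''" "rvar s2 ''yp'' = rvar s1 ''yp''"
          using agreeI[OF a2] agreeA[OF a2] agreeR[OF a2] s1 by auto
        have "sym_on n K" using inverse_on_sym[OF K] pd_Q by (simp add: pd_def)
        then have Q1': "rarr s2 ''Q1'' i j = bf n K (v i j) (v i j)" if "i < n" "j < n" for i j
          using Q1[OF that] S[OF that] that by (simp add: bf_pvec S_sq s1)
        have Q2': "rarr s2 ''Q2'' i j = ip n (vm n (v i j) K) (vm n (v i j) K)" if "i < n" "j < n" for i j
          using Q2[OF that] S[OF that] that by (simp add: ip_def vm_pvec power2_eq_square s1)
        have yq': "rvar s2 ''yq'' = \<eta> * fro K + (- \<tau>) * m2 K"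
        proof -
          have "rvar s2 ''yq'' = (\<Sum>i<n. \<Sum>j<n. \<eta> * (K i j * K i j) + (-1) * (\<tau> * (\<bar>A i j\<bar> / 2 * (\<Sum>l<n. (K i l + S i j * K j l)\<^sup>2))))"
            unfolding yq by (intro sum.cong refl) (simp add: s1 S S_abs)
          then show ?thesis unfolding sum_shift_entries by simp
        qed
        let ?th = "\<lambda>i j. rarr s2 ''P2'' i j / rvar s2 ''yp'' + rarr s2 ''P1'' i j"
        let ?ch = "\<lambda>i j. - rvar s2 ''yq'' * (?th i j + rarr s2 ''Q1'' i j) < rarr s2 ''Q2'' i j"
        have ch: "?ch i j \<longleftrightarrow> chosen H K i j" if "i < n" "j < n" for i j
          unfolding chosen_def[OF H K] using that by (simp add: P1' P2' Q1' Q2' yp' yq' s2)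
        show "runs (Seq prog_select prog_update) (n * (n * 80 + 20) + 90) s2 Z"
        proof (rule runs_Seq[where p = "n * (n * 80 + 20) + 20" and q = 60], rule runs_select[OF s2(1) n_pos])
          fix s3 p q assume a3: "agree prog_select s2 s3" and pq: "ivar s3 ''bi'' = p" "ivar s3 ''bj'' = q" "p < n" "q < n"
            and sel: "rvar s3 ''s'' = 0 \<and> \<not> (\<exists>i<n. \<exists>j<n. ?ch i j) \<or> ?ch p q \<and> rvar s3 ''s'' = 1 / ?th p q"
          let ?w = "rvar s3 ''s''"
          have s3: "rarr s3 ''S'' p q = S p q" "rarr s3 ''G'' = rarr s ''G''" "rvar s3 ''u'' = u + \<eta>" "rvar s3 ''c'' = c + \<tau>"
            using agreeA[OF a3] agreeR[OF a3] s2 S pq by auto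
          let ?X = "\<lambda>k l. (rarr s ''G'' k l - c * M k l) - \<tau> * M k l + ?w * v p q k * v p q l"
          have conf: "confined \<Phi> (u + \<eta>) ?X \<and> confined \<Phi> (u + \<eta>) (\<lambda>k l. - ?X k l)"
          proof (cases "chosen H K p q \<and> ?w = 1 / ?th p q")
            case True
            then show ?thesis using confined_step[OF H K pq(3,4), of ?w] pq(3,4) by (simp add: P1' P2' yp' s2)
          next
            case False
            then have "?w = 0" "\<not> (\<exists>i<n. \<exists>j<n. chosen H K i j)" using sel ch pq by auto
            then show ?thesis using confined_no_step[OF H K] by simp
          qed
          show "runs prog_update 60 s3 Z"
          proof (rule runs_update)
            show "(rarr s3 ''S'' (ivar s3 ''bi'') (ivar s3 ''bj''))\<^sup>2 = 1" using pq s3 by (simp add: S_sq)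
            fix s4 assume a4: "agree prog_update s3 s4"
              and G: "\<And>k l. rarr s4 ''G'' k l = rarr s3 ''G'' k l + rvar s3 ''s''
                * pvec (rarr s3 ''S'' (ivar s3 ''bi'') (ivar s3 ''bj'')) (ivar s3 ''bi'') (ivar s3 ''bj'') k
                * pvec (rarr s3 ''S'' (ivar s3 ''bi'') (ivar s3 ''bj'')) (ivar s3 ''bi'') (ivar s3 ''bj'') l"
            have ag: "agree prog_body ?s0 s1" "agree prog_body s1 s2" "agree prog_body s2 s3" "agree prog_body s3 s4"
              by (rule agree_mono[OF a1] agree_mono[OF a2] agree_mono[OF a3] agree_mono[OF a4]; auto)+
            have "agree prog_body s s4" using ag0 ag agree_trans by blast
            moreover note pq(3,4)
            moreover have "rvar s4 ''u'' = u + \<eta>" "rvar s4 ''c'' = c + \<tau>" using agreeR[OF a4] s3 by auto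
            moreover have G': "rarr s4 ''G'' k l = rarr s ''G'' k l + ?w * v p q k * v p q l" for k l
              using G pq s3 by simp
            moreover have "(\<lambda>i j. rarr s4 ''G'' i j - (c + \<tau>) * M i j) = ?X"
              by (simp add: G' fun_eq_iff algebra_simps)
            then have "confined \<Phi> (u + \<eta>) (\<lambda>i j. rarr s4 ''G'' i j - (c + \<tau>) * M i j)"
              "confined \<Phi> (u + \<eta>) (\<lambda>i j. - (rarr s4 ''G'' i j - (c + \<tau>) * M i j))"
              using conf by (simp_all add: fun_eq_iff)
            ultimately show "Z s4" by (rule Z)
          qed
        qed auto
      qed (auto simp: algebra_simps)
    qed (use n in \<open>auto simp: algebra_simps\<close>)
  qed auto
qed

text \<open>The trace budget stays the same while the barrier moves, so every step meets the
  hypotheses of \<open>barrier_step\<close>. A step touches at most the four positions of {p, q} x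
  {p, q}.\<close>

lemma runs_main:
  fixes T :: nat and u \<eta> :: real
  assumes n: "ivar s ''n'' = n" "0 < n" and T: "ivar s ''T'' = T" "0 < T" and A: "rarr s ''A'' = A"
    and S: "\<And>i j. i < n \<Longrightarrow> j < n \<Longrightarrow> rarr s ''S'' i j = S i j"
    and M: "\<And>i j. i < n \<Longrightarrow> j < n \<Longrightarrow> rarr s ''M'' i j = M i j"
    and G: "rarr s ''G'' = (\<lambda>i j. 0)"
    and R: "0 < R" and u: "0 < u" "4 * u \<le> R"
    and vars: "rvar s ''u'' = u" "rvar s ''c'' = 0" "rvar s ''eta'' = \<eta>" "rvar s ''tau'' = 1 / T"
    and eta: "\<eta> = 6 * R\<^sup>2 * n * (1 / T)\<^sup>2 / u" and Tl: "6 * R\<^sup>2 * n \<le> T * u\<^sup>2"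
    and Q: "\<And>s'. agree (For ''t'' ''T'' prog_body) s s' \<Longrightarrow> sym_on n (rarr s' ''G'') \<Longrightarrow>
      card {(i, j). i < n \<and> j < n \<and> rarr s' ''G'' i j \<noteq> 0} \<le> 4 * T \<Longrightarrow>
      (\<And>x. \<bar>bf n (\<lambda>i j. rarr s' ''G'' i j - M i j) x x\<bar> \<le> 2 * u * ip n x x) \<Longrightarrow> Q s'"
  shows "runs (For ''t'' ''T'' prog_body) (T * (n * (n * (n * 168 + 880) + 420) + 308) + 8) s Q"
proof -
  define \<Phi> where "\<Phi> = n / u"
  define \<tau> where "\<tau> = 1 / real T"
  let ?I = "\<lambda>k s'. rvar s' ''u'' = u + real k * \<eta> \<and> rvar s' ''c'' = real k * \<tau> \<and> sym_on n (rarr s' ''G'')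
    \<and> card {(i, j). i < n \<and> j < n \<and> rarr s' ''G'' i j \<noteq> 0} \<le> 4 * k
    \<and> confined \<Phi> (u + real k * \<eta>) (\<lambda>i j. rarr s' ''G'' i j - (real k * \<tau>) * M i j)
    \<and> confined \<Phi> (u + real k * \<eta>) (\<lambda>i j. - (rarr s' ''G'' i j - (real k * \<tau>) * M i j))"
  have T0: "0 < real T" and n0: "0 < real n" using T n by auto
  \<comment> \<open>Here 4 u \<le> R enters: 4 R n u \<le> R^2 n \<le> 6 R^2 n \<le> T u^2, divided
    by u.\<close>
  have tau: "4 * R * \<tau> * \<Phi> \<le> 1"
  proof -
    have "4 * R * n * u \<le> R * n * R" using mult_left_mono[OF u(2), of "R * n"] R n0 by (simp add: mult_ac)
    also have "\<dots> \<le> 6 * R\<^sup>2 * n" using R n0 by (simp add: power2_eq_square mult_ac)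
    also have "\<dots> \<le> T * u * u" using Tl by (simp add: power2_eq_square mult.assoc)
    finally have "4 * R * n \<le> T * u" using u(1) by simp
    then show ?thesis using T0 u(1) by (simp add: \<tau>_def \<Phi>_def field_simps)
  qed
  have eta': "\<eta> = 6 * R\<^sup>2 * \<Phi> * \<tau>\<^sup>2" by (simp add: eta \<tau>_def \<Phi>_def)
  \<comment> \<open>All widenings together are at most the initial u, so the final barrier is at
    most 2 u.\<close>
  have Teta: "real T * \<eta> \<le> u"
  proof -
    have "real T * \<eta> = 6 * R\<^sup>2 * n / (T * u)" using T0 u by (simp add: eta power2_eq_square field_simps)
    also have "\<dots> \<le> u" using Tl T0 u by (simp add: divide_le_eq power2_eq_square mult_ac)
    finally show ?thesis .
  qed
  show ?thesis
  proof (rule runs_For[where N = T and b = "n * (n * (n * 168 + 880) + 420) + 300" and I = ?I])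
    show "?I 0 s" using vars G confined_init[of u] u by (auto simp: sym_on_def \<Phi>_def)
  next
    fix k s1 assume k: "k < T" and a1: "agree (For ''t'' ''T'' prog_body) s s1" and I: "?I k s1"
    have s1: "ivar s1 ''n'' = n" "rarr s1 ''A'' = A" "rarr s1 ''S'' = rarr s ''S''" "rarr s1 ''M'' = rarr s ''M''"
      "rvar s1 ''eta'' = \<eta>" "rvar s1 ''tau'' = \<tau>"
      using agreeI[OF a1] agreeA[OF a1] agreeR[OF a1] n A vars by (auto simp: \<tau>_def)
    have bs: "barrier_step n A R \<Phi> \<tau> \<eta> (u + real k * \<eta>) (\<lambda>i j. rarr s1 ''G'' i j - (real k * \<tau>) * M i j)"
      by (unfold_locales) (use n R T0 u I tau eta' in \<open>auto simp: \<tau>_def \<Phi>_def\<close>)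
    show "runs prog_body (n * (n * (n * 168 + 880) + 420) + 300) s1 (?I (Suc k))"
    proof (rule runs_body[OF s1(1,2) _ _ _ _ s1(5,6) bs])
      fix s2 p q w assume a2: "agree prog_body s1 s2" and pq: "p < n" "q < n" and uc: "rvar s2 ''u'' = u + real k * \<eta> + \<eta>" "rvar s2 ''c'' = real k * \<tau> + \<tau>"
        and G2: "\<And>k l. rarr s2 ''G'' k l = rarr s1 ''G'' k l + w * v p q k * v p q l"
        and conf: "confined \<Phi> (u + real k * \<eta> + \<eta>) (\<lambda>i j. rarr s2 ''G'' i j - (real k * \<tau> + \<tau>) * M i j)"
          "confined \<Phi> (u + real k * \<eta> + \<eta>) (\<lambda>i j. - (rarr s2 ''G'' i j - (real k * \<tau> + \<tau>) * M i j))"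
      have e: "u + real (Suc k) * \<eta> = u + real k * \<eta> + \<eta>" "real (Suc k) * \<tau> = real k * \<tau> + \<tau>"
        by (simp_all add: algebra_simps)
      have "sym_on n (rarr s2 ''G'')" using I by (simp add: sym_on_def G2)
      moreover have "card {(i, j). i < n \<and> j < n \<and> rarr s2 ''G'' i j \<noteq> 0} \<le> 4 * Suc k"
      proof -
        let ?N = "\<lambda>G :: nat \<Rightarrow> nat \<Rightarrow> real. {(i, j). i < n \<and> j < n \<and> G i j \<noteq> 0}"
        have fin: "finite (?N G)" for G by (rule finite_subset[of _ "{..<n} \<times> {..<n}"]) auto
        have "?N (rarr s2 ''G'') \<subseteq> ?N (rarr s1 ''G'') \<union> {p, q} \<times> {p, q}"
          by (auto simp: G2 pvec_def split: if_splits)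
        then have "card (?N (rarr s2 ''G'')) \<le> card (?N (rarr s1 ''G'') \<union> {p, q} \<times> {p, q})"
          by (intro card_mono finite_UnI fin) auto
        also have "\<dots> \<le> card (?N (rarr s1 ''G'')) + card ({p, q} \<times> {p, q})" by (rule card_Un_le)
        also have "card ({p, q} \<times> {p, q}) \<le> 2 * 2"
          unfolding card_cartesian_product by (intro mult_le_mono) (auto simp: card_insert_if)
        finally show ?thesis using I by simp
      qed
      ultimately show "?I (Suc k) s2" unfolding e using uc conf by simp
    qed (use s1 S M I in auto)
  next
    fix s' assume a: "agree (For ''t'' ''T'' prog_body) s s'" and I: "?I T s'"
    \<comment> \<open>After T rounds the whole of \<open>M\<close> has been subtracted.\<close>
    have Tt: "real T * \<tau> = 1" using T0 by (simp add: \<tau>_def)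
    let ?X = "\<lambda>i j. rarr s' ''G'' i j - M i j"
    have c1: "confined \<Phi> (u + real T * \<eta>) ?X" and c2: "confined \<Phi> (u + real T * \<eta>) (\<lambda>i j. - ?X i j)"
      using I by (simp_all add: Tt)
    have "\<bar>bf n ?X x x\<bar> \<le> 2 * u * ip n x x" for x
    proof -
      have "bf n ?X x x \<le> (u + real T * \<eta>) * ip n x x"
        by (rule confined_form_le[OF c1]) (rule signed_matrix_axioms)
      moreover have "bf n (\<lambda>i j. - ?X i j) x x \<le> (u + real T * \<eta>) * ip n x x"
        by (rule confined_form_le[OF c2]) (rule signed_matrix_axioms)
      moreover have "bf n (\<lambda>i j. - ?X i j) x x = - bf n ?X x x"
        using bf_scale_mat[of n "-1" ?X x x] by simp
      moreover have "(u + real T * \<eta>) * ip n x x \<le> (2 * u) * ip n x x"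
        using Teta ip_self_nonneg by (intro mult_right_mono) auto
      ultimately show ?thesis by linarith
    qed
    then show "Q s'" using I by (intro Q[OF a]) auto
  qed (use T in \<open>auto simp: algebra_simps\<close>)
qed

end

text \<open>M - A is D as a full matrix, so a single formula serves diagonal and off-diagonal
  positions.\<close>

definition prog_out :: com where
  "prog_out = Map2 (put ''B'' ''i'' ''j'' (RAdd (RSub (ent ''G'' ''i'' ''j'') (ent ''M'' ''i'' ''j'')) (ent ''A'' ''i'' ''j'')))"

lemma runs_out:
  assumes "ivar s ''n'' = n"
    and "\<And>s'. (\<And>i j. i < n \<Longrightarrow> j < n \<Longrightarrow> rarr s' ''B'' i j = rarr s ''G'' i j - rarr s ''M'' i j + rarr s ''A'' i j) \<Longrightarrow> Q s'"
  shows "runs prog_out (n * (n * 30 + 16) + 8) s Q"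
  unfolding prog_out_def
  by (rule runs_Fill2[OF assms(1), where f = "\<lambda>i j. rarr s ''G'' i j - rarr s ''M'' i j + rarr s ''A'' i j"])
    (use assms(2) in \<open>auto simp: agreeA\<close>)

section \<open>Operator norm\<close>

text \<open>The value 0 outside the matrix makes this equal, as a function, to the array
  \<open>''A''\<close> of the input state.\<close>

definition entries :: "nat \<Rightarrow> real mat \<Rightarrow> nat \<Rightarrow> nat \<Rightarrow> real" where
  "entries n A = (\<lambda>i j. if i < n \<and> j < n then A $$ (i, j) else 0)"

lemma vec_norm2_eq_nrm: "v \<in> carrier_vec n \<Longrightarrow> vec_norm2 v = nrm n (\<lambda>i. v $ i)"
  by (simp add: vec_norm2_def nrm_def ip_def scalar_prod_def lessThan_atLeast0)

lemma vec_norm2_mult_eq: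
  assumes "A \<in> carrier_mat n n" "v \<in> carrier_vec n"
  shows "vec_norm2 (A *\<^sub>v v) = nrm n (mv n (entries n A) (\<lambda>i. v $ i))"
proof -
  have "(A *\<^sub>v v) $ i = mv n (entries n A) (\<lambda>i. v $ i) i" if "i < n" for i
    using assms that by (auto simp: mv_def entries_def scalar_prod_def lessThan_atLeast0 intro!: sum.cong)
  then show ?thesis using assms
    by (simp add: vec_norm2_eq_nrm[of _ n] nrm_def ip_def)
qed

lemma op_norm_le:
  assumes A: "A \<in> carrier_mat n n" and c: "\<And>x. nrm n x \<le> 1 \<Longrightarrow> nrm n (mv n (entries n A) x) \<le> c"
  shows "op_norm A \<le> c"
  unfolding op_norm_def
proof (rule cSUP_least)
  show "{v \<in> carrier_vec (dim_col A). vec_norm2 v \<le> 1} \<noteq> {}"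
    using A by (auto intro!: exI[of _ "0\<^sub>v n"] simp: vec_norm2_def)
  fix v assume "v \<in> {v \<in> carrier_vec (dim_col A). vec_norm2 v \<le> 1}"
  then have "v \<in> carrier_vec n" "nrm n (\<lambda>i. v $ i) \<le> 1" using A by (auto simp: vec_norm2_eq_nrm)
  then show "vec_norm2 (A *\<^sub>v v) \<le> c" using c A by (simp add: vec_norm2_mult_eq)
qed

text \<open>The a priori bound b makes the set under the supremum bounded; it also settles vectors
  of norm 0, which cannot be rescaled to the unit ball.\<close>

lemma nrm_mv_le_op_norm:
  assumes A: "A \<in> carrier_mat n n" and b: "\<And>x. nrm n (mv n (entries n A) x) \<le> b * nrm n x" "0 \<le> b"
  shows "nrm n (mv n (entries n A) x) \<le> op_norm A * nrm n x" "0 \<le> op_norm A"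
proof -
  let ?V = "{v \<in> carrier_vec (dim_col A). vec_norm2 v \<le> 1}"
  have bdd: "bdd_above ((\<lambda>v. vec_norm2 (A *\<^sub>v v)) ` ?V)"
  proof (rule bdd_aboveI2)
    fix v assume "v \<in> ?V"
    then have v: "v \<in> carrier_vec n" "nrm n (\<lambda>i. v $ i) \<le> 1" using A by (auto simp: vec_norm2_eq_nrm)
    have "vec_norm2 (A *\<^sub>v v) \<le> b * nrm n (\<lambda>i. v $ i)" using b(1) v A by (simp add: vec_norm2_mult_eq)
    also have "\<dots> \<le> b" using v(2) b(2) by (simp add: mult_left_le)
    finally show "vec_norm2 (A *\<^sub>v v) \<le> b" .
  qed
  have unit: "nrm n (mv n (entries n A) y) \<le> op_norm A" if "nrm n y \<le> 1" for y
  proof -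
    let ?v = "vec n y"
    have 1: "nrm n (\<lambda>i. ?v $ i) = nrm n y" by (simp add: nrm_def ip_def)
    have 2: "mv n (entries n A) (\<lambda>i. ?v $ i) = mv n (entries n A) y" by (rule mv_cong) simp
    have "?v \<in> ?V" using A that 1 by (simp add: vec_norm2_eq_nrm[of _ n])
    then have "vec_norm2 (A *\<^sub>v ?v) \<le> op_norm A"
      unfolding op_norm_def using bdd by (rule cSUP_upper)
    then show ?thesis using A 2 by (simp add: vec_norm2_mult_eq)
  qed
  have z: "nrm n (\<lambda>_. 0) = 0" by (simp add: nrm_def ip_def)
  show "0 \<le> op_norm A" using unit[of "\<lambda>_. 0"] nrm_nonneg[of n "mv n (entries n A) (\<lambda>_. 0)"] z by simp
  show "nrm n (mv n (entries n A) x) \<le> op_norm A * nrm n x"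
  proof (cases "nrm n x = 0")
    case True then show ?thesis using b(1)[of x] by simp
  next
    case False
    then have pos: "0 < nrm n x" using nrm_nonneg[of n x] by simp
    have "nrm n (mv n (entries n A) (\<lambda>i. (1 / nrm n x) * x i)) \<le> op_norm A"
      by (rule unit) (use pos in \<open>simp only: nrm_scale, simp\<close>)
    then show ?thesis unfolding mv_scale nrm_scale using pos by (simp add: divide_le_eq)
  qed
qed

section \<open>The algorithm\<close>

definition prog_run :: com where
  "prog_run = Seq prog_pow (Seq prog_lam (Seq prog_count (Seq (For ''t'' ''T'' prog_body) prog_out)))"

text \<open>R = 0 means A = 0, and the initially zero array \<open>''B''\<close> is already the
  output.\<close>

definition prog_sparsify :: com where
  "prog_sparsify = Seq prog_setup (Cond (RLess (RConst 0) (RVar ''R'')) prog_run Skip)"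

lemma writes_setup [simp]: "iw prog_setup = {''i'', ''j''}" "rw prog_setup = {''R'', ''d''}" "aw prog_setup = {''S'', ''D'', ''M''}"
  by (auto simp: prog_setup_def prog_sign_def prog_rows_def prog_M_def)
lemma writes_sign [simp]: "iw prog_sign = {''i'', ''j''}" "rw prog_sign = {}" "aw prog_sign = {''S''}"
  by (auto simp: prog_sign_def)
lemma writes_rows [simp]: "iw prog_rows = {''i'', ''j''}" "rw prog_rows = {''R'', ''d''}" "aw prog_rows = {''D''}"
  by (auto simp: prog_rows_def)
lemma writes_M [simp]: "iw prog_M = {''i'', ''j''}" "rw prog_M = {}" "aw prog_M = {''M''}"
  by (auto simp: prog_M_def)
lemma writes_pow [simp]: "iw prog_pow = {''i'', ''j'', ''k'', ''l''}" "rw prog_pow = {''F'', ''d''}" "aw prog_pow = {''Y''}"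
  by (auto simp: prog_pow_def)
lemma writes_lam [simp]: "iw prog_lam = {''i''}" "rw prog_lam = {''lam'', ''p'', ''h''}" "aw prog_lam = {}"
  by (auto simp: prog_lam_def prog_halve_def)
lemma writes_count [simp]: "iw prog_count = {''T''}" "rw prog_count = {''u'', ''tau'', ''eta'', ''c''}" "aw prog_count = {}"
  by (auto simp: prog_count_def)

lemma runs_setup:
  assumes n: "ivar s ''n'' = n" and sym: "sym_on n (rarr s ''A'')"
    and Q: "\<And>s'. agree prog_setup s s' \<Longrightarrow> signed_matrix n (rarr s ''A'') (rvar s' ''R'') \<Longrightarrow>
      (\<And>i j. i < n \<Longrightarrow> j < n \<Longrightarrow> rarr s' ''S'' i j = signed_matrix.S (rarr s ''A'') i j) \<Longrightarrow>
      (\<And>i j. i < n \<Longrightarrow> j < n \<Longrightarrow> rarr s' ''M'' i j = signed_matrix.M n (rarr s ''A'') i j) \<Longrightarrow>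
      0 \<le> rvar s' ''R'' \<Longrightarrow> rvar s' ''R'' = 0 \<or> (\<exists>i<n. rvar s' ''R'' = (\<Sum>j<n. \<bar>rarr s ''A'' i j\<bar>)) \<Longrightarrow> Q s'"
  shows "runs prog_setup (n * (n * 78 + 72) + 26) s Q"
  unfolding prog_setup_def
proof (rule runs_Seq[where p = "n * (n * 30 + 16) + 8" and q = "n * (n * 48 + 56) + 18"], rule runs_sign[OF n])
  fix s1 assume a1: "agree prog_sign s s1"
    and S: "\<And>i j. i < n \<Longrightarrow> j < n \<Longrightarrow> rarr s1 ''S'' i j = (if rarr s ''A'' i j < 0 then -1 else 1)"
  have s1: "ivar s1 ''n'' = n" "rarr s1 ''A'' = rarr s ''A''" using agreeI[OF a1] agreeA[OF a1] n by auto
  show "runs (Seq prog_rows prog_M) (n * (n * 48 + 56) + 18) s1 Q"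
  proof (rule runs_Seq[where p = "n * (n * 18 + 40) + 10" and q = "n * (n * 30 + 16) + 8"], rule runs_rows[OF s1(1)])
    show "rarr s1 ''S'' i j * rarr s1 ''A'' i j = \<bar>rarr s1 ''A'' i j\<bar>" if "i < n" "j < n" for i j
      using S[OF that] s1 by simp
  next
    fix s2 assume a2: "agree prog_rows s1 s2" and D: "\<And>i. i < n \<Longrightarrow> rarr s2 ''D'' i 0 = (\<Sum>j<n. \<bar>rarr s1 ''A'' i j\<bar>)"
      and R: "\<And>i. i < n \<Longrightarrow> (\<Sum>j<n. \<bar>rarr s1 ''A'' i j\<bar>) \<le> rvar s2 ''R''" "0 \<le> rvar s2 ''R''"
        "rvar s2 ''R'' = 0 \<or> (\<exists>i<n. rvar s2 ''R'' = (\<Sum>j<n. \<bar>rarr s1 ''A'' i j\<bar>))"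
    have s2: "ivar s2 ''n'' = n" "rarr s2 ''A'' = rarr s ''A''" "rarr s2 ''S'' = rarr s1 ''S''"
      using agreeI[OF a2] agreeA[OF a2] s1 by auto
    show "runs prog_M (n * (n * 30 + 16) + 8) s2 Q"
    proof (rule runs_M[OF s2(1)])
      fix s3 assume a3: "agree prog_M s2 s3"
        and M: "\<And>i j. i < n \<Longrightarrow> j < n \<Longrightarrow> rarr s3 ''M'' i j = rarr s2 ''A'' i j + (if i = j then rarr s2 ''D'' i 0 else 0)"
      have sm: "signed_matrix n (rarr s ''A'') (rvar s2 ''R'')"
        by unfold_locales (use sym R(1) s1 in auto)
      have R3: "rvar s3 ''R'' = rvar s2 ''R''" using agreeR[OF a3] by simp
      have ag: "agree prog_setup s s1" "agree prog_setup s1 s2" "agree prog_setup s2 s3"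
        by (rule agree_mono[OF a1] agree_mono[OF a2] agree_mono[OF a3]; auto)+
      have "agree prog_setup s s3" using ag agree_trans by blast
      then show "Q s3"
      proof (rule Q)
        show "rarr s3 ''S'' i j = signed_matrix.S (rarr s ''A'') i j" if "i < n" "j < n" for i j
          using S[OF that] agreeA[OF a3] s2 by (simp add: signed_matrix.S_def[OF sm])
        show "rarr s3 ''M'' i j = signed_matrix.M n (rarr s ''A'') i j" if "i < n" "j < n" for i j
          using M[OF that] D s2 s1 that by (simp add: signed_matrix.M_def[OF sm])
      qed (use sm R s1 in \<open>simp_all add: R3\<close>)
    qed
  qed (auto simp: algebra_simps)
qed (auto simp: algebra_simps)

context signed_matrix begin

text \<open>\<open>a\<close> stands for the operator norm, known only through the power sum. The
  halving yields a/4 < lam \<le> a, so u = \<epsilon> lam/2 satisfies \<epsilon> a/8 < u and 2 u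
  \<le> \<epsilon> a: the first bounds the number of steps, the second the error.\<close>

lemma runs_run:
  fixes a \<epsilon> :: real
  assumes n: "ivar s ''n'' = n" "0 < n" and A: "rarr s ''A'' = A"
    and S: "\<And>i j. i < n \<Longrightarrow> j < n \<Longrightarrow> rarr s ''S'' i j = S i j"
    and M: "\<And>i j. i < n \<Longrightarrow> j < n \<Longrightarrow> rarr s ''M'' i j = M i j"
    and G: "rarr s ''G'' = (\<lambda>i j. 0)"
    and R: "rvar s ''R'' = R" and eps: "rvar s ''eps'' = \<epsilon>" "0 < \<epsilon>" "\<epsilon> < 1 / 2"
    and a: "0 < a" "a \<le> R" "a ^ (2 * n) \<le> power_sum n A n" "power_sum n A n \<le> n * a ^ (2 * n)"
    and N1: "2 * R / a \<le> real N1" and N: "384 * real n * (R / a)\<^sup>2 / \<epsilon>\<^sup>2 \<le> real N"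
    and Q: "\<And>s'. sym_on n (\<lambda>i j. rarr s' ''B'' i j - A i j) \<Longrightarrow>
      card {(i, j). i < n \<and> j < n \<and> rarr s' ''B'' i j \<noteq> 0} \<le> 4 * N + n \<Longrightarrow>
      (\<And>x. \<bar>bf n (\<lambda>i j. rarr s' ''B'' i j - A i j) x x\<bar> \<le> \<epsilon> * a * ip n x x) \<Longrightarrow> Q s'"
  shows "runs prog_run (n * (n * (n * (n * 18 + 40) + 60) + 40) + n * (n * 30 + 56) + N1 * 20
    + N * (n * (n * (n * 168 + 880) + 420) + 348) + 146) s Q"
  unfolding prog_run_def
proof (rule runs_Seq[where p = "n * (n * (n * (n * 18 + 40) + 60) + 40) + 10" and q = "n * (n * 30 + 56) + N1 * 20 + N * (n * (n * (n * 168 + 880) + 420) + 348) + 136"], rule runs_pow[OF n(1)])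
  fix s1 assume a1: "agree prog_pow s s1" and F: "rvar s1 ''F'' = power_sum n (rarr s ''A'') n"
  have s1: "ivar s1 ''n'' = n" "rvar s1 ''R'' = R" "a ^ (2 * n) \<le> rvar s1 ''F''"
    using agreeI[OF a1] agreeR[OF a1] n R F a A by auto
  show "runs (Seq prog_lam (Seq prog_count (Seq (For ''t'' ''T'' prog_body) prog_out)))
    (n * (n * 30 + 56) + N1 * 20 + N * (n * (n * (n * 168 + 880) + 420) + 348) + 136) s1 Q"
  proof (rule runs_Seq[where p = "N1 * 20 + n * 40 + 40" and q = "n * (n * 30 + 16) + N * (n * (n * (n * 168 + 880) + 420) + 348) + 96"],
      rule runs_lam[OF s1(1) n(2) s1(2) a(2,1) s1(3) N1])
    fix s2 assume a2: "agree prog_lam s1 s2" and lam: "0 < rvar s2 ''lam''" "rvar s2 ''lam'' \<le> R"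
      "n * rvar s2 ''lam'' ^ (2 * n) \<le> rvar s1 ''F''" "a < 4 * rvar s2 ''lam''"
    define u where "u = rvar s2 ''eps'' * rvar s2 ''lam'' / 2"
    have e2: "rvar s2 ''eps'' = \<epsilon>" using agreeR[OF a2] agreeR[OF a1] eps by simp
    have s2: "ivar s2 ''n'' = n" "rvar s2 ''R'' = R" using agreeI[OF a2] agreeR[OF a2] s1 by auto
    have u0: "0 < u" using e2 eps lam by (simp add: u_def)
    have "n * rvar s2 ''lam'' ^ (2 * n) \<le> n * a ^ (2 * n)" using lam(3) F A a(4) by simp
    then have "rvar s2 ''lam'' ^ (2 * n) \<le> a ^ (2 * n)" using n(2) by simp
    then have la: "rvar s2 ''lam'' \<le> a"
      using a(1) n(2) lam(1) power_mono_iff[of "rvar s2 ''lam''" a "2 * n"] by simp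
    have u_le: "2 * u \<le> \<epsilon> * a" using la eps e2 by (simp add: u_def)
    have "\<epsilon> * a / 8 \<le> u" using lam(4) eps e2 mult_left_mono[of a "4 * rvar s2 ''lam''" \<epsilon>] by (simp add: u_def)
    then have usq: "(\<epsilon> * a / 8)\<^sup>2 \<le> u\<^sup>2" using eps a by (intro power_mono) auto
    have "6 * R\<^sup>2 * n / u\<^sup>2 \<le> 6 * R\<^sup>2 * n / (\<epsilon> * a / 8)\<^sup>2"
      using usq eps a u0 by (intro divide_left_mono) auto
    \<comment> \<open>384 is 6 times 8^2, with the 8 from \<epsilon> a/8 \<le> u.\<close>
    also have "\<dots> = 384 * real n * (R / a)\<^sup>2 / \<epsilon>\<^sup>2" using eps a by (simp add: power2_eq_square field_simps)
    finally have N': "6 * R\<^sup>2 * n / u\<^sup>2 \<le> real N" using N by linarith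
    have R0: "0 < R" using a by simp
    \<comment> \<open>Required by the main loop; since 4 u = 2 \<epsilon> lam, it follows from
      \<epsilon> < 1/2 and lam \<le> R.\<close>
    have uR: "4 * u \<le> R"
    proof -
      have "\<epsilon> * rvar s2 ''lam'' \<le> 1 / 2 * R" using eps lam by (intro mult_mono) auto
      then show ?thesis by (simp add: u_def e2)
    qed
    show "runs (Seq prog_count (Seq (For ''t'' ''T'' prog_body) prog_out))
      (n * (n * 30 + 16) + N * (n * (n * (n * 168 + 880) + 420) + 348) + 96) s2 Q"
    proof (rule runs_Seq[where p = "N * 40 + 80" and q = "n * (n * 30 + 16) + N * (n * (n * (n * 168 + 880) + 420) + 308) + 16"],
        rule runs_count[OF s2(1) u_def u0 s2(2) N'])
      fix s3 T assume a3: "agree prog_count s2 s3" and T: "ivar s3 ''T'' = T" "6 * R\<^sup>2 * n \<le> T * u\<^sup>2" "T \<le> N"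
        and v3: "rvar s3 ''u'' = u" "rvar s3 ''tau'' = 1 / T" "rvar s3 ''eta'' = 6 * R\<^sup>2 * n * (1 / T)\<^sup>2 / u" "rvar s3 ''c'' = 0"
      have s3: "ivar s3 ''n'' = n" "rarr s3 ''A'' = A" "rarr s3 ''S'' = rarr s ''S''" "rarr s3 ''M'' = rarr s ''M''" "rarr s3 ''G'' = (\<lambda>i j. 0)"
        using agreeI[OF a3] agreeA[OF a3] agreeA[OF a2] agreeA[OF a1] s2 A G by auto
      have T0: "0 < T"
      proof (rule ccontr)
        assume "\<not> 0 < T"
        then have "6 * R\<^sup>2 * n \<le> 0" using T(2) by simp
        moreover have "0 < 6 * R\<^sup>2 * n" using R0 n(2) by simp
        ultimately show False by simp
      qed
      show "runs (Seq (For ''t'' ''T'' prog_body) prog_out)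
        (n * (n * 30 + 16) + N * (n * (n * (n * 168 + 880) + 420) + 308) + 16) s3 Q"
      proof (rule runs_Seq[where p = "T * (n * (n * (n * 168 + 880) + 420) + 308) + 8" and q = "n * (n * 30 + 16) + 8"],
          rule runs_main[OF s3(1) n(2) T(1) T0 s3(2) _ _ s3(5) R0 u0 uR v3(1,4,3,2) refl T(2)])
        fix s4 assume a4: "agree (For ''t'' ''T'' prog_body) s3 s4" and symG: "sym_on n (rarr s4 ''G'')"
          and cG: "card {(i, j). i < n \<and> j < n \<and> rarr s4 ''G'' i j \<noteq> 0} \<le> 4 * T"
          and bG: "\<And>x. \<bar>bf n (\<lambda>i j. rarr s4 ''G'' i j - M i j) x x\<bar> \<le> 2 * u * ip n x x"
        have s4: "ivar s4 ''n'' = n" "rarr s4 ''A'' = A" "rarr s4 ''M'' = rarr s ''M''"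
          using agreeI[OF a4] agreeA[OF a4] s3 by auto
        show "runs prog_out (n * (n * 30 + 16) + 8) s4 Q"
        proof (rule runs_out[OF s4(1)], rule Q)
          fix s5 assume B0: "\<And>i j. i < n \<Longrightarrow> j < n \<Longrightarrow> rarr s5 ''B'' i j = rarr s4 ''G'' i j - rarr s4 ''M'' i j + rarr s4 ''A'' i j"
          then have B: "rarr s5 ''B'' i j = rarr s4 ''G'' i j - M i j + A i j" if "i < n" "j < n" for i j
            using that by (simp add: s4 M)
          show "sym_on n (\<lambda>i j. rarr s5 ''B'' i j - A i j)"
            using symG M_sym by (simp add: sym_on_def B)
          \<comment> \<open>Off the diagonal \<open>M\<close> equals \<open>A\<close>, so the output
            equals \<open>G\<close> there; the diagonal adds at most n entries.\<close>
          have "{(i, j). i < n \<and> j < n \<and> rarr s5 ''B'' i j \<noteq> 0}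
            \<subseteq> {(i, j). i < n \<and> j < n \<and> rarr s4 ''G'' i j \<noteq> 0} \<union> (\<lambda>i. (i, i)) ` {..<n}"
            by (auto simp: B M_def split: if_splits)
          then have "card {(i, j). i < n \<and> j < n \<and> rarr s5 ''B'' i j \<noteq> 0}
            \<le> card ({(i, j). i < n \<and> j < n \<and> rarr s4 ''G'' i j \<noteq> 0} \<union> (\<lambda>i. (i, i)) ` {..<n})"
            by (rule card_mono[rotated]) (rule finite_subset[of _ "{..<n} \<times> {..<n}"], auto)
          also have "\<dots> \<le> card {(i, j). i < n \<and> j < n \<and> rarr s4 ''G'' i j \<noteq> 0} + card ((\<lambda>i. (i, i)) ` {..<n})"
            by (rule card_Un_le)
          also have "\<dots> \<le> 4 * N + n"
            using cG T(3) card_image_le[of "{..<n}" "\<lambda>i. (i, i)"] by simp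
          finally show "card {(i, j). i < n \<and> j < n \<and> rarr s5 ''B'' i j \<noteq> 0} \<le> 4 * N + n" .
          fix x
          have "bf n (\<lambda>i j. rarr s5 ''B'' i j - A i j) x x = bf n (\<lambda>i j. rarr s4 ''G'' i j - M i j) x x"
            by (rule bf_cong) (auto simp: B)
          then have "\<bar>bf n (\<lambda>i j. rarr s5 ''B'' i j - A i j) x x\<bar> \<le> 2 * u * ip n x x" using bG[of x] by simp
          also have "\<dots> \<le> \<epsilon> * a * ip n x x" using u_le ip_self_nonneg by (rule mult_right_mono)
          finally show "\<bar>bf n (\<lambda>i j. rarr s5 ''B'' i j - A i j) x x\<bar> \<le> \<epsilon> * a * ip n x x" .
        qed
      next
        show "T * (n * (n * (n * 168 + 880) + 420) + 308) + 8 + (n * (n * 30 + 16) + 8)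
          \<le> n * (n * 30 + 16) + N * (n * (n * (n * 168 + 880) + 420) + 308) + 16"
          using mult_le_mono1[OF T(3), of "n * (n * (n * 168 + 880) + 420) + 308"] by linarith
      qed (use s3 S M in auto)
    qed (auto simp: distrib_left)
  qed (auto simp: distrib_left)
qed auto

end

text \<open>With z = \<theta>/\<epsilon>^2 \<ge> 1 the barrier steps cost O(n^4 z), and z \<le> z^2.
  The remaining terms are at most n^4 or \<theta> up to constants, hence also bounded by multiples
  of K.\<close>

lemma time_bound:
  fixes x :: real
  assumes n: "1 \<le> n" and \<theta>: "1 \<le> \<theta>" and \<epsilon>: "0 < \<epsilon>" "\<epsilon> < 1" and l: "1 \<le> l" and N1: "real N1 \<le> 3 * \<theta>"
    and N: "real N \<le> 385 * (n * \<theta> / \<epsilon>\<^sup>2)"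
    and t: "t \<le> (n * (n * 78 + 72) + 26) + 8 + (n * (n * (n * (n * 18 + 40) + 60) + 40) + n * (n * 30 + 56) + N1 * 20
    + N * (n * (n * (n * 168 + 880) + 420) + 348) + 146)"
  shows "real t \<le> 1000000 * (real n ^ 4 * \<theta>\<^sup>2 * l / \<epsilon> ^ 4)"
proof -
  define K where "K = real n ^ 4 * \<theta>\<^sup>2 * l / \<epsilon> ^ 4"
  have n': "1 \<le> real n" using n by simp
  have p: "real n \<le> real n ^ 4" "real n ^ 2 \<le> real n ^ 4" "real n ^ 3 \<le> real n ^ 4" "1 \<le> real n ^ 4"
    using n' power_increasing[of 1 4 "real n"] power_increasing[of 2 4 "real n"] power_increasing[of 3 4 "real n"]
      power_increasing[of 0 4 "real n"] by auto
  have q: "real n \<le> real n ^ 3" "real n ^ 2 \<le> real n ^ 3" "1 \<le> real n ^ 3"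
    using n' power_increasing[of 1 3 "real n"] power_increasing[of 2 3 "real n"]
      power_increasing[of 0 3 "real n"] by auto
  have ie: "1 \<le> 1 / \<epsilon>\<^sup>2" using \<epsilon> by (simp add: power_le_one)
  define z where "z = \<theta> / \<epsilon>\<^sup>2"
  have z: "\<theta> \<le> z" "1 \<le> z" using \<epsilon> \<theta> ie mult_left_mono[OF ie, of \<theta>] by (auto simp: z_def)
  have zz: "z \<le> z\<^sup>2" using mult_left_mono[of 1 z z] z by (simp add: power2_eq_square)
  have Kz: "K = real n ^ 4 * z\<^sup>2 * l" by (simp add: K_def z_def power_divide flip: power_mult)
  have "real n ^ 4 * z\<^sup>2 * 1 \<le> K" unfolding Kz using l by (intro mult_left_mono) auto
  moreover have "real n ^ 4 * z \<le> real n ^ 4 * z\<^sup>2" using zz by (intro mult_left_mono) auto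
  ultimately have K1: "real n ^ 4 * z \<le> K" by linarith
  have "real n ^ 4 * 1 \<le> real n ^ 4 * z" using z by (intro mult_left_mono) auto
  then have K2: "real n ^ 4 \<le> K" using K1 by simp
  have "1 * z \<le> real n ^ 4 * z" using p z by (intro mult_right_mono) auto
  then have K3: "\<theta> \<le> K" using K1 z by linarith
  \<comment> \<open>1816 = 168 + 880 + 420 + 348: every power of n is rounded up to n^3.\<close>
  have "real N * (real n * (real n * (real n * 168 + 880) + 420) + 348) \<le> (385 * (n * \<theta> / \<epsilon>\<^sup>2)) * (1816 * real n ^ 3)"
  proof (intro mult_mono N)
    have "real n * (real n * (real n * 168 + 880) + 420) + 348 = 168 * real n ^ 3 + 880 * real n ^ 2 + 420 * real n + 348"
      by (simp add: algebra_simps power2_eq_square power3_eq_cube)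
    then show "real n * (real n * (real n * 168 + 880) + 420) + 348 \<le> 1816 * real n ^ 3" using q by linarith
  qed (use \<theta> in auto)
  also have "\<dots> = 699160 * (real n ^ 4 * z)" by (simp add: z_def power4_eq_xxxx power3_eq_cube)
  finally have main: "real N * (real n * (real n * (real n * 168 + 880) + 420) + 348) \<le> 699160 * K" using K1 by linarith
  have "real t \<le> real ((n * (n * 78 + 72) + 26) + 8 + (n * (n * (n * (n * 18 + 40) + 60) + 40) + n * (n * 30 + 56) + N1 * 20
    + N * (n * (n * (n * 168 + 880) + 420) + 348) + 146))" using t by (simp only: of_nat_le_iff)
  also have "\<dots> = 18 * real n ^ 4 + 40 * real n ^ 3 + 168 * real n ^ 2 + 168 * real n + 180 + 20 * real N1
    + real N * (real n * (real n * (real n * 168 + 880) + 420) + 348)"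
    by (simp add: algebra_simps power2_eq_square power3_eq_cube power4_eq_xxxx)
  also have "\<dots> \<le> 1000000 * K" using p K2 K3 N1 main by linarith
  finally show ?thesis by (simp add: K_def)
qed

lemma nat_ceiling_le: "0 \<le> x \<Longrightarrow> real (nat \<lceil>x\<rceil>) \<le> x + 1"
  by linarith

lemma prog_sparsify_correct:
  assumes n: "1 \<le> n" and \<theta>: "1 \<le> \<theta>" and A: "A \<in> carrier_mat n n" and sdd: "sdd \<theta> A" and \<epsilon>: "0 < \<epsilon>" "\<epsilon> < 1 / 2"
  shows "\<exists>t B. computes prog_sparsify n A \<epsilon> t B \<and> B \<in> carrier_mat n n \<and>
    real (nnz B) \<le> 1000000 * (real n * \<theta> / \<epsilon>\<^sup>2) \<and> op_norm (A - B) \<le> \<epsilon> * op_norm A \<and>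
    real t \<le> 1000000 * hidden_factor n \<epsilon> ^ 0 *
      (real (nnz A) * real n ^ 2 * \<theta> * lg n ^ 3 / \<epsilon>\<^sup>2 + real n ^ 4 * \<theta>\<^sup>2 * lg n / \<epsilon> ^ 4)"
proof -
  let ?s = "input_state n A \<epsilon>"
  let ?A = "entries n A"
  define a where "a = op_norm A"
  \<comment> \<open>Bounds the number of halvings, since 2 R/a \<le> 2 sqrt \<theta> for a
    \<theta>-SDD matrix.\<close>
  define N1 where "N1 = nat \<lceil>2 * sqrt \<theta>\<rceil>"
  define N where "N = nat \<lceil>384 * real n * \<theta> / \<epsilon>\<^sup>2\<rceil>"
  have s: "ivar ?s ''n'' = n" "rvar ?s ''eps'' = \<epsilon>" "rarr ?s ''A'' = ?A" "rarr ?s ''G'' = (\<lambda>i j. 0)" "rarr ?s ''B'' = (\<lambda>i j. 0)"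
    by (auto simp: input_state_def entries_def fun_eq_iff)
  have symA: "sym_on n ?A"
    unfolding sym_on_def
  proof (intro allI impI)
    fix i j assume ij: "i < n" "j < n"
    have "A $$ (i, j) = transpose_mat A $$ (i, j)" using sdd by (simp add: sdd_def)
    also have "\<dots> = A $$ (j, i)" using A ij by simp
    finally show "?A i j = ?A j i" using ij by (simp add: entries_def)
  qed
  have Kge: "1 \<le> n * \<theta> / \<epsilon>\<^sup>2"
  proof -
    have "\<epsilon>\<^sup>2 \<le> 1" using \<epsilon> by (simp add: power_le_one)
    also have "1 \<le> n * \<theta>" using n \<theta> mult_mono[of 1 "real n" 1 \<theta>] by simp
    finally show ?thesis using \<epsilon> by simp
  qed
  have nK: "n \<le> n * \<theta> / \<epsilon>\<^sup>2"
  proof -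
    have "n * \<epsilon>\<^sup>2 \<le> n * \<theta>" using \<epsilon> \<theta> power_le_one[of \<epsilon> 2] by (intro mult_left_mono) auto
    then show ?thesis using \<epsilon> by (simp add: le_divide_eq)
  qed
  have N_le: "real N \<le> 385 * (n * \<theta> / \<epsilon>\<^sup>2)"
  proof -
    have aux: "x \<le> 384 * y + 1 \<Longrightarrow> 1 \<le> y \<Longrightarrow> x \<le> 385 * y" for x y :: real by linarith
    have "real N \<le> 384 * real n * \<theta> / \<epsilon>\<^sup>2 + 1"
      unfolding N_def using \<theta> by (intro nat_ceiling_le) auto
    also have "384 * real n * \<theta> / \<epsilon>\<^sup>2 = 384 * (n * \<theta> / \<epsilon>\<^sup>2)" by simp
    finally show ?thesis using Kge by (rule aux)
  qed
  have N1_le: "real N1 \<le> 3 * \<theta>"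
  proof -
    have "sqrt \<theta> \<le> \<theta>" using \<theta> real_sqrt_le_mono[of \<theta> "\<theta>\<^sup>2"] by (simp add: self_le_power)
    moreover have "real N1 \<le> 2 * sqrt \<theta> + 1" unfolding N1_def using \<theta> by (intro nat_ceiling_le) auto
    ultimately show ?thesis using \<theta> by linarith
  qed
  let ?good = "\<lambda>s'. sym_on n (\<lambda>i j. rarr s' ''B'' i j - ?A i j) \<and>
      card {(i, j). i < n \<and> j < n \<and> rarr s' ''B'' i j \<noteq> 0} \<le> 4 * N + n \<and>
      (\<forall>x. \<bar>bf n (\<lambda>i j. rarr s' ''B'' i j - ?A i j) x x\<bar> \<le> \<epsilon> * a * ip n x x) \<and> 0 \<le> a"
  let ?b = "n * (n * (n * (n * 18 + 40) + 60) + 40) + n * (n * 30 + 56) + N1 * 20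
    + N * (n * (n * (n * 168 + 880) + 420) + 348) + 146"
  have "runs prog_sparsify ((n * (n * 78 + 72) + 26) + (8 + ?b)) ?s ?good"
    unfolding prog_sparsify_def
  proof (rule runs_Seq[where p = "n * (n * 78 + 72) + 26" and q = "8 + ?b"], rule runs_setup[OF s(1)], unfold s)
    fix s1 assume a1: "agree prog_setup ?s s1" and sm: "signed_matrix n ?A (rvar s1 ''R'')"
      and S: "\<And>i j. i < n \<Longrightarrow> j < n \<Longrightarrow> rarr s1 ''S'' i j = signed_matrix.S ?A i j"
      and M: "\<And>i j. i < n \<Longrightarrow> j < n \<Longrightarrow> rarr s1 ''M'' i j = signed_matrix.M n ?A i j"
      and R0: "0 \<le> rvar s1 ''R''" and R1: "rvar s1 ''R'' = 0 \<or> (\<exists>i<n. rvar s1 ''R'' = (\<Sum>j<n. \<bar>?A i j\<bar>))"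
    define R where "R = rvar s1 ''R''"
    interpret signed_matrix n ?A R using sm by (simp add: R_def)
    have s1: "ivar s1 ''n'' = n" "rvar s1 ''eps'' = \<epsilon>" "rarr s1 ''A'' = ?A" "rarr s1 ''G'' = (\<lambda>i j. 0)" "rarr s1 ''B'' = (\<lambda>i j. 0)"
      using agreeI[OF a1] agreeR[OF a1] agreeA[OF a1] s by auto
    have bnd: "nrm n (mv n ?A x) \<le> R * nrm n x" for x using nrm_mv_le R0 by (simp add: R_def)
    have mva: "nrm n (mv n ?A x) \<le> a * nrm n x" and a0: "0 \<le> a" for x
      using nrm_mv_le_op_norm[OF A bnd] R0 by (auto simp: a_def R_def)
    have aR: "a \<le> R"
      unfolding a_def
    proof (rule op_norm_le[OF A])
      fix x assume "nrm n x \<le> 1"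
      then have "R * nrm n x \<le> R" using R0 by (simp add: R_def mult_left_le)
      then show "nrm n (mv n ?A x) \<le> R" using bnd[of x] by linarith
    qed
    show "runs (Cond (RLess (RConst 0) (RVar ''R'')) prog_run Skip) (8 + ?b) s1 ?good"
    proof (rule runs_Cond[where b' = ?b])
      assume "tval (RLess (RConst 0) (RVar ''R'')) s1"
      then have Rpos: "0 < R" by (simp add: R_def)
      then obtain i where i: "i < n" "R = (\<Sum>j<n. \<bar>?A i j\<bar>)" using R1 by (auto simp: R_def)
      \<comment> \<open>\<open>R\<close> is attained by a row, so it is one of the values under the
        \<open>Max\<close>. The SDD inequality then turns into R \<le> sqrt \<theta> a, which is how
        \<theta> enters the bounds.\<close>
      have "R \<le> inf_norm A"
        unfolding inf_norm_def
      proof (rule Max_ge)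
        have "R = (\<Sum>j<dim_col A. \<bar>A $$ (i, j)\<bar>)" using i A by (auto simp: entries_def intro!: sum.cong)
        then show "R \<in> (\<lambda>i. \<Sum>j<dim_col A. \<bar>A $$ (i, j)\<bar>) ` {..<dim_row A}" using i A by auto
      qed simp
      then have Ra: "R \<le> sqrt \<theta> * a" using sdd by (simp add: sdd_def a_def)
      have apos: "0 < a"
      proof (rule ccontr)
        assume "\<not> 0 < a"
        then have "a = 0" using a0 by simp
        then show False using Ra Rpos by simp
      qed
      have sq: "R / a \<le> sqrt \<theta>" using Ra apos by (simp add: divide_le_eq)
      have N1': "2 * R / a \<le> real N1" unfolding N1_def using sq by linarith
      have "(R / a)\<^sup>2 \<le> (sqrt \<theta>)\<^sup>2" using sq Rpos apos by (intro power_mono) auto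
      then have "384 * real n * (R / a)\<^sup>2 / \<epsilon>\<^sup>2 \<le> 384 * real n * \<theta> / \<epsilon>\<^sup>2"
        using \<theta> by (intro divide_right_mono mult_left_mono) auto
      then have N': "384 * real n * (R / a)\<^sup>2 / \<epsilon>\<^sup>2 \<le> real N" unfolding N_def by linarith
      have F0: "0 \<le> power_sum n ?A n" unfolding power_sum_def by (intro sum_nonneg ip_self_nonneg)
      \<comment> \<open>The power bound is known vector by vector; in the form of a 2n-th root it
        passes to the supremum.\<close>
      have "a \<le> root (2 * n) (power_sum n ?A n)"
        unfolding a_def
      proof (rule op_norm_le[OF A])
        fix x assume "nrm n x \<le> 1"
        then have "nrm n (mv n ?A x) ^ (2 * n) \<le> power_sum n ?A n" using power_sum_lower[OF symA] n by simp
        then have "root (2 * n) (nrm n (mv n ?A x) ^ (2 * n)) \<le> root (2 * n) (power_sum n ?A n)"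
          using n by (intro real_root_le_mono) auto
        then show "nrm n (mv n ?A x) \<le> root (2 * n) (power_sum n ?A n)"
          using n nrm_nonneg by (simp add: real_root_power_cancel)
      qed
      then have "a ^ (2 * n) \<le> root (2 * n) (power_sum n ?A n) ^ (2 * n)" using a0 by (intro power_mono) auto
      then have lo: "a ^ (2 * n) \<le> power_sum n ?A n" using n F0 by (simp add: real_root_pow_pos2)
      have hi: "power_sum n ?A n \<le> n * a ^ (2 * n)" by (rule power_sum_upper[OF mva a0])
      have n0: "0 < n" using n by simp
      show "runs prog_run ?b s1 ?good"
        by (rule runs_run[OF s1(1) n0 s1(3) S M s1(4) R_def[symmetric] s1(2) \<epsilon> apos aR lo hi N1' N'])
          (use a0 in auto)
    next
      assume "\<not> tval (RLess (RConst 0) (RVar ''R'')) s1"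
      \<comment> \<open>All absolute row sums vanish, so the matrix is zero and nothing has to be
        computed.\<close>
      then have "R = 0" using R0 by (simp add: R_def)
      have zero: "?A i j = 0" if "i < n" "j < n" for i j
      proof -
        have "(\<Sum>j<n. \<bar>?A i j\<bar>) \<le> 0" using row_le[OF that(1)] \<open>R = 0\<close> by simp
        then have "(\<Sum>j<n. \<bar>?A i j\<bar>) = 0" by (meson abs_ge_zero antisym sum_nonneg)
        then show ?thesis using that by (simp add: sum_nonneg_eq_0_iff)
      qed
      have "bf n (\<lambda>i j. 0 - ?A i j) x x = 0" for x using zero by (simp add: bf_def)
      then have "?good s1" using zero a0 \<epsilon> by (auto simp: s1 sym_on_def ip_self_nonneg)
      then show "runs Skip ?b s1 ?good" by (intro runs_loop_free) auto
    qed simp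
  qed (use symA in auto)
  then obtain t s' where ex: "exec prog_sparsify ?s t s'" and t: "t \<le> (n * (n * 78 + 72) + 26) + (8 + ?b)" and good: "?good s'"
    unfolding runs_def by blast
  let ?B = "output_mat n s'"
  have B: "?B \<in> carrier_mat n n" by (simp add: output_mat_def)
  have "nnz ?B = card {(i, j). i < n \<and> j < n \<and> rarr s' ''B'' i j \<noteq> 0}"
    unfolding nnz_def output_mat_def by (intro arg_cong[where f = card]) auto
  then have "real (nnz ?B) \<le> real (4 * N + n)" using good by (simp only: of_nat_le_iff)
  also have "\<dots> = 4 * real N + real n" by simp
  also have "\<dots> \<le> 1000000 * (real n * \<theta> / \<epsilon>\<^sup>2)"
  proof -
    have aux: "x \<le> 385 * y \<Longrightarrow> z \<le> y \<Longrightarrow> 1 \<le> y \<Longrightarrow> 4 * x + z \<le> 1000000 * y" for x y z :: real by linarith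
    show ?thesis using N_le nK Kge by (rule aux)
  qed
  finally have nz: "real (nnz ?B) \<le> 1000000 * (real n * \<theta> / \<epsilon>\<^sup>2)" .
  have AB: "A - ?B \<in> carrier_mat n n" using B by (rule minus_carrier_mat)
  let ?X = "entries n (A - ?B)"
  have X: "?X i j = - 1 * (rarr s' ''B'' i j - ?A i j)" if "i < n" "j < n" for i j
    using that A by (simp add: entries_def output_mat_def)
  have opn: "op_norm (A - ?B) \<le> \<epsilon> * a"
  proof (rule op_norm_le[OF AB])
    fix x assume x: "nrm n x \<le> 1"
    have "nrm n (mv n ?X x) \<le> \<epsilon> * a * nrm n x"
    proof (rule nrm_le_of_form)
      show "sym_on n ?X" using good by (auto simp: sym_on_def X)
      fix y
      have "bf n ?X y y = bf n (\<lambda>i j. - 1 * (rarr s' ''B'' i j - ?A i j)) y y" by (rule bf_cong) (auto simp: X)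
      also have "\<dots> = - bf n (\<lambda>i j. rarr s' ''B'' i j - ?A i j) y y" unfolding bf_scale_mat by simp
      finally show "\<bar>bf n ?X y y\<bar> \<le> \<epsilon> * a * ip n y y" using good by simp
    qed (use good \<epsilon> in simp)
    also have "\<dots> \<le> \<epsilon> * a" using x good \<epsilon> by (simp add: mult_left_le)
    finally show "nrm n (mv n ?X x) \<le> \<epsilon> * a" .
  qed
  have lg: "1 \<le> lg n"
  proof -
    have "log 2 2 \<le> log 2 (real n + 1)" using n by (intro log_mono) auto
    then show ?thesis by (simp add: lg_def)
  qed
  have "real t \<le> 1000000 * (real n ^ 4 * \<theta>\<^sup>2 * lg n / \<epsilon> ^ 4)"
    by (rule time_bound[OF n \<theta> \<epsilon>(1) _ lg N1_le N_le]) (use \<epsilon> t in auto)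
  moreover have "0 \<le> real (nnz A) * real n ^ 2 * \<theta> * lg n ^ 3 / \<epsilon>\<^sup>2" using \<theta> lg by simp
  ultimately have "real t \<le> 1000000 * hidden_factor n \<epsilon> ^ 0 *
    (real (nnz A) * real n ^ 2 * \<theta> * lg n ^ 3 / \<epsilon>\<^sup>2 + real n ^ 4 * \<theta>\<^sup>2 * lg n / \<epsilon> ^ 4)" by simp
  then show ?thesis using ex B nz opn unfolding computes_def a_def by blast
qed

theorem theorem10:
  shows "\<exists>(P :: com) (C :: real) (k :: nat). C > 0 \<and>
    (\<forall>(n :: nat) (\<theta> :: real) (A :: real mat) (\<epsilon> :: real).
      n \<ge> 1 \<longrightarrow> \<theta> \<ge> 1 \<longrightarrow> A \<in> carrier_mat n n \<longrightarrow> sdd \<theta> A \<longrightarrow> 0 < \<epsilon> \<longrightarrow> \<epsilon> < 1/2 \<longrightarrow>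
      (\<exists>(t :: nat) (B :: real mat).
        computes P n A \<epsilon> t B \<and>
        B \<in> carrier_mat n n \<and>
        real (nnz B) \<le> C * (real n * \<theta> / \<epsilon>^2) \<and>
        op_norm (A - B) \<le> \<epsilon> * op_norm A \<and>
        real t \<le> C * hidden_factor n \<epsilon> ^ k *
          (real (nnz A) * real n ^ 2 * \<theta> * lg n ^ 3 / \<epsilon>^2
            + real n ^ 4 * \<theta>^2 * lg n / \<epsilon>^4)))"
  by (rule exI[of _ prog_sparsify], rule exI[of _ 1000000], rule exI[of _ 0])
    (intro conjI allI impI prog_sparsify_correct; simp)

end
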